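(* For $0<|q|<1$ we have $$\chi_4(1,1,1,1;q^2)=\frac{(-q;q^2)_{\infty}}{(q^2;q^2)_{\infty}}\left(\frac{J_4^5J_{12}J_{4,24}J_{10,24}}{J_1J_2^2J_8^2J_{24}^2}+2q\frac{J_8^2J_{12}J_{5,12}J_{2,24}^2J_{10,24}}{J_1J_4J_{1,12}J_{4,24}J_{24}^2}\right),$$ $$\chi_4(1,q^{-2},q^2,1;q^2)=\frac{(-q;q^2)_{\infty}}{(q^2;q^2)_{\infty}}\left(\frac{J_4^5J_{24}^3}{J_1J_2J_8^3J_{2,24}J_{10,24}}+2\frac{J_2J_8J_{24}^3}{J_1J_4J_{4,24}^2}\right),$$ $$\chi_4(1,1,1,q;q^2)=\frac{(-q^2;q^2)_{\infty}}{(q^2;q^2)_{\infty}}\left(\frac{J_4^5J_{12}^6}{J_2^3J_6^3J_8^2J_{2,24}J_{10,24}}+4q^2\frac{J_8^2J_{24}^4}{J_2J_4J_6J_{2,24}J_{10,24}}\right),$$ $$\chi_4(q^2,q^{-2},q^2,1;q^2)=\frac{(-q;q^2)_{\infty}}{(q^2;q^2)_{\infty}}\left(q\frac{J_4^5J_{24}^3}{J_1J_2J_8^3J_{6,24}J_{10,24}}+2\frac{J_8^3J_{12}^3J_{24}^2J_{10,24}}{J_3J_4^3J_{5,24}^2J_{7,24}^2}\right).$$ Moreover, assume that the following (conjectural) identity holds for $|q|<1$: $$\sum_{n_1,n_2,n_3\geq0}\frac{q^{4n_1^2+4n_1n_2+3n_2^2-2n_2n_3+n_3^2+4n_1+2n_2}}{(q^4;q^4)_{n_1}(q^4;q^4)_{n_2}(q^4;q^4)_{n_3}}=\frac{(q^6;q^6)_{\infty}(q^8;q^8)_{\infty}(q^2,q^{10};q^{12})_{\infty}}{(q^4;q^4)_{\infty}^2(q,q^{11};q^{12})_{\infty}(q^5,q^7;q^{12})_{\infty}}.$$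 Then also $$\chi_4(q^2,q^{-2},q^2,q^{-1};q^2)=\frac{(-1;q^2)_{\infty}}{(q^2;q^2)_{\infty}}\left(\frac{J_4^5J_{12}^2J_{24}^7}{J_2^2J_6^2J_8^3J_{2,24}^3J_{10,24}^3}+2\frac{J_8^3J_{12}^2}{J_2^2J_4J_{24}}\right).$$
   Context: $(a;q)_n=\prod_{k=0}^{n-1}(1-aq^k)$, $(a;q)_\infty=\prod_{k=0}^\infty(1-aq^k)$ for $|q|<1$, and $(a_1,\dots,a_m;q)_\infty=(a_1;q)_\infty\cdots(a_m;q)_\infty$. Notation: $J_m=(q^m;q^m)_\infty$ and $J_{a,m}=(q^a,q^{m-a},q^m;q^m)_\infty$. The tadpole Cartan matrix $T_r=(a_{ij})_{r\times r}$ has $a_{rr}=1$, $a_{ii}=2$ for $i<r$, $a_{ij}=-1$ for $|i-j|=1$, and $a_{ij}=0$ otherwise. The generalized tadpole Nahm sum is $$\chi_r(x_1,\dots,x_r;q)=\sum_{n=(n_1,\dots,n_r)^{\mathrm T}\in(\mathbb{Z}_{\ge0})^r}\frac{q^{\frac12 n^{\mathrm T}T_r n}x_1^{n_1}\cdots x_r^{n_r}}{(q;q)_{n_1}\cdots (q;q)_{n_r}}.$$ Thus $\chi_4(x_1,\dots,x_4;q^2)=\sum_{n\in(\mathbb{Z}_{\ge 0})^4} q^{n^{\mathrm T}T_4n}x_1^{n_1}x_2^{n_2}x_3^{n_3}x_4^{n_4}/\big((q^2;q^2)_{n_1}\cdots(q^2;q^2)_{n_4}\big)$. *)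

theory Defs
  imports "HOL-Analysis.Analysis"
begin

definition qpoch :: "complex \<Rightarrow> complex \<Rightarrow> nat \<Rightarrow> complex" where
  "qpoch a q n = (\<Prod>k<n. 1 - a * q ^ k)"

definition qpoch_inf :: "complex \<Rightarrow> complex \<Rightarrow> complex" where
  "qpoch_inf a q = (\<Prod>k. 1 - a * q ^ k)"

definition qpochs_inf :: "complex list \<Rightarrow> complex \<Rightarrow> complex" where
  "qpochs_inf as q = prod_list (map (\<lambda>a. qpoch_inf a q) as)"

definition J :: "complex \<Rightarrow> nat \<Rightarrow> complex" where
  "J q m = qpoch_inf (q ^ m) (q ^ m)"

(* J_{a,m} as a function of q. The natural-number subtraction m - a is meant for a \<le> m. *)
definition JJ :: "complex \<Rightarrow> nat \<Rightarrow> nat \<Rightarrow> complex" where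
  "JJ q a m = qpochs_inf [q ^ a, q ^ (m - a), q ^ m] (q ^ m)"

(* The r x r tadpole Cartan matrix with indices shifted to 0, ..., r - 1, so that the
   exceptional diagonal entry 1 sits at index r - 1. *)
definition tadpole :: "nat \<Rightarrow> nat \<Rightarrow> nat \<Rightarrow> int" where
  "tadpole r i j =
     (if i = j then (if Suc i = r then 1 else 2)
      else if i = Suc j \<or> j = Suc i then -1
      else 0)"

definition tadpole_form :: "nat list \<Rightarrow> int" where
  "tadpole_form n =
     (\<Sum>i<length n. \<Sum>j<length n. int (n ! i) * tadpole (length n) i j * int (n ! j))"

(* chi_sq [x_1, ..., x_r] q is the generalized tadpole Nahm sum chi_r(x_1, ..., x_r; q^2).
   The general term of chi_r(x; t) contains t^(n^T T_r n / 2), which for t = q^2 is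
   q^(n^T T_r n); taking the square root q of t as the argument avoids a choice of branch. *)
definition chi_sq :: "complex list \<Rightarrow> complex \<Rightarrow> complex" where
  "chi_sq x q =
     (\<Sum>\<^sub>\<infinity>n\<in>{n :: nat list. length n = length x}.
        q powi tadpole_form n * (\<Prod>i<length x. (x ! i) ^ (n ! i)) /
        (\<Prod>i<length x. qpoch (q\<^sup>2) (q\<^sup>2) (n ! i)))"

end

theory Submission
  imports Defs
begin

text \<open>Put t = q^2 and let (a)_n be the shifted factorial with base t. All five sums are first turned into bilinear
forms in the theta series \<open>qsum a b t\<close> = Sum_{n in Z} t^(a n^2 + b n); these forms are then recognised as infinite products.

Summing out variables. The last index d enters the summand only through q^(d^2 - 2 N d) x4^d / (t)_d, where N is the
third index, so Euler's series sums it and leaves a weight in N (\<open>chi_reduction\<close>). The first two indices n1, n2 are removed together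
(\<open>rank_reduction\<close>): since 1/(t)_{n1} = (t^(n1+1))_inf / (t)_inf vanishes for negative n1, the sum over n1 may run over
all integers; expanding the numerator by Euler's series in a new index m, n1 occurs only in a complete square, and its sum is a theta
series that depends only on the parity of k = n2 + m. For fixed k the remaining sum is a terminating
q-binomial sum. What is left is a single sum over k of q-powers times
V(k) = Sum_j q^(j^2) w(k + j) / (t)_j, where w is the weight of the third index, and the even and the odd k each carry their own theta series.

One-variable sums. For the weights that occur, V(k) is found either from the even and odd parts of Euler's series or from Lebesgue's identity.
The sums over even and over odd k are then identities of Rogers-Ramanujan type. They follow from one Bailey pair with
a free parameter (\<open>bailey_pair\<close>), inserted into the limiting q-Gauss sum (\<open>has_sum_bailey\<close>). In the sum with arguments
(1, q^(-2), q^2, 1) the weight becomes a difference of two shifted factorials after moving N to N + 1, and one more telescoping relation is needed.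

Products. The theta series are products by the Jacobi triple product. In two of the bilinear forms there occur sums and
differences of theta series, such as Sum t^(n^2) + Sum t^(3 n^2); these combinations are also products, by four instances of the
three-term theta relation (\<open>theta_addition\<close>). After that each product is a monomial in the factors
(q^j; q^24)_inf, and the theorem is a comparison of monomials.\<close>

section \<open>Shifted factorials and multiple sums\<close>

lemma qpoch_0 [simp]: "qpoch a q 0 = 1"
  by (simp add: qpoch_def)

lemma qpoch_Suc: "qpoch a q (Suc n) = qpoch a q n * (1 - a * q ^ n)"
  by (simp add: qpoch_def)

lemma qpoch_zero_left [simp]: "qpoch 0 q n = 1"
  by (simp add: qpoch_def)

lemma qpoch_add: "qpoch a q (m + n) = qpoch a q m * qpoch (a * q ^ m) q n"
  by (induction n) (simp_all add: qpoch_Suc power_add mult_ac)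

lemma qpoch_Suc_left: "qpoch a q (Suc n) = (1 - a) * qpoch (a * q) q n"
  using qpoch_add[of a q 1 n] by (simp add: qpoch_def)

lemma qpoch_eq_0_iff: "qpoch a q n = 0 \<longleftrightarrow> (\<exists>k<n. a * q ^ k = 1)"
  by (auto simp: qpoch_def)

lemma mult_power_neq_1:
  fixes a q :: complex
  assumes "norm q < 1" "norm a \<le> 1" "a \<noteq> 1"
  shows "a * q ^ k \<noteq> 1"
proof (cases "k = 0")
  case False
  have "norm (a * q ^ k) \<le> 1 * norm q ^ k"
    unfolding norm_mult norm_power using assms by (intro mult_right_mono) auto
  also have "\<dots> < 1"
    using assms False by (simp add: power_less_one_iff)
  finally show ?thesis by auto
qed (use assms in auto)

lemma qpoch_nonzero:
  assumes "norm q < 1" "norm a \<le> 1" "a \<noteq> 1"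
  shows "qpoch a q n \<noteq> 0"
  using mult_power_neq_1[OF assms] by (auto simp: qpoch_eq_0_iff)

lemma norm_less_1_neq_1: "norm (q::complex) < 1 \<Longrightarrow> q \<noteq> 1"
  by auto

lemma self_mult_power_neq_1:
  fixes q :: complex
  shows "norm q < 1 \<Longrightarrow> q * q ^ k \<noteq> 1"
  using mult_power_neq_1[of q q k] norm_less_1_neq_1[of q] by auto

lemma qpoch_nonzero_less [simp]: "norm q < 1 \<Longrightarrow> norm a < 1 \<Longrightarrow> qpoch a q n \<noteq> 0"
  by (rule qpoch_nonzero) auto

lemma qpoch_self_nonzero [simp]: "norm q < 1 \<Longrightarrow> qpoch q q n \<noteq> 0"
  by (intro qpoch_nonzero) auto

lemma convergent_prod_qpoch:
  fixes a q :: complex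
  assumes "norm q < 1"
  shows "convergent_prod (\<lambda>k. 1 - a * q ^ k)"
proof (rule abs_convergent_prod_imp_convergent_prod)
  have "summable (\<lambda>k. norm a * norm q ^ k)"
    using assms by (intro summable_mult summable_geometric) auto
  thus "abs_convergent_prod (\<lambda>k. 1 - a * q ^ k)"
    by (intro summable_imp_abs_convergent_prod) (simp add: norm_mult norm_power)
qed

lemma qpoch_tendsto:
  assumes "norm q < 1"
  shows "qpoch a q \<longlonglongrightarrow> qpoch_inf a q"
proof -
  have "(\<lambda>n. \<Prod>k\<le>n. 1 - a * q ^ k) \<longlonglongrightarrow> qpoch_inf a q"
    unfolding qpoch_inf_def by (rule convergent_prod_LIMSEQ[OF convergent_prod_qpoch[OF assms]])
  hence "(\<lambda>n. qpoch a q (Suc n)) \<longlonglongrightarrow> qpoch_inf a q"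
    by (simp add: qpoch_def lessThan_Suc_atMost)
  thus ?thesis by (rule LIMSEQ_imp_Suc)
qed

lemma qpoch_inf_nonzero_iff:
  assumes "norm q < 1"
  shows "qpoch_inf a q \<noteq> 0 \<longleftrightarrow> (\<forall>k. a * q ^ k \<noteq> 1)"
proof -
  have "(\<lambda>k. 1 - a * q ^ k) has_prod qpoch_inf a q"
    using convergent_prod_qpoch[OF assms] unfolding qpoch_inf_def by blast
  from has_prod_eq_0_iff[OF this] show ?thesis by auto
qed

lemma qpoch_inf_nonzero:
  assumes "norm q < 1" "norm a \<le> 1" "a \<noteq> 1"
  shows "qpoch_inf a q \<noteq> 0"
  using mult_power_neq_1[OF assms] assms(1) qpoch_inf_nonzero_iff by blast

lemma qpoch_inf_nonzero_less [simp]: "norm q < 1 \<Longrightarrow> norm a < 1 \<Longrightarrow> qpoch_inf a q \<noteq> 0"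
  by (rule qpoch_inf_nonzero) auto

lemma qpoch_inf_zero_left [simp]: "qpoch_inf 0 q = 1"
  by (simp add: qpoch_inf_def)

lemma qpoch_inf_shift:
  assumes "norm q < 1"
  shows "qpoch_inf a q = qpoch a q n * qpoch_inf (a * q ^ n) q"
proof (rule LIMSEQ_unique)
  show "(\<lambda>m. qpoch a q (m + n)) \<longlonglongrightarrow> qpoch_inf a q"
    by (rule LIMSEQ_ignore_initial_segment[OF qpoch_tendsto[OF assms]])
  have "(\<lambda>m. qpoch a q n * qpoch (a * q ^ n) q m) \<longlonglongrightarrow> qpoch a q n * qpoch_inf (a * q ^ n) q"
    by (intro tendsto_intros qpoch_tendsto assms)
  thus "(\<lambda>m. qpoch a q (m + n)) \<longlonglongrightarrow> qpoch a q n * qpoch_inf (a * q ^ n) q"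
    by (subst add.commute) (simp add: qpoch_add)
qed

lemma qpoch_inf_Suc:
  assumes "norm q < 1"
  shows "qpoch_inf a q = (1 - a) * qpoch_inf (a * q) q"
  using qpoch_inf_shift[OF assms, of a 1] by (simp add: qpoch_def)

lemma qpoch_inf_shift_self:
  assumes "norm q < 1"
  shows "qpoch_inf (q ^ Suc n) q = qpoch_inf q q / qpoch q q n"
  using qpoch_inf_shift[OF assms, of q n] assms by (simp add: field_simps)

lemma qpoch_neg_mult: "qpoch a q n * qpoch (-a) q n = qpoch (a\<^sup>2) (q\<^sup>2) n"
  by (induction n) (simp_all add: qpoch_Suc algebra_simps power2_eq_square power_mult_distrib)

lemma norm_power_less_1: "norm (q::complex) < 1 \<Longrightarrow> m > 0 \<Longrightarrow> norm (q ^ m) < 1"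
  by (simp add: norm_power power_less_one_iff)

lemma qpoch_inf_neg_mult:
  assumes "norm q < 1"
  shows "qpoch_inf a q * qpoch_inf (-a) q = qpoch_inf (a\<^sup>2) (q\<^sup>2)"
proof (rule LIMSEQ_unique)
  show "(\<lambda>n. qpoch (a\<^sup>2) (q\<^sup>2) n) \<longlonglongrightarrow> qpoch_inf (a\<^sup>2) (q\<^sup>2)"
    by (intro qpoch_tendsto norm_power_less_1 assms) auto
  show "(\<lambda>n. qpoch (a\<^sup>2) (q\<^sup>2) n) \<longlonglongrightarrow> qpoch_inf a q * qpoch_inf (-a) q"
    unfolding qpoch_neg_mult[symmetric] by (intro tendsto_intros qpoch_tendsto assms)
qed

text \<open>The factors 1 - a q^j are sorted by the residue of j modulo m.\<close>

lemma qpoch_split: "qpoch a q (m * n) = (\<Prod>i<m. qpoch (a * q ^ i) (q ^ m) n)"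
proof (induction n)
  case (Suc n)
  have "qpoch a q (m * Suc n) = qpoch a q (m * n) * qpoch (a * q ^ (m * n)) q m"
    by (simp add: qpoch_add[symmetric] add.commute)
  also have "qpoch (a * q ^ (m * n)) q m = (\<Prod>i<m. 1 - a * q ^ i * (q ^ m) ^ n)"
    by (simp add: qpoch_def power_mult mult_ac)
  finally show ?case
    by (simp add: Suc.IH prod.distrib qpoch_Suc)
qed auto

lemma qpoch_inf_split:
  assumes "norm q < 1" "m > 0"
  shows "qpoch_inf a q = (\<Prod>i<m. qpoch_inf (a * q ^ i) (q ^ m))"
proof (rule LIMSEQ_unique)
  have "filterlim (\<lambda>n. m * n) at_top sequentially"
    using assms(2) by (intro mult_nat_left_at_top) auto
  from filterlim_compose[OF qpoch_tendsto[OF assms(1)] this]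
  show "(\<lambda>n. qpoch a q (m * n)) \<longlonglongrightarrow> qpoch_inf a q" by simp
  show "(\<lambda>n. qpoch a q (m * n)) \<longlonglongrightarrow> (\<Prod>i<m. qpoch_inf (a * q ^ i) (q ^ m))"
    unfolding qpoch_split by (intro tendsto_intros qpoch_tendsto norm_power_less_1 assms)
qed

lemma qpoch_bounded:
  assumes "norm q < 1"
  obtains C where "C \<ge> 1" "\<And>n. norm (qpoch a q n) \<le> C"
proof -
  have "Bseq (qpoch a q)"
    using qpoch_tendsto[OF assms] convergentI convergent_imp_Bseq by blast
  then obtain C where "\<And>n. norm (qpoch a q n) \<le> C" by (auto simp: Bseq_def)
  thus ?thesis using that[of "max C 1"] by (auto simp: le_max_iff_disj)
qed

lemma inverse_qpoch_bounded:
  assumes "norm q < 1" "\<And>k. a * q ^ k \<noteq> 1"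
  obtains C where "C \<ge> 1" "\<And>n. norm (1 / qpoch a q n) \<le> C"
proof -
  have "(\<lambda>n. inverse (qpoch a q n)) \<longlonglongrightarrow> inverse (qpoch_inf a q)"
    using assms by (intro tendsto_inverse qpoch_tendsto) (auto simp: qpoch_inf_nonzero_iff)
  hence "Bseq (\<lambda>n. inverse (qpoch a q n))"
    using convergentI convergent_imp_Bseq by blast
  then obtain C where "\<And>n. norm (inverse (qpoch a q n)) \<le> C" by (auto simp: Bseq_def)
  thus ?thesis using that[of "max C 1"] by (auto simp: le_max_iff_disj inverse_eq_divide)
qed

lemma zero_choose_two [simp]: "0 choose 2 = 0"
  by (simp add: numeral_2_eq_2)

lemma choose_two_add: "(m + n) choose 2 = (m choose 2) + (n choose 2) + m * n"
proof (induction n)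
  case (Suc n)
  have "Suc k choose 2 = k + (k choose 2)" for k :: nat by (simp add: numeral_2_eq_2)
  with Suc show ?case by simp
qed auto

lemma Suc_choose_two: "Suc n choose 2 = n + (n choose 2)"
  by (simp add: numeral_2_eq_2)

lemma square_eq_choose_two: "n * n = 2 * (n choose 2) + n"
  by (induction n) (auto simp: Suc_choose_two)

lemma choose_two_int: "2 * int (n choose 2) = int n * (int n - 1)"
proof -
  have "int (n * n) = int (2 * (n choose 2) + n)" by (subst square_eq_choose_two) simp
  thus ?thesis by (simp add: algebra_simps)
qed

text \<open>Gaussian decay beats every geometric growth. The multiple series below converge by comparison with this one.\<close>

lemma summable_gauss_nat:
  fixes r B :: real
  assumes "0 \<le> r" "r < 1" "0 \<le> B"
  shows "(\<lambda>n. B ^ n * r ^ (n choose 2)) summable_on (UNIV :: nat set)"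
proof -
  have "(\<lambda>n. B * r ^ n) \<longlonglongrightarrow> B * 0"
    using assms by (intro tendsto_intros LIMSEQ_power_zero) auto
  hence "eventually (\<lambda>n. B * r ^ n < 1/2) sequentially"
    by (rule order_tendstoD) auto
  then obtain N where N: "\<And>n. n \<ge> N \<Longrightarrow> B * r ^ n < 1/2"
    by (auto simp: eventually_sequentially)
  have "summable (\<lambda>n. B ^ n * r ^ (n choose 2))"
  proof (rule summable_ratio_test)
    show "(1/2::real) < 1" by simp
    fix n assume "n \<ge> N"
    have "B ^ Suc n * r ^ (Suc n choose 2) = (B * r ^ n) * (B ^ n * r ^ (n choose 2))"
      by (simp add: Suc_choose_two power_add mult_ac)
    also have "\<dots> \<le> 1/2 * (B ^ n * r ^ (n choose 2))"
      using N[OF \<open>n \<ge> N\<close>] assms by (intro mult_right_mono) auto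
    finally show "norm (B ^ Suc n * r ^ (Suc n choose 2)) \<le> 1/2 * norm (B ^ n * r ^ (n choose 2))"
      using assms by simp
  qed
  thus ?thesis using assms by (subst summable_on_UNIV_nonneg_real_iff) auto
qed

lemma summable_gauss_int:
  fixes r B :: real
  assumes "0 \<le> r" "r < 1" "1 \<le> B"
  shows "(\<lambda>n::int. B ^ nat \<bar>n\<bar> * r ^ nat (n\<^sup>2)) summable_on UNIV"
proof -
  have le: "B ^ n * r ^ (n * n) \<le> B ^ n * r ^ (n choose 2)" for n :: nat
    using assms by (intro mult_left_mono power_decreasing) (auto simp: square_eq_choose_two)
  have nat: "(\<lambda>n::nat. B ^ n * r ^ (n * n)) summable_on UNIV"
    using assms
    by (intro summable_on_comparison_test[OF summable_gauss_nat[of r B]] le) auto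
  have eq: "nat ((int n)\<^sup>2) = n * n" for n :: nat
    by (simp add: power2_eq_square nat_mult_distrib)
  have "(\<lambda>n::int. B ^ nat \<bar>n\<bar> * r ^ nat (n\<^sup>2)) summable_on (range int)"
    by (subst summable_on_reindex) (use nat in \<open>auto simp: o_def eq\<close>)
  moreover have "(\<lambda>n::int. B ^ nat \<bar>n\<bar> * r ^ nat (n\<^sup>2)) summable_on (range (\<lambda>n. - int n))"
    by (subst summable_on_reindex) (use nat in \<open>auto simp: o_def eq inj_on_def\<close>)
  moreover have "(UNIV :: int set) = range int \<union> range (\<lambda>n. - int n)"
  proof -
    have "k \<in> range int \<union> range (\<lambda>n. - int n)" for k :: int
      by (cases k rule: int_cases2) auto
    thus ?thesis by auto
  qed
  ultimately show ?thesis
    by (metis summable_on_union)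
qed

lemma summable_on_complex_majorant:
  fixes f :: "'a \<Rightarrow> complex"
  assumes "g summable_on A" "\<And>x. x \<in> A \<Longrightarrow> norm (f x) \<le> g x"
  shows "f summable_on A"
  using Infinite_Sum.abs_summable_on_comparison_test'[of g A f] assms Infinite_Sum.abs_summable_summable by blast

lemma summable_on_times_real:
  fixes f :: "'a \<Rightarrow> real" and g :: "'b \<Rightarrow> real"
  assumes "f summable_on A" "g summable_on B" "\<And>x. x \<in> A \<Longrightarrow> f x \<ge> 0" "\<And>x. x \<in> B \<Longrightarrow> g x \<ge> 0"
  shows "(\<lambda>(x, y). f x * g y) summable_on A \<times> B"
proof (rule summable_on_SigmaI)
  fix x assume "x \<in> A"
  show "((\<lambda>y. case (x, y) of (x, y) \<Rightarrow> f x * g y) has_sum f x * infsum g B) B"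
    using assms(2) by (auto intro!: has_sum_cmult_right)
qed (use assms in \<open>auto intro!: summable_on_cmult_left\<close>)

lemma has_sum_antidiagonal:
  fixes f :: "nat \<Rightarrow> nat \<Rightarrow> complex"
  assumes "((\<lambda>(i, j). f i j) has_sum S) UNIV"
  shows "((\<lambda>n. \<Sum>i\<le>n. f i (n - i)) has_sum S) UNIV"
proof -
  have bij: "bij_betw (\<lambda>(n, i). (i, n - i)) (SIGMA n:UNIV. {..n}) (UNIV :: (nat \<times> nat) set)"
    by (rule bij_betwI[of _ _ _ "\<lambda>(i, j). (i + j, i)"]) auto
  have "((\<lambda>(n, i). f i (n - i)) has_sum S) (SIGMA n:UNIV. {..n})"
    using assms has_sum_reindex_bij_betw[OF bij, of "\<lambda>(i, j). f i j" S]
    by (simp add: case_prod_unfold)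
  from has_sum_SigmaD[OF this, of "\<lambda>n. \<Sum>i\<le>n. f i (n - i)"] show ?thesis
    by (auto intro: has_sum_finite)
qed

lemma has_sum_iterated:
  fixes f :: "'a \<Rightarrow> 'b \<Rightarrow> complex"
  assumes "((\<lambda>(i, j). f i j) has_sum S) UNIV"
  assumes "\<And>i. (f i has_sum g i) UNIV"
  shows "(g has_sum S) UNIV"
  using has_sum_SigmaD[where f = "\<lambda>(i, j). f i j" and A = UNIV and B = "\<lambda>_. UNIV" and g = g] assms by simp

lemma has_sum_iterated_rev:
  fixes f :: "'a \<Rightarrow> 'b \<Rightarrow> complex"
  assumes "(\<lambda>(i, j). f i j) summable_on UNIV"
  assumes "\<And>i. (f i has_sum g i) UNIV" "(g has_sum S) UNIV"
  shows "((\<lambda>(i, j). f i j) has_sum S) UNIV"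
  using has_sum_SigmaI[where f = "\<lambda>(i, j). f i j" and A = UNIV and B = "\<lambda>_. UNIV" and g = g] assms by simp

lemma has_sum_swap_UNIV:
  fixes f :: "'a \<Rightarrow> 'b \<Rightarrow> complex"
  assumes "((\<lambda>(i, j). f i j) has_sum S) UNIV"
  shows "((\<lambda>(j, i). f i j) has_sum S) UNIV"
  using has_sum_swap[where f = "\<lambda>(i, j). f i j" and A = UNIV and B = UNIV] assms by simp

section \<open>The q-binomial theorem and the q-Gauss sum\<close>

text \<open>The finite q-binomial theorem. The factor 1 - q^(n+1) is distributed over the two factors of the denominator as
(1 - q^(n+1-i)) + q^(n+1-i) (1 - q^i), which is the q-Pascal rule.\<close>

lemma qbinomial_finite:
  fixes q z :: complex
  assumes "norm q < 1"
  shows "(\<Sum>i\<le>n. (-1) ^ i * q ^ (i choose 2) * z ^ i / (qpoch q q i * qpoch q q (n - i))) =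
           qpoch z q n / qpoch q q n"
proof (induction n)
  case (Suc n)
  define c where "c = (\<lambda>i. (-1) ^ i * q ^ (i choose 2) * z ^ i)"
  define b where "b = (\<lambda>n i. 1 / (qpoch q q i * qpoch q q (n - i)))"
  have c_Suc: "c (Suc i) = - z * q ^ i * c i" for i
    by (simp add: c_def Suc_choose_two power_add)
  have nz: "qpoch q q k \<noteq> 0" "1 - q * q ^ k \<noteq> 0" for k
    using assms self_mult_power_neq_1[of q k] by auto
  have IH: "(\<Sum>i\<le>n. c i * b n i) = qpoch z q n / qpoch q q n"
    using Suc.IH by (simp add: c_def b_def)
  have b1: "b (Suc n) i * (1 - q ^ (Suc n - i)) = b n i" if "i \<le> n" for i
    using that nz by (simp add: b_def Suc_diff_le qpoch_Suc field_simps)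
  have b2: "b (Suc n) (Suc i) * (1 - q ^ Suc i) = b n i" for i
    using nz by (simp add: b_def qpoch_Suc field_simps)
  have "(\<Sum>i\<le>Suc n. c i * b (Suc n) i) * (1 - q ^ Suc n) =
        (\<Sum>i\<le>Suc n. c i * (b (Suc n) i * (1 - q ^ (Suc n - i)))
           + c i * q ^ (Suc n - i) * (b (Suc n) i * (1 - q ^ i)))"
    unfolding sum_distrib_right
  proof (intro sum.cong refl)
    fix i assume "i \<in> {..Suc n}"
    hence "q ^ Suc n = q ^ (Suc n - i) * q ^ i"
      by (simp add: power_add[symmetric])
    thus "c i * b (Suc n) i * (1 - q ^ Suc n) =
        c i * (b (Suc n) i * (1 - q ^ (Suc n - i)))
           + c i * q ^ (Suc n - i) * (b (Suc n) i * (1 - q ^ i))"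
      by (simp add: algebra_simps)
  qed
  also have "\<dots> = (\<Sum>i\<le>Suc n. c i * (b (Suc n) i * (1 - q ^ (Suc n - i))))
                + (\<Sum>i\<le>Suc n. c i * q ^ (Suc n - i) * (b (Suc n) i * (1 - q ^ i)))"
    by (rule sum.distrib)
  also have "(\<Sum>i\<le>Suc n. c i * (b (Suc n) i * (1 - q ^ (Suc n - i)))) = (\<Sum>i\<le>n. c i * b n i)"
    using b1 by simp
  also have "(\<Sum>i\<le>Suc n. c i * q ^ (Suc n - i) * (b (Suc n) i * (1 - q ^ i))) =
             (\<Sum>i\<le>n. c (Suc i) * q ^ (n - i) * (b (Suc n) (Suc i) * (1 - q ^ Suc i)))"
    by (subst sum.atMost_Suc_shift) simp
  also have "\<dots> = (\<Sum>i\<le>n. (- z * q ^ n) * (c i * b n i))"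
  proof (intro sum.cong refl)
    fix i assume "i \<in> {..n}"
    hence "q ^ n = q ^ (n - i) * q ^ i"
      by (simp add: power_add[symmetric])
    thus "c (Suc i) * q ^ (n - i) * (b (Suc n) (Suc i) * (1 - q ^ Suc i)) =
          (- z * q ^ n) * (c i * b n i)"
      unfolding b2 c_Suc by simp
  qed
  also have "\<dots> = - z * q ^ n * (\<Sum>i\<le>n. c i * b n i)"
    by (rule sum_distrib_left[symmetric])
  also have "(\<Sum>i\<le>n. c i * b n i) + - z * q ^ n * (\<Sum>i\<le>n. c i * b n i)
             = qpoch z q (Suc n) / qpoch q q n"
    unfolding IH using nz(1)[of n] by (simp add: qpoch_Suc divide_simps) (simp add: algebra_simps)
  finally have "(\<Sum>i\<le>Suc n. c i * b (Suc n) i) * (1 - q * q ^ n) = qpoch z q (Suc n) / qpoch q q n"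
    by simp
  hence "(\<Sum>i\<le>Suc n. c i * b (Suc n) i) = qpoch z q (Suc n) / qpoch q q n / (1 - q * q ^ n)"
    using nz(2)[of n] by (metis nonzero_mult_div_cancel_right)
  also have "\<dots> = qpoch z q (Suc n) / qpoch q q (Suc n)"
    by (simp only: qpoch_Suc divide_divide_eq_left)
  finally show ?case by (simp add: c_def b_def)
qed auto

text \<open>This product is (-y)^n q^(n(n-1)/2) (c/y; q)_n. The polynomial form stays meaningful at y = 0, where it becomes c^n q^(n(n-1)),
so that the q-Gauss sum below contains its degenerate cases.\<close>

definition wprod :: "complex \<Rightarrow> complex \<Rightarrow> complex \<Rightarrow> nat \<Rightarrow> complex" where
  "wprod c y q n = (\<Prod>i<n. (c * q ^ i - y) * q ^ i)"

lemma wprod_0 [simp]: "wprod c y q 0 = 1"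
  by (simp add: wprod_def)

lemma wprod_Suc: "wprod c y q (Suc n) = wprod c y q n * ((c * q ^ n - y) * q ^ n)"
  by (simp add: wprod_def)

lemma wprod_add: "wprod c y q (m + n) = wprod c y q m * wprod (c * q ^ (2 * m)) (y * q ^ m) q n"
proof (induction n)
  case (Suc n)
  have "(c * q ^ (m + n) - y) * q ^ (m + n) = (c * q ^ (2 * m) * q ^ n - y * q ^ m) * q ^ n"
    by (simp add: power_add algebra_simps power_mult power2_eq_square)
  thus ?case using Suc by (simp add: wprod_Suc mult.assoc)
qed auto

lemma wprod_scale: "wprod (c * s) (y * s) q n = s ^ n * wprod c y q n"
  by (induction n) (simp_all add: wprod_Suc algebra_simps)

lemma wprod_0_left: "wprod 0 y q n = q ^ (n choose 2) * (-y) ^ n"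
  by (induction n) (auto simp: wprod_Suc Suc_choose_two power_add)

lemma norm_prod_le_power:
  fixes f :: "nat \<Rightarrow> complex"
  assumes "\<And>i. norm (f i) \<le> B"
  shows "norm (\<Prod>i<n. f i) \<le> B ^ n"
proof -
  have "norm (\<Prod>i<n. f i) \<le> (\<Prod>i<n. B)"
    unfolding prod_norm[symmetric] by (intro prod_mono) (use assms in auto)
  thus ?thesis by simp
qed

lemma prod_power_choose_two: "(\<Prod>i<n. q ^ i) = (q::'a::comm_monoid_mult) ^ (n choose 2)"
  by (induction n) (auto simp: Suc_choose_two power_add mult.commute)

lemma norm_diff_mult_power_le:
  fixes c y q :: complex
  assumes "norm q \<le> 1"
  shows "norm (c * q ^ i - y) \<le> norm c + norm y"
proof -
  have "norm (c * q ^ i - y) \<le> norm c * norm q ^ i + norm y"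
    by (metis norm_mult norm_power norm_triangle_ineq4)
  also have "norm c * norm q ^ i \<le> norm c * 1"
    using assms by (intro mult_left_mono power_le_one) auto
  finally show ?thesis by simp
qed

lemma norm_wprod_le:
  assumes "norm q \<le> 1"
  shows "norm (wprod c y q n) \<le> (norm c + norm y) ^ n * norm q ^ (n choose 2)"
proof -
  have "norm (wprod c y q n) = norm (\<Prod>i<n. c * q ^ i - y) * norm q ^ (n choose 2)"
    by (simp add: wprod_def prod.distrib prod_power_choose_two norm_mult norm_power)
  also have "\<dots> \<le> (norm c + norm y) ^ n * norm q ^ (n choose 2)"
    by (intro mult_right_mono norm_prod_le_power norm_diff_mult_power_le assms) auto
  finally show ?thesis .
qed

definition gauss_term :: "complex \<Rightarrow> complex \<Rightarrow> complex \<Rightarrow> nat \<Rightarrow> complex" where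
  "gauss_term c y q n = wprod c y q n / (qpoch q q n * qpoch c q n)"

text \<open>The bound is uniform in m: it is the dominating series when the q-Gauss sum is iterated towards its trivial limit.\<close>

lemma norm_gauss_term_le:
  assumes "norm q < 1" "\<And>k. c * q ^ k \<noteq> 1"
  obtains K where "K \<ge> 1" "\<And>m n. norm (wprod (c * q ^ m) (y * q ^ m) q n / (qpoch q q n * qpoch (c * q ^ m) q n))
      \<le> K * ((norm c + norm y) ^ n * norm q ^ (n choose 2))"
proof -
  obtain C1 where C1: "C1 \<ge> 1" "\<And>n. norm (1 / qpoch q q n) \<le> C1"
    using inverse_qpoch_bounded[OF assms(1), of q] mult_power_neq_1[OF assms(1), of q] assms(1)
    by (metis less_imp_le norm_less_1_neq_1)
  obtain C2 where C2: "C2 \<ge> 1" "\<And>n. norm (1 / qpoch c q n) \<le> C2"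
    using inverse_qpoch_bounded[OF assms] by metis
  obtain C3 where C3: "C3 \<ge> 1" "\<And>n. norm (qpoch c q n) \<le> C3"
    using qpoch_bounded[OF assms(1)] by metis
  show ?thesis
  proof (rule that[of "C1 * (C3 * C2)"])
    show "1 \<le> C1 * (C3 * C2)" using C1(1) C2(1) C3(1)
      by (smt (verit) mult_le_cancel_left1)
    fix m n
    have nz: "qpoch c q m \<noteq> 0" using assms(2) by (auto simp: qpoch_eq_0_iff)
    have e: "1 / qpoch (c * q ^ m) q n = qpoch c q m * (1 / qpoch c q (m + n))"
      using nz by (simp add: qpoch_add)
    have "norm (qpoch c q m * (1 / qpoch c q (m + n))) \<le> C3 * C2"
      unfolding norm_mult using C3 C2 by (intro mult_mono) (auto intro: order_trans[OF norm_ge_zero])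
    hence b2: "norm (1 / qpoch (c * q ^ m) q n) \<le> C3 * C2" by (simp only: e)
    have "norm (wprod (c * q ^ m) (y * q ^ m) q n) = norm (q ^ m) ^ n * norm (wprod c y q n)"
      by (simp add: wprod_scale norm_mult norm_power)
    also have "\<dots> \<le> 1 * ((norm c + norm y) ^ n * norm q ^ (n choose 2))"
      using assms(1) by (intro mult_mono norm_wprod_le) (auto simp: norm_power power_le_one)
    finally have b3: "norm (wprod (c * q ^ m) (y * q ^ m) q n) \<le> (norm c + norm y) ^ n * norm q ^ (n choose 2)"
      by simp
    have "norm (wprod (c * q ^ m) (y * q ^ m) q n / (qpoch q q n * qpoch (c * q ^ m) q n)) =
          norm (1 / qpoch q q n) * norm (1 / qpoch (c * q ^ m) q n) * norm (wprod (c * q ^ m) (y * q ^ m) q n)"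
      by (simp add: norm_divide norm_mult)
    also have "\<dots> \<le> C1 * (C3 * C2) * ((norm c + norm y) ^ n * norm q ^ (n choose 2))"
      using C1(1) C2(1) C3(1) by (intro mult_mono C1(2) b2 b3) auto
    finally show "norm (wprod (c * q ^ m) (y * q ^ m) q n / (qpoch q q n * qpoch (c * q ^ m) q n))
      \<le> C1 * (C3 * C2) * ((norm c + norm y) ^ n * norm q ^ (n choose 2))" .
  qed
qed

lemma gauss_term_summable:
  assumes "norm q < 1" "\<And>k. c * q ^ k \<noteq> 1"
  shows "gauss_term c y q summable_on UNIV"
proof -
  obtain K where K: "\<And>m n. norm (wprod (c * q ^ m) (y * q ^ m) q n / (qpoch q q n * qpoch (c * q ^ m) q n))
      \<le> K * ((norm c + norm y) ^ n * norm q ^ (n choose 2))"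
    using norm_gauss_term_le[OF assms] by metis
  have "(\<lambda>n. K * ((norm c + norm y) ^ n * norm q ^ (n choose 2))) summable_on UNIV"
    using assms by (intro summable_on_cmult_right summable_gauss_nat) auto
  thus ?thesis
    by (rule summable_on_complex_majorant) (use K[of 0] in \<open>simp add: gauss_term_def\<close>)
qed

text \<open>Replacing (c, y) by (c q, y q) changes the q-Gauss sum by the factor (1 - y)/(1 - c), because the difference of the
two summands telescopes; the certificate is the sequence G in the proof.\<close>

lemma gauss_term_functional:
  assumes "norm q < 1" "\<And>k. c * q ^ k \<noteq> 1"
  shows "(1 - c) * (\<Sum>\<^sub>\<infinity>n. gauss_term c y q n) = (1 - y) * (\<Sum>\<^sub>\<infinity>n. gauss_term (c * q) (y * q) q n)"
proof -
  have ne: "c * q * q ^ k \<noteq> 1" for k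
    using assms(2)[of "Suc k"] by (simp add: mult.assoc)
  have nz: "1 - c * q ^ k \<noteq> 0" "1 - q * q ^ k \<noteq> 0" "qpoch c q k \<noteq> 0" "qpoch (c * q) q k \<noteq> 0" "qpoch q q k \<noteq> 0" for k
    using assms self_mult_power_neq_1[of q] ne by (auto simp: qpoch_eq_0_iff)
  have c1: "1 - c \<noteq> 0" using nz(1)[of 0] by simp
  define U where "U = (\<lambda>n. wprod c y q n / (qpoch q q n * qpoch (c * q) q n))"
  \<comment> \<open>The Wilf-Zeilberger certificate: G vanishes at 0 and tends to 0.\<close>
  define G where "G = (\<lambda>n. - U n * (1 - q ^ n) * (1 - c * q ^ n))"
  have T1: "(1 - c) * gauss_term c y q n = U n * (1 - c * q ^ n)" for n
  proof -
    have "qpoch c q n * (1 - c * q ^ n) = (1 - c) * qpoch (c * q) q n"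
      by (metis qpoch_Suc qpoch_Suc_left)
    thus ?thesis
      using nz(3-5)[of n] by (simp add: U_def gauss_term_def divide_simps mult_ac)
  qed
  have T2: "gauss_term (c * q) (y * q) q n = q ^ n * U n" for n
    by (simp add: U_def gauss_term_def wprod_scale)
  have tele: "G (Suc n) - G n = (1 - c) * gauss_term c y q n - (1 - y) * gauss_term (c * q) (y * q) q n" for n
  proof -
    have "U (Suc n) * ((1 - q * q ^ n) * (1 - c * q * q ^ n)) = U n * ((c * q ^ n - y) * q ^ n)"
      using nz(2,4,5)[of n] ne[of n] by (simp add: U_def wprod_Suc qpoch_Suc divide_simps)
    hence "G (Suc n) = - U n * ((c * q ^ n - y) * q ^ n)"
      by (simp add: G_def mult_ac)
    hence "G (Suc n) - G n = U n * (1 - c * q ^ n) - (1 - y) * (q ^ n * U n)"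
      unfolding G_def by (simp add: algebra_simps)
    thus ?thesis by (simp only: T1 T2)
  qed
  have "U \<longlonglongrightarrow> 0"
  proof -
    have *: "gauss_term c y q \<longlonglongrightarrow> 0"
      by (intro summable_LIMSEQ_zero summable_on_imp_summable gauss_term_summable assms)
    have "(\<lambda>n. (1 - c) * gauss_term c y q n / (1 - c * q ^ n)) \<longlonglongrightarrow> (1 - c) * 0 / (1 - c * 0)"
      by (intro tendsto_intros * LIMSEQ_power_zero assms) auto
    thus ?thesis using nz(1) by (simp add: T1)
  qed
  hence "G \<longlonglongrightarrow> - 0 * (1 - 0) * (1 - c * 0)"
    unfolding G_def by (intro tendsto_intros LIMSEQ_power_zero assms)
  hence "(\<lambda>n. G (Suc n) - G n) sums (0 - G 0)"
    by (intro telescope_sums) simp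
  hence 1: "(\<lambda>n. G (Suc n) - G n) sums 0" by (simp add: G_def)
  have "(\<lambda>n. (1 - c) * gauss_term c y q n - (1 - y) * gauss_term (c * q) (y * q) q n) sums
     ((1 - c) * (\<Sum>\<^sub>\<infinity>n. gauss_term c y q n) - (1 - y) * (\<Sum>\<^sub>\<infinity>n. gauss_term (c * q) (y * q) q n))"
    by (intro sums_diff sums_mult has_sum_imp_sums has_sum_infsum gauss_term_summable assms ne)
  with 1 show ?thesis unfolding tele using sums_unique2 by fastforce
qed

text \<open>The q-Gauss sum with one numerator parameter sent to infinity. Iterating the functional equation m times produces the
two shifted factorials, and as m tends to infinity only the term n = 0 of the shifted series survives.\<close>

lemma has_sum_gauss:
  assumes "norm q < 1" "\<And>k. c * q ^ k \<noteq> 1"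
  shows "((\<lambda>n. wprod c y q n / (qpoch q q n * qpoch c q n)) has_sum (qpoch_inf y q / qpoch_inf c q)) UNIV"
proof -
  define F where "F = (\<lambda>m. \<Sum>\<^sub>\<infinity>n. gauss_term (c * q ^ m) (y * q ^ m) q n)"
  have ne: "c * q ^ m * q ^ k \<noteq> 1" for m k
    using assms(2)[of "m + k"] by (simp add: power_add mult.assoc)
  have nz: "qpoch c q n \<noteq> 0" for n using assms by (auto simp: qpoch_eq_0_iff)
  have nzi: "qpoch_inf c q \<noteq> 0" using assms by (simp add: qpoch_inf_nonzero_iff)
  have F_eq: "F 0 * qpoch c q m = qpoch y q m * F m" for m
  proof (induction m)
    case (Suc m)
    have "(1 - c * q ^ m) * F m = (1 - y * q ^ m) * F (Suc m)"
      using gauss_term_functional[OF assms(1) ne[of m], of "y * q ^ m"] by (simp add: F_def mult_ac)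
    hence "F 0 * qpoch c q (Suc m) = qpoch y q m * ((1 - y * q ^ m) * F (Suc m))"
      using Suc by (metis (no_types, lifting) mult.assoc mult.commute qpoch_Suc)
    thus ?case by (simp add: qpoch_Suc)
  qed (simp add: F_def)
  obtain K where K: "\<And>m n. norm (wprod (c * q ^ m) (y * q ^ m) q n / (qpoch q q n * qpoch (c * q ^ m) q n))
      \<le> K * ((norm c + norm y) ^ n * norm q ^ (n choose 2))"
    using norm_gauss_term_le[OF assms] by metis
  have "F \<longlonglongrightarrow> 1"
  proof -
    have lim: "(\<lambda>m. gauss_term (c * q ^ m) (y * q ^ m) q n) \<longlonglongrightarrow> (if n = 0 then 1 else 0)" for n
    proof (cases "n = 0")
      case False
      have "(\<lambda>m. qpoch (c * q ^ m) q n) \<longlonglongrightarrow> (\<Prod>k<n. 1 - c * 0 * q ^ k)"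
        unfolding qpoch_def by (intro tendsto_intros LIMSEQ_power_zero assms)
      moreover have "(\<lambda>m. (q ^ m) ^ n * wprod c y q n) \<longlonglongrightarrow> 0 ^ n * wprod c y q n"
        by (intro tendsto_intros LIMSEQ_power_zero assms)
      ultimately have "(\<lambda>m. (q ^ m) ^ n * wprod c y q n / (qpoch q q n * qpoch (c * q ^ m) q n))
          \<longlonglongrightarrow> 0 ^ n * wprod c y q n / (qpoch q q n * (\<Prod>k<n. 1 - c * 0 * q ^ k))"
        using assms(1) by (intro tendsto_intros) auto
      thus ?thesis using False by (simp add: gauss_term_def wprod_scale zero_power)
    qed (simp add: gauss_term_def)
    have "(\<lambda>m. \<Sum>n. gauss_term (c * q ^ m) (y * q ^ m) q n) \<longlonglongrightarrow> (\<Sum>n. if n = 0 then 1 else 0)"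
    proof (rule conjunct2[OF conjunct2[OF tannerys_theorem]])
      show "\<forall>\<^sub>F (n, m) in sequentially \<times>\<^sub>F sequentially.
              norm (gauss_term (c * q ^ m) (y * q ^ m) q n) \<le> K * ((norm c + norm y) ^ n * norm q ^ (n choose 2))"
        using K by (intro always_eventually) (auto simp: gauss_term_def)
      show "summable (\<lambda>n. K * ((norm c + norm y) ^ n * norm q ^ (n choose 2)))"
        using assms(1) by (intro summable_mult summable_on_imp_summable summable_gauss_nat) auto
    qed (use lim in auto)
    also have "(\<lambda>m. \<Sum>n. gauss_term (c * q ^ m) (y * q ^ m) q n) = F"
      unfolding F_def
      by (intro ext sums_unique[symmetric] has_sum_imp_sums has_sum_infsum gauss_term_summable assms ne)
    also have "(\<Sum>n. if n = 0 then 1 else 0) = (1 :: complex)"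
      using suminf_finite[of "{0}" "\<lambda>n. if n = (0::nat) then 1 else (0::complex)"] by simp
    finally show ?thesis .
  qed
  hence "(\<lambda>m. qpoch y q m * F m) \<longlonglongrightarrow> qpoch_inf y q * 1"
    by (intro tendsto_intros qpoch_tendsto assms)
  moreover have "(\<lambda>m. F 0 * qpoch c q m) \<longlonglongrightarrow> F 0 * qpoch_inf c q"
    by (intro tendsto_intros qpoch_tendsto assms)
  ultimately have "F 0 * qpoch_inf c q = qpoch_inf y q"
    unfolding F_eq using LIMSEQ_unique by fastforce
  hence "F 0 = qpoch_inf y q / qpoch_inf c q" using nzi by (simp add: field_simps)
  moreover have "(gauss_term c y q has_sum F 0) UNIV"
    unfolding F_def using gauss_term_summable[OF assms] by simp
  ultimately show ?thesis by (simp add: gauss_term_def[abs_def])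
qed

text \<open>The case c = 0 of the q-Gauss sum.\<close>

lemma has_sum_euler:
  assumes "norm q < 1"
  shows "((\<lambda>n. q ^ (n choose 2) * (-y) ^ n / qpoch q q n) has_sum qpoch_inf y q) UNIV"
  using has_sum_gauss[OF assms, of 0 y] by (simp add: wprod_0_left)

section \<open>Inner sums: Euler splitting and Lebesgue's identity\<close>

text \<open>The infinite product (y q^i)_inf is expanded by Euler's series in a second index l. On the antidiagonal i + l = j the
powers of q split into one depending on j and one depending on i, and the sum over i is a finite q-binomial sum.\<close>

lemma has_sum_transform:
  fixes a q y S :: complex
  assumes q: "norm q < 1"
  assumes S: "((\<lambda>i. q ^ (2 * (i choose 2)) * (y * a) ^ i / qpoch q q i * qpoch_inf (y * q ^ i) q) has_sum S) UNIV"
  shows "((\<lambda>j. q ^ (j choose 2) * (-y) ^ j * qpoch a q j / qpoch q q j) has_sum S) UNIV"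
proof -
  define f where "f = (\<lambda>i l. q ^ (2 * (i choose 2)) * (y * a) ^ i / qpoch q q i *
     (q ^ (l choose 2) * (-(y * q ^ i)) ^ l / qpoch q q l))"
  obtain C where C: "C \<ge> 1" "\<And>n. norm (1 / qpoch q q n) \<le> C"
    using inverse_qpoch_bounded[OF q self_mult_power_neq_1[OF q]] by metis
  define g where "g = (\<lambda>B n. B ^ n * norm q ^ (n choose 2))"
  have g: "g B summable_on UNIV" "g B n \<ge> 0" if "B \<ge> 0" for B n
    using that q summable_gauss_nat[of "norm q" B] by (auto simp: g_def)
  have "(\<lambda>(i, l). C * g (norm (y * a)) i * (C * g (norm y) l)) summable_on UNIV \<times> UNIV"
    by (intro summable_on_times_real summable_on_cmult_right g) (use C g in auto)
  hence summable: "(\<lambda>(i, l). f i l) summable_on UNIV"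
    unfolding UNIV_Times_UNIV
  proof (rule summable_on_complex_majorant)
    fix p :: "nat \<times> nat"
    obtain i l where p: "p = (i, l)" by (cases p)
    have "norm (q ^ (2 * (i choose 2)) * (y * a) ^ i) \<le> norm q ^ (i choose 2) * norm (y * a) ^ i"
      unfolding norm_mult norm_power using q by (intro mult_right_mono power_decreasing) auto
    hence 1: "norm (q ^ (2 * (i choose 2)) * (y * a) ^ i) \<le> g (norm (y * a)) i"
      by (simp add: g_def mult.commute)
    have "norm (q ^ (l choose 2) * (-(y * q ^ i)) ^ l) \<le> norm q ^ (l choose 2) * norm y ^ l"
      unfolding norm_mult norm_power norm_minus_cancel using q
      by (intro mult_left_mono power_mono) (auto intro!: mult_left_le power_le_one)
    hence 2: "norm (q ^ (l choose 2) * (-(y * q ^ i)) ^ l) \<le> g (norm y) l"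
      by (simp add: g_def mult.commute)
    have "norm (f i l) = norm (1 / qpoch q q i) * norm (q ^ (2 * (i choose 2)) * (y * a) ^ i) *
        (norm (1 / qpoch q q l) * norm (q ^ (l choose 2) * (-(y * q ^ i)) ^ l))"
      by (simp add: f_def norm_mult norm_divide)
    also have "\<dots> \<le> C * g (norm (y * a)) i * (C * g (norm y) l)"
      using C(1) g by (intro mult_mono C(2) 1 2) auto
    finally show "norm (case p of (i, l) \<Rightarrow> f i l) \<le> (case p of (i, l) \<Rightarrow> C * g (norm (y * a)) i * (C * g (norm y) l))"
      by (simp add: p)
  qed
  have "((\<lambda>(i, l). f i l) has_sum S) UNIV"
  proof (rule has_sum_iterated_rev[OF summable])
    fix i
    show "(f i has_sum q ^ (2 * (i choose 2)) * (y * a) ^ i / qpoch q q i * qpoch_inf (y * q ^ i) q) UNIV"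
      unfolding f_def by (intro has_sum_cmult_right has_sum_euler q)
  qed (fact S)
  from has_sum_antidiagonal[OF this] show ?thesis
  proof (rule has_sum_cong[THEN iffD1, rotated])
    fix j
    have "(\<Sum>i\<le>j. f i (j - i)) = (\<Sum>i\<le>j. q ^ (j choose 2) * (-y) ^ j *
        ((-1) ^ i * q ^ (i choose 2) * a ^ i / (qpoch q q i * qpoch q q (j - i))))"
    proof (intro sum.cong refl)
      fix i assume "i \<in> {..j}"
      then obtain l where l: "j = i + l" by (metis atMost_iff le_Suc_ex)
      have "(-1) ^ i * (-1) ^ i = (1 :: complex)" by (simp flip: power_mult_distrib)
      thus "f i (j - i) = q ^ (j choose 2) * (-y) ^ j *
        ((-1) ^ i * q ^ (i choose 2) * a ^ i / (qpoch q q i * qpoch q q (j - i)))"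
        by (simp add: f_def l choose_two_add power_add power_mult_distrib power_minus[of y]
              power_minus[of "y * _"] mult_2 power_mult[symmetric] mult_ac)
    qed
    also have "\<dots> = q ^ (j choose 2) * (-y) ^ j * qpoch a q j / qpoch q q j"
      unfolding sum_distrib_left[symmetric] qbinomial_finite[OF q] by simp
    finally show "(\<Sum>i\<le>j. f i (j - i)) = q ^ (j choose 2) * (-y) ^ j * qpoch a q j / qpoch q q j" .
  qed
qed

lemma has_sum_even_odd:
  fixes f :: "nat \<Rightarrow> complex"
  assumes "(f has_sum S) UNIV" "((\<lambda>n. (-1) ^ n * f n) has_sum T) UNIV"
  shows "((\<lambda>n. f (2 * n)) has_sum (S + T) / 2) UNIV" "((\<lambda>n. f (2 * n + 1)) has_sum (S - T) / 2) UNIV"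
proof -
  have inj: "inj (\<lambda>n::nat. 2 * n)" "inj (\<lambda>n::nat. 2 * n + 1)" by (auto simp: inj_on_def)
  have "((\<lambda>n. (f n + (-1) ^ n * f n) / 2) has_sum (S + T) / 2) UNIV"
    by (intro has_sum_divide_const has_sum_add assms)
  also have "?this \<longleftrightarrow> (f has_sum (S + T) / 2) (range (\<lambda>n. 2 * n))"
  proof (rule has_sum_cong_neutral)
    fix n assume "n \<in> UNIV - range (\<lambda>n::nat. 2 * n)"
    hence "odd n" by (auto elim!: evenE)
    thus "(f n + (-1) ^ n * f n) / 2 = 0" by simp
  qed auto
  finally show "((\<lambda>n. f (2 * n)) has_sum (S + T) / 2) UNIV"
    using inj by (subst (asm) has_sum_reindex) (auto simp: o_def)
  have "((\<lambda>n. (f n - (-1) ^ n * f n) / 2) has_sum (S - T) / 2) UNIV"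
    unfolding diff_conv_add_uminus
    by (intro has_sum_divide_const has_sum_add assms has_sum_uminusI)
  also have "?this \<longleftrightarrow> (f has_sum (S - T) / 2) (range (\<lambda>n. 2 * n + 1))"
  proof (rule has_sum_cong_neutral)
    fix n assume "n \<in> UNIV - range (\<lambda>n::nat. 2 * n + 1)"
    hence "even n" by (metis DiffD2 oddE range_eqI)
    thus "(f n - (-1) ^ n * f n) / 2 = 0" by simp
  qed auto
  finally show "((\<lambda>n. f (2 * n + 1)) has_sum (S - T) / 2) UNIV"
    using inj by (subst (asm) has_sum_reindex) (auto simp: o_def)
qed

lemma qpoch_double: "qpoch q q (2 * n) = qpoch q (q\<^sup>2) n * qpoch (q\<^sup>2) (q\<^sup>2) n"
  using qpoch_split[of q q 2 n] by (simp add: numeral_2_eq_2)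

lemma qpoch_double_Suc: "qpoch q q (2 * n + 1) = qpoch q (q\<^sup>2) (Suc n) * qpoch (q\<^sup>2) (q\<^sup>2) n"
  using qpoch_double[of q n] by (simp add: qpoch_Suc power_mult[symmetric] mult_ac)

lemma has_sum_euler_even_odd:
  fixes r z :: complex
  assumes r: "norm r < 1"
  shows "((\<lambda>i. r ^ ((2 * i) choose 2) * z ^ (2 * i) / qpoch r r (2 * i)) has_sum
            (qpoch_inf z r + qpoch_inf (-z) r) / 2) UNIV"
    and "((\<lambda>i. r ^ ((2 * i + 1) choose 2) * z ^ (2 * i + 1) / qpoch r r (2 * i + 1)) has_sum
            (qpoch_inf (-z) r - qpoch_inf z r) / 2) UNIV"
proof -
  have 1: "((\<lambda>n. r ^ (n choose 2) * z ^ n / qpoch r r n) has_sum qpoch_inf (-z) r) UNIV"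
    using has_sum_euler[OF r, of "-z"] by simp
  have 2: "((\<lambda>n. (-1) ^ n * (r ^ (n choose 2) * z ^ n / qpoch r r n)) has_sum qpoch_inf z r) UNIV"
    using has_sum_euler[OF r, of "z"] by (simp add: power_minus[of z] mult_ac)
  show "((\<lambda>i. r ^ ((2 * i) choose 2) * z ^ (2 * i) / qpoch r r (2 * i)) has_sum
            (qpoch_inf z r + qpoch_inf (-z) r) / 2) UNIV"
    using has_sum_even_odd(1)[OF 1 2] by (simp add: add.commute)
  show "((\<lambda>i. r ^ ((2 * i + 1) choose 2) * z ^ (2 * i + 1) / qpoch r r (2 * i + 1)) has_sum
            (qpoch_inf (-z) r - qpoch_inf z r) / 2) UNIV"
    using has_sum_even_odd(2)[OF 1 2] by simp
qed

lemma double_choose_two: "(2 * i) choose 2 = 4 * (i choose 2) + i"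
  by (induction i) (auto simp: Suc_choose_two)

lemma double_Suc_choose_two: "(2 * i + 1) choose 2 = 4 * (i choose 2) + 3 * i"
  by (simp add: Suc_choose_two double_choose_two)

lemma square_nat_choose_two: "i\<^sup>2 = 2 * (i choose 2) + (i::nat)"
  using square_eq_choose_two[of i] by (simp add: power2_eq_square)

text \<open>Put r = x^2 and t = r^2. In the transformed series the product (r t^i; t)_inf equals (r; t)_inf / (r; t)_i, and (r; t)_i (t; t)_i = (r; r)_{2i}.
So the series is the even part of Euler's series with base r, that is, half the sum of two infinite products.\<close>

lemma has_sum_kernel:
  fixes x c :: complex
  assumes x: "norm x < 1"
  shows "((\<lambda>j. (-1) ^ j * (x\<^sup>2) ^ j\<^sup>2 * qpoch (c\<^sup>2) (x ^ 4) (k + j) / qpoch (x ^ 4) (x ^ 4) j) has_sum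
     qpoch_inf (x\<^sup>2) (x ^ 4) / 2 *
       (qpoch c (x\<^sup>2) k * qpoch_inf (-c) (x\<^sup>2) + qpoch (-c) (x\<^sup>2) k * qpoch_inf c (x\<^sup>2))) UNIV"
proof -
  define t where "t = x ^ 4"
  define r where "r = x\<^sup>2"
  have rt: "r\<^sup>2 = t" by (simp add: r_def t_def power_mult[symmetric])
  have t: "norm t < 1" and r: "norm r < 1" using x by (simp_all add: t_def r_def norm_power_less_1)
  define P where "P = qpoch_inf r t"
  \<comment> \<open>Shifting by k in base t corresponds to multiplying the argument of the series with base r by r^k.\<close>
  define z where "z = c * r ^ k"
  have "((\<lambda>i. P * (r ^ ((2 * i) choose 2) * z ^ (2 * i) / qpoch r r (2 * i))) has_sum
            P * ((qpoch_inf z r + qpoch_inf (-z) r) / 2)) UNIV"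
    by (intro has_sum_cmult_right has_sum_euler_even_odd r)
  hence "((\<lambda>i. t ^ (2 * (i choose 2)) * (r * (c\<^sup>2 * t ^ k)) ^ i / qpoch t t i * qpoch_inf (r * t ^ i) t) has_sum
            P * ((qpoch_inf z r + qpoch_inf (-z) r) / 2)) UNIV"
  proof (rule has_sum_cong[THEN iffD1, rotated])
    fix i
    have nz: "qpoch r t n \<noteq> 0" "qpoch t t n \<noteq> 0" for n using r t by simp_all
    have P: "P = qpoch r t i * qpoch_inf (r * t ^ i) t"
      unfolding P_def by (rule qpoch_inf_shift[OF t])
    have "r ^ ((2 * i) choose 2) * z ^ (2 * i) = t ^ (2 * (i choose 2)) * (r * (c\<^sup>2 * t ^ k)) ^ i"
      unfolding z_def double_choose_two rt[symmetric]
      by (simp add: power_add power_mult_distrib power_mult[symmetric] mult_ac)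
    thus "P * (r ^ ((2 * i) choose 2) * z ^ (2 * i) / qpoch r r (2 * i)) =
       t ^ (2 * (i choose 2)) * (r * (c\<^sup>2 * t ^ k)) ^ i / qpoch t t i * qpoch_inf (r * t ^ i) t"
      using nz by (simp add: P qpoch_double rt)
  qed
  from has_sum_transform[OF t this]
  have base: "((\<lambda>j. qpoch (c\<^sup>2) t k * (t ^ (j choose 2) * (-r) ^ j * qpoch (c\<^sup>2 * t ^ k) t j / qpoch t t j)) has_sum
      qpoch (c\<^sup>2) t k * (P * ((qpoch_inf z r + qpoch_inf (-z) r) / 2))) UNIV"
    by (intro has_sum_cmult_right)
  have eq1: "qpoch (c\<^sup>2) t k * (t ^ (j choose 2) * (-r) ^ j * qpoch (c\<^sup>2 * t ^ k) t j / qpoch t t j) =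
      (-1) ^ j * r ^ j\<^sup>2 * qpoch (c\<^sup>2) t (k + j) / qpoch t t j" for j
    unfolding qpoch_add square_nat_choose_two rt[symmetric]
    by (simp add: power_add power_mult power_minus[of r] mult_ac)
  have eq2: "qpoch (c\<^sup>2) t k * (P * ((qpoch_inf z r + qpoch_inf (-z) r) / 2)) =
      P / 2 * (qpoch c r k * qpoch_inf (-c) r + qpoch (-c) r k * qpoch_inf c r)"
  proof -
    have "qpoch_inf c r = qpoch c r k * qpoch_inf z r" "qpoch_inf (-c) r = qpoch (-c) r k * qpoch_inf (-z) r"
      using qpoch_inf_shift[OF r, of c k] qpoch_inf_shift[OF r, of "-c" k] by (simp_all add: z_def)
    moreover have "qpoch (c\<^sup>2) t k = qpoch c r k * qpoch (-c) r k"
      using qpoch_neg_mult[of c r k] by (simp add: rt)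
    ultimately show ?thesis by (simp add: algebra_simps)
  qed
  show ?thesis
    using base unfolding eq1 eq2 unfolding P_def r_def t_def .
qed

text \<open>As before, but the extra factor r^(2j) turns the even part of Euler's series with base x^2 into its odd part.\<close>

lemma has_sum_kernel_odd:
  fixes x c :: complex
  assumes x: "norm x < 1" and c: "c \<noteq> 0" "x \<noteq> 0"
  shows "((\<lambda>j. (-1) ^ j * (x\<^sup>2) ^ (j\<^sup>2 + 2 * j) * qpoch (c\<^sup>2) (x ^ 4) (k + j) / qpoch (x ^ 4) (x ^ 4) j) has_sum
     qpoch_inf (x\<^sup>2) (x ^ 4) / (2 * c * (x\<^sup>2) ^ k) *
       (qpoch c (x\<^sup>2) k * qpoch_inf (-c) (x\<^sup>2) - qpoch (-c) (x\<^sup>2) k * qpoch_inf c (x\<^sup>2))) UNIV"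
proof -
  define t where "t = x ^ 4"
  define r where "r = x\<^sup>2"
  have rt: "r\<^sup>2 = t" by (simp add: r_def t_def power_mult[symmetric])
  have t: "norm t < 1" and r: "norm r < 1" "r \<noteq> 0" using x c by (simp_all add: t_def r_def norm_power_less_1)
  define P where "P = qpoch_inf r t"
  define z where "z = c * r ^ k"
  have z: "z \<noteq> 0" using r c by (simp add: z_def)
  have "((\<lambda>i. P / z * (r ^ ((2 * i + 1) choose 2) * z ^ (2 * i + 1) / qpoch r r (2 * i + 1))) has_sum
            P / z * ((qpoch_inf (-z) r - qpoch_inf z r) / 2)) UNIV"
    by (intro has_sum_cmult_right has_sum_euler_even_odd r)
  hence "((\<lambda>i. t ^ (2 * (i choose 2)) * (r * t * (c\<^sup>2 * t ^ k)) ^ i / qpoch t t i * qpoch_inf (r * t * t ^ i) t) has_sum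
            P / z * ((qpoch_inf (-z) r - qpoch_inf z r) / 2)) UNIV"
  proof (rule has_sum_cong[THEN iffD1, rotated])
    fix i
    have nz: "qpoch r t n \<noteq> 0" "qpoch t t n \<noteq> 0" for n using r t by simp_all
    have P: "P = qpoch r t (Suc i) * qpoch_inf (r * t * t ^ i) t"
      unfolding P_def using qpoch_inf_shift[OF t, of r "Suc i"] by (simp add: mult_ac)
    have "r ^ ((2 * i + 1) choose 2) * z ^ (2 * i) = t ^ (2 * (i choose 2)) * (r * t * (c\<^sup>2 * t ^ k)) ^ i"
      unfolding z_def double_Suc_choose_two rt[symmetric]
      by (simp add: power_add power_mult_distrib power_mult[symmetric] mult_ac eval_nat_numeral)
    hence *: "r ^ ((2 * i + 1) choose 2) * z ^ (2 * i + 1) = z * (t ^ (2 * (i choose 2)) * (r * t * (c\<^sup>2 * t ^ k)) ^ i)"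
      by simp
    show "P / z * (r ^ ((2 * i + 1) choose 2) * z ^ (2 * i + 1) / qpoch r r (2 * i + 1)) =
       t ^ (2 * (i choose 2)) * (r * t * (c\<^sup>2 * t ^ k)) ^ i / qpoch t t i * qpoch_inf (r * t * t ^ i) t"
      unfolding * qpoch_double_Suc unfolding rt P using nz[of i] nz[of "Suc i"] z by simp
  qed
  from has_sum_transform[OF t this]
  have base: "((\<lambda>j. qpoch (c\<^sup>2) t k * (t ^ (j choose 2) * (-(r * t)) ^ j * qpoch (c\<^sup>2 * t ^ k) t j / qpoch t t j)) has_sum
      qpoch (c\<^sup>2) t k * (P / z * ((qpoch_inf (-z) r - qpoch_inf z r) / 2))) UNIV"
    by (intro has_sum_cmult_right)
  have eq1: "qpoch (c\<^sup>2) t k * (t ^ (j choose 2) * (-(r * t)) ^ j * qpoch (c\<^sup>2 * t ^ k) t j / qpoch t t j) =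
      (-1) ^ j * r ^ (j\<^sup>2 + 2 * j) * qpoch (c\<^sup>2) t (k + j) / qpoch t t j" for j
    unfolding qpoch_add square_nat_choose_two rt[symmetric]
    by (simp add: power_add power_mult power_minus[of "r * _"] power_mult_distrib mult_ac
          power2_eq_square power3_eq_cube)
  have eq2: "qpoch (c\<^sup>2) t k * (P / z * ((qpoch_inf (-z) r - qpoch_inf z r) / 2)) =
      P / (2 * c * r ^ k) * (qpoch c r k * qpoch_inf (-c) r - qpoch (-c) r k * qpoch_inf c r)"
  proof -
    have "qpoch_inf c r = qpoch c r k * qpoch_inf z r" "qpoch_inf (-c) r = qpoch (-c) r k * qpoch_inf (-z) r"
      using qpoch_inf_shift[OF r(1), of c k] qpoch_inf_shift[OF r(1), of "-c" k] by (simp_all add: z_def)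
    moreover have "qpoch (c\<^sup>2) t k = qpoch c r k * qpoch (-c) r k"
      using qpoch_neg_mult[of c r k] by (simp add: rt)
    ultimately show ?thesis using c r by (simp add: z_def field_simps)
  qed
  show ?thesis
    using base unfolding eq1 eq2 unfolding P_def r_def t_def .
qed

text \<open>Lebesgue's identity. With y = -t the transformed series contains (-t^(i+1); t)_inf = (-t; t)_inf / (-t; t)_i, and
(t; t)_i (-t; t)_i = (t^2; t^2)_i makes it an Euler series with base t^2.\<close>

lemma has_sum_lebesgue:
  fixes t a :: complex
  assumes t: "norm t < 1"
  shows "((\<lambda>j. t ^ (j choose 2) * t ^ j * qpoch a t j / qpoch t t j) has_sum
           qpoch_inf (-t) t * qpoch_inf (a * t) (t\<^sup>2)) UNIV"
proof -
  have t2: "norm (t\<^sup>2) < 1" using t by (simp add: norm_power_less_1)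
  have "((\<lambda>i. qpoch_inf (-t) t * ((t\<^sup>2) ^ (i choose 2) * (-(a * t)) ^ i / qpoch (t\<^sup>2) (t\<^sup>2) i)) has_sum
           qpoch_inf (-t) t * qpoch_inf (a * t) (t\<^sup>2)) UNIV"
    by (intro has_sum_cmult_right has_sum_euler t2)
  hence "((\<lambda>i. t ^ (2 * (i choose 2)) * (-t * a) ^ i / qpoch t t i * qpoch_inf (-t * t ^ i) t) has_sum
           qpoch_inf (-t) t * qpoch_inf (a * t) (t\<^sup>2)) UNIV"
  proof (rule has_sum_cong[THEN iffD1, rotated])
    fix i
    have P: "qpoch_inf (-t) t = qpoch (-t) t i * qpoch_inf (-t * t ^ i) t"
      by (rule qpoch_inf_shift[OF t])
    have Q: "qpoch (t\<^sup>2) (t\<^sup>2) i = qpoch t t i * qpoch (-t) t i"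
      using qpoch_neg_mult[of t t i] by simp
    have nz: "qpoch (-t) t n \<noteq> 0" "qpoch t t n \<noteq> 0" for n using t by simp_all
    have e: "(-(a * t)) ^ i = (-t * a) ^ i" by (simp add: mult.commute)
    show "qpoch_inf (-t) t * ((t\<^sup>2) ^ (i choose 2) * (-(a * t)) ^ i / qpoch (t\<^sup>2) (t\<^sup>2) i) =
        t ^ (2 * (i choose 2)) * (-t * a) ^ i / qpoch t t i * qpoch_inf (-t * t ^ i) t"
      unfolding P Q e using nz[of i] by (simp add: power_mult)
  qed
  from has_sum_transform[OF t this] show ?thesis by simp
qed

section \<open>A Bailey pair with one free parameter\<close>

text \<open>The customary factor (a; q)_r / (1 - a) is written as (a q; q)_{r-1}. This is a polynomial in a, so a = 1 is covered;
it forces the case r = 0 to be listed separately.\<close>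

definition bailey_alpha :: "complex \<Rightarrow> complex \<Rightarrow> complex \<Rightarrow> nat \<Rightarrow> complex" where
  "bailey_alpha a c q r =
     (if r = 0 then 1
      else (\<Prod>i<r. (c - a * q ^ Suc i) / (1 - c * q ^ i)) * q ^ (2 * (r choose 2)) * (1 - a * q ^ (2 * r)) *
             qpoch (a * q) q (r - 1) / qpoch q q r)"

text \<open>The polynomial identity behind one step of the telescoping in the next proof, with p = q^m and u = q^(n-m-1).\<close>

lemma bailey_pair_algebra:
  fixes a c q p u :: complex
  shows "- (u * (c - a * (q * q * p)) * (q * p * (q * p)) * (1 - a * (q * p)) * (1 - q * u)) +
         q * u * (1 - c * p) * (1 - q * p) * (1 - a * (q * q * q * p * p * u)) =
         (1 - a * (q * q * p * p)) * ((1 - q * (q * p * u)) * (1 - c * (q * p * u)) -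
            (1 - q * u) * (1 - a * (q * q * q * p * p * u)))"
  by (simp add: algebra_simps)

text \<open>After multiplication by (q)_n (c)_n the left hand side has to be independent of n. The difference of its summands at n + 1 and n is summed in closed form
over r = 0, ..., m; the value H n m is its Wilf-Zeilberger certificate. At m = n it cancels the one additional term of the longer sum.\<close>

lemma bailey_pair:
  fixes a c q :: complex
  assumes q: "norm q < 1" and a: "\<And>k. a * q ^ Suc k \<noteq> 1" and c: "\<And>k. c * q ^ k \<noteq> 1"
  shows "(\<Sum>r\<le>n. bailey_alpha a c q r / (qpoch q q (n - r) * qpoch (a * q) q (n + r))) =
           1 / (qpoch q q n * qpoch c q n)"
proof -
  define Q where "Q = qpoch q q"
  define R where "R = qpoch (a * q) q"
  define C where "C = qpoch c q"
  define X where "X = (\<lambda>r. (\<Prod>i<Suc r. c - a * q ^ Suc i) / (\<Prod>i<r. 1 - c * q ^ i))"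
  define al where "al = bailey_alpha a c q"
  define s where "s = (\<lambda>n r. Q n * C n * al r / (Q (n - r) * R (n + r)))"
  define H where "H = (\<lambda>n r. - (q ^ (n - r) * (Q n * C n) * X r * q ^ (2 * (Suc r choose 2)) * R r /
                          (Q r * Q (n - r) * R (Suc (n + r)))))"
  have nzQ: "Q n \<noteq> 0" for n using q by (simp add: Q_def)
  have nzC: "C n \<noteq> 0" for n using c by (auto simp: C_def qpoch_eq_0_iff)
  have nzR: "R n \<noteq> 0" for n using a by (auto simp: R_def qpoch_eq_0_iff mult.assoc)
  have Q_Suc: "Q (Suc n) = Q n * (1 - q * q ^ n)" and C_Suc: "C (Suc n) = C n * (1 - c * q ^ n)"
    and R_Suc: "R (Suc n) = R n * (1 - a * q * q ^ n)" for n
    by (simp_all add: Q_def C_def R_def qpoch_Suc)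
  have nzc: "1 - c * q ^ k \<noteq> 0" for k using c[of k] by simp
  have X_Suc: "X (Suc r) = X r * (c - a * q ^ Suc (Suc r)) / (1 - c * q ^ r)" for r
    by (simp add: X_def)
  have al_Suc: "al (Suc r) = X r / (1 - c * q ^ r) * q ^ (2 * (Suc r choose 2)) *
       (1 - a * q ^ (2 * Suc r)) * R r / Q (Suc r)" for r
    by (simp add: al_def bailey_alpha_def X_def R_def Q_def prod_dividef)
  have partial: "(\<Sum>r\<le>m. s (Suc n) r - s n r) = H n m" if "m \<le> n" for m n
    using that
  proof (induction m)
    case 0
    have "1 - a * q * q ^ n \<noteq> 0" using nzR[of "Suc n"] by (auto simp: R_Suc)
    hence "s n 0 = C n / R (Suc n) * (1 - a * q * q ^ n)"
      using nzQ[of n] by (simp add: s_def al_def bailey_alpha_def R_Suc)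
    moreover have "s (Suc n) 0 = C n / R (Suc n) * (1 - c * q ^ n)"
      using nzQ[of "Suc n"] by (simp add: s_def al_def bailey_alpha_def C_Suc)
    ultimately have "s (Suc n) 0 - s n 0 = C n / R (Suc n) * ((1 - c * q ^ n) - (1 - a * q * q ^ n))"
      by (simp only: right_diff_distrib)
    also have "\<dots> = H n 0"
      using nzQ[of n] nzR[of "Suc n"] unfolding H_def
      by (simp add: X_def Suc_choose_two R_def Q_def divide_simps) (simp add: algebra_simps)
    finally show ?case by simp
  next
    case (Suc m)
    then obtain k where n: "n = Suc (m + k)" by (metis Suc_le_D add_Suc le_Suc_ex)
    define u where "u = q ^ k"
    define p where "p = q ^ m"
    define E where "E = q ^ (2 * (Suc m choose 2))"
    define W where "W = Q n * C n * X m * E * R m /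
        (Q (Suc m) * (1 - c * p) * Q (Suc k) * R (Suc (Suc (n + m))))"
    have pw: "q ^ n = q * p * u" "q ^ (n - m) = q * u" "q ^ (n - Suc m) = u" "q ^ Suc (Suc m) = q * q * p"
      "q ^ (n + Suc m) = q * q * p * p * u" "q ^ (2 * Suc m) = q * q * p * p" "n - m = Suc k" "n - Suc m = k"
      "Suc n - Suc m = Suc k"
      by (simp_all add: n p_def u_def power_add power_mult power2_eq_square algebra_simps)
    have E2: "q ^ (2 * (Suc (Suc m) choose 2)) = E * (q * p * (q * p))"
      by (simp add: E_def Suc_choose_two[of "Suc m"] p_def power_add mult_2)
    have nz: "1 - c * p \<noteq> 0" using nzc by (simp add: p_def)
    note Rs = R_Suc[of "n + Suc m", unfolded pw]
    have Rn: "R (Suc (Suc (n + m))) = R (Suc (n + m)) * (1 - a * (q * q * q * p * p * u))"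
      using R_Suc[of "n + Suc m"] unfolding pw by (simp add: mult_ac)
    have nzk: "1 - q * u \<noteq> 0" "1 - a * (q * q * q * p * p * u) \<noteq> 0" "1 - q * p \<noteq> 0"
      using nzQ[of "Suc k"] nzR[of "Suc (Suc (n + m))"] nzQ[of "Suc m"] Rn by (auto simp: Q_Suc u_def p_def)
    have H1: "H n (Suc m) = W * (- (u * (c - a * (q * q * p)) * (q * p * (q * p)) * (1 - a * (q * p)) * (1 - q * u)))"
      unfolding H_def W_def pw E2 X_Suc using nzQ[of k] nzQ[of "Suc m"] nzR[of "Suc (Suc (n + m))"] nz nzk
      by (simp add: R_Suc Q_Suc p_def[symmetric] u_def[symmetric] pw mult_ac)
    have H2: "- H n m = W * (q * u * (1 - c * p) * (1 - q * p) * (1 - a * (q * q * q * p * p * u)))"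
      unfolding H_def W_def pw E_def[symmetric] Rn using nz nzk nzQ[of m] nzR[of "Suc (n + m)"]
      by (simp add: Q_Suc p_def[symmetric] u_def[symmetric] mult_ac)
    have S1: "s (Suc n) (Suc m) = W * ((1 - a * (q * q * p * p)) * ((1 - q * (q * p * u)) * (1 - c * (q * p * u))))"
      unfolding s_def W_def al_Suc pw E_def[symmetric] Q_Suc[of n] C_Suc[of n] p_def[symmetric] using nz
      by (simp add: pw mult_ac)
    have S2: "s n (Suc m) = W * ((1 - a * (q * q * p * p)) * ((1 - q * u) * (1 - a * (q * q * q * p * p * u))))"
      unfolding s_def W_def al_Suc pw E_def[symmetric] p_def[symmetric] Rn Q_Suc[of k] u_def[symmetric]
      using nz nzk by (simp add: mult_ac)
    have "H n (Suc m) = H n m + (s (Suc n) (Suc m) - s n (Suc m))"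
    proof -
      have "H n (Suc m) + - H n m = W * (- (u * (c - a * (q * q * p)) * (q * p * (q * p)) * (1 - a * (q * p)) * (1 - q * u)) +
         q * u * (1 - c * p) * (1 - q * p) * (1 - a * (q * q * q * p * p * u)))"
        unfolding H1 H2 by (rule distrib_left[symmetric])
      also have "\<dots> = s (Suc n) (Suc m) - s n (Suc m)"
        unfolding bailey_pair_algebra S1 S2 by (simp only: right_diff_distrib)
      finally show ?thesis by (simp add: algebra_simps)
    qed
    thus ?case using Suc by simp
  qed
  have "(\<Sum>r\<le>n. s n r) = 1" for n
  proof (induction n)
    case 0
    show ?case by (simp add: s_def al_def bailey_alpha_def Q_def C_def R_def)
  next
    case (Suc n)
    have "s (Suc n) (Suc n) = - H n n"
    proof -
      have "R (Suc n + Suc n) = R (Suc (n + n)) * (1 - a * q ^ (2 * Suc n))"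
        using R_Suc[of "Suc (n + n)"] by (simp add: power_add power_mult power2_eq_square mult_ac)
      moreover from this nzR[of "Suc n + Suc n"] have "1 - a * q ^ (2 * Suc n) \<noteq> 0" by auto
      ultimately show ?thesis
        unfolding s_def H_def al_Suc C_Suc
        using nzQ[of n] nzQ[of "Suc n"] nzR[of "Suc (n + n)"] nzc[of n]
        by (simp add: Q_Suc Q_def mult_ac)
    qed
    thus ?case using partial[of n n] Suc by (simp add: sum_subtractf diff_eq_eq)
  qed
  hence "(\<Sum>r\<le>n. s n r) / (Q n * C n) = 1 / (Q n * C n)" by simp
  also have "(\<Sum>r\<le>n. s n r) / (Q n * C n) = (\<Sum>r\<le>n. al r / (Q (n - r) * R (n + r)))"
    unfolding sum_divide_distrib s_def using nzQ nzC by (intro sum.cong refl) simp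
  finally show ?thesis by (simp add: al_def Q_def R_def C_def)
qed

text \<open>Geometric growth in r is enough, since the series in which these coefficients occur carries a Gaussian factor.\<close>

lemma norm_bailey_alpha_le:
  assumes q: "norm q < 1" and c: "\<And>k. c * q ^ k \<noteq> 1"
  obtains K where "K \<ge> 1" "\<And>r. norm (bailey_alpha a c q r) \<le> K * (norm a + norm c) ^ r"
proof -
  obtain C1 where C1: "C1 \<ge> 1" "\<And>n. norm (1 / qpoch q q n) \<le> C1"
    using inverse_qpoch_bounded[OF q self_mult_power_neq_1[OF q]] by metis
  obtain C2 where C2: "C2 \<ge> 1" "\<And>n. norm (1 / qpoch c q n) \<le> C2"
    using inverse_qpoch_bounded[OF q c] by metis
  obtain C3 where C3: "C3 \<ge> 1" "\<And>n. norm (qpoch (a * q) q n) \<le> C3"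
    using qpoch_bounded[OF q] by metis
  define K where "K = C2 * (1 + norm a) * C3 * C1"
  have "1 \<le> C2 * (1 + norm a)" using C2(1) by (smt (verit) mult_le_cancel_left1 norm_ge_zero)
  hence "1 \<le> C2 * (1 + norm a) * C3" using C3(1) by (smt (verit) mult_le_cancel_left1)
  hence K1: "1 \<le> K" using C1(1) unfolding K_def by (smt (verit) mult_le_cancel_left1)
  show ?thesis
  proof (rule that[OF K1])
    fix r
    show "norm (bailey_alpha a c q r) \<le> K * (norm a + norm c) ^ r"
    proof (cases "r = 0")
      case False
      have eq: "bailey_alpha a c q r = (\<Prod>i<r. c - a * q ^ Suc i) * (1 / qpoch c q r) * q ^ (2 * (r choose 2)) *
         (1 - a * q ^ (2 * r)) * qpoch (a * q) q (r - 1) * (1 / qpoch q q r)"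
        using False by (simp add: bailey_alpha_def prod_dividef qpoch_def)
      have b1: "norm (\<Prod>i<r. c - a * q ^ Suc i) \<le> (norm a + norm c) ^ r"
        using norm_diff_mult_power_le[of q a "Suc _" c] q
        by (intro norm_prod_le_power) (simp add: norm_minus_commute)
      have b2: "norm (q ^ (2 * (r choose 2))) \<le> 1"
        using q by (simp add: norm_power power_le_one)
      have b3: "norm (1 - a * q ^ (2 * r)) \<le> 1 + norm a"
        using norm_diff_mult_power_le[of q a "2 * r" 1] q by (simp add: norm_minus_commute)
      have "norm (bailey_alpha a c q r) \<le> (norm a + norm c) ^ r * C2 * 1 * (1 + norm a) * C3 * C1"
        unfolding eq norm_mult[of "_ * _"] norm_mult[of "prod _ _"] norm_mult[of "1 / _"]
        using C1(1) C2(1) C3(1) by (intro mult_mono C1(2) C2(2) C3(2) b1 b2 b3) auto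
      thus ?thesis by (simp add: K_def mult_ac)
    qed (use K1 in \<open>simp add: bailey_alpha_def\<close>)
  qed
qed

text \<open>The left hand side is expanded with the Bailey pair and the order of summation is exchanged. The inner sum is the q-Gauss sum
with parameters c = a q^(2r+1) and y q^r.\<close>

lemma has_sum_bailey:
  fixes a c q y S :: complex
  assumes q: "norm q < 1" and a: "\<And>k. a * q ^ Suc k \<noteq> 1" and c: "\<And>k. c * q ^ k \<noteq> 1"
    and y: "\<And>k. y * q ^ k \<noteq> 1"
  assumes S: "((\<lambda>r. wprod (a * q) y q r / qpoch y q r * bailey_alpha a c q r) has_sum S) UNIV"
  shows "((\<lambda>n. wprod (a * q) y q n / (qpoch q q n * qpoch c q n)) has_sum
            (qpoch_inf y q / qpoch_inf (a * q) q * S)) UNIV"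
proof -
  define f where "f = (\<lambda>r j. wprod (a * q) y q (r + j) * bailey_alpha a c q r /
      (qpoch q q j * qpoch (a * q) q (2 * r + j)))"
  have nzR: "qpoch (a * q) q n \<noteq> 0" for n using a by (auto simp: qpoch_eq_0_iff mult.assoc)
  have nzY: "qpoch y q n \<noteq> 0" for n using y by (auto simp: qpoch_eq_0_iff)
  have nzRi: "qpoch_inf (a * q) q \<noteq> 0" using a q by (auto simp: qpoch_inf_nonzero_iff mult.assoc)
  obtain K where K: "K \<ge> 1" "\<And>r. norm (bailey_alpha a c q r) \<le> K * (norm a + norm c) ^ r"
    using norm_bailey_alpha_le[OF q c] by metis
  obtain C1 where C1: "C1 \<ge> 1" "\<And>n. norm (1 / qpoch q q n) \<le> C1"
    using inverse_qpoch_bounded[OF q self_mult_power_neq_1[OF q]] by metis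
  obtain C2 where C2: "C2 \<ge> 1" "\<And>n. norm (1 / qpoch (a * q) q n) \<le> C2"
    using inverse_qpoch_bounded[OF q, of "a * q"] a by (metis mult.assoc power_Suc)
  define B where "B = norm (a * q) + norm y"
  define B' where "B' = norm a + norm c"
  have B: "B \<ge> 0" "B' \<ge> 0" by (simp_all add: B_def B'_def)
  define g where "g = (\<lambda>B n. B ^ n * norm q ^ (n choose 2))"
  have g: "g B summable_on UNIV" "g B n \<ge> 0" if "B \<ge> 0" for B n
    using that q summable_gauss_nat[of "norm q" B] by (auto simp: g_def)
  have "(\<lambda>(r, j). (K * (C1 * C2)) * g (B * B') r * g B j) summable_on UNIV \<times> UNIV"
    using K C1 C2 B by (intro summable_on_times_real summable_on_cmult_right g mult_nonneg_nonneg) auto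
  hence summable: "(\<lambda>(r, j). f r j) summable_on UNIV"
    unfolding UNIV_Times_UNIV
  proof (rule summable_on_complex_majorant)
    fix p :: "nat \<times> nat"
    obtain r j where p: "p = (r, j)" by (cases p)
    have "norm (wprod (a * q) y q (r + j)) \<le> B ^ (r + j) * norm q ^ ((r + j) choose 2)"
      unfolding B_def using q by (intro norm_wprod_le) auto
    also have "\<dots> \<le> B ^ (r + j) * norm q ^ ((r choose 2) + (j choose 2))"
      using q B by (intro mult_left_mono power_decreasing) (auto simp: choose_two_add)
    also have "\<dots> = B ^ r * norm q ^ (r choose 2) * g B j"
      by (simp add: g_def power_add mult_ac)
    finally have b: "norm (wprod (a * q) y q (r + j)) \<le> B ^ r * norm q ^ (r choose 2) * g B j" .
    have "norm (f r j) = norm (wprod (a * q) y q (r + j)) * norm (bailey_alpha a c q r) *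
        (norm (1 / qpoch q q j) * norm (1 / qpoch (a * q) q (2 * r + j)))"
      by (simp add: f_def norm_mult norm_divide)
    also have "\<dots> \<le> (B ^ r * norm q ^ (r choose 2) * g B j) * (K * B' ^ r) * (C1 * C2)"
      using C1(1) C2(1) K(1) B g by (intro mult_mono b K(2)[folded B'_def] C1(2) C2(2)) auto
    also have "\<dots> = (K * (C1 * C2)) * g (B * B') r * g B j"
      by (simp add: g_def power_mult_distrib mult_ac)
    finally show "norm (case p of (r, j) \<Rightarrow> f r j) \<le> (case p of (r, j) \<Rightarrow> (K * (C1 * C2)) * g (B * B') r * g B j)"
      by (simp add: p)
  qed
  have "((\<lambda>(r, j). f r j) has_sum qpoch_inf y q / qpoch_inf (a * q) q * S) UNIV"
  proof (rule has_sum_iterated_rev[OF summable])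
    show "((\<lambda>r. qpoch_inf y q / qpoch_inf (a * q) q *
              (wprod (a * q) y q r / qpoch y q r * bailey_alpha a c q r)) has_sum
              qpoch_inf y q / qpoch_inf (a * q) q * S) UNIV"
      by (intro has_sum_cmult_right S)
  next
    fix r
    define a' where "a' = a * q * q ^ (2 * r)"
    have ne: "a' * q ^ k \<noteq> 1" for k
      using a[of "2 * r + k"] by (simp add: a'_def power_add mult_ac)
    have "((\<lambda>j. wprod (a * q) y q r * bailey_alpha a c q r / qpoch (a * q) q (2 * r) *
             (wprod a' (y * q ^ r) q j / (qpoch q q j * qpoch a' q j))) has_sum
          wprod (a * q) y q r * bailey_alpha a c q r / qpoch (a * q) q (2 * r) *
            (qpoch_inf (y * q ^ r) q / qpoch_inf a' q)) UNIV"
      by (intro has_sum_cmult_right has_sum_gauss q ne)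
    also have "(\<lambda>j. wprod (a * q) y q r * bailey_alpha a c q r / qpoch (a * q) q (2 * r) *
             (wprod a' (y * q ^ r) q j / (qpoch q q j * qpoch a' q j))) = f r"
      by (rule ext) (simp add: f_def wprod_add qpoch_add a'_def mult_ac)
    also have "wprod (a * q) y q r * bailey_alpha a c q r / qpoch (a * q) q (2 * r) *
            (qpoch_inf (y * q ^ r) q / qpoch_inf a' q) = qpoch_inf y q / qpoch_inf (a * q) q *
              (wprod (a * q) y q r / qpoch y q r * bailey_alpha a c q r)"
    proof -
      have "qpoch_inf y q = qpoch y q r * qpoch_inf (y * q ^ r) q"
        "qpoch_inf (a * q) q = qpoch (a * q) q (2 * r) * qpoch_inf a' q"
        unfolding a'_def by (rule qpoch_inf_shift[OF q])+
      thus ?thesis using nzY[of r] nzR[of "2 * r"] nzRi by simp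
    qed
    finally show "(f r has_sum qpoch_inf y q / qpoch_inf (a * q) q *
              (wprod (a * q) y q r / qpoch y q r * bailey_alpha a c q r)) UNIV" .
  qed
  from has_sum_antidiagonal[OF this] show ?thesis
  proof (rule has_sum_cong[THEN iffD1, rotated])
    fix n
    have "(\<Sum>r\<le>n. f r (n - r)) = (\<Sum>r\<le>n. wprod (a * q) y q n *
            (bailey_alpha a c q r / (qpoch q q (n - r) * qpoch (a * q) q (n + r))))"
    proof (intro sum.cong refl)
      fix r assume "r \<in> {..n}"
      hence "r + (n - r) = n" "2 * r + (n - r) = n + r" by auto
      thus "f r (n - r) = wprod (a * q) y q n *
            (bailey_alpha a c q r / (qpoch q q (n - r) * qpoch (a * q) q (n + r)))"
        unfolding f_def by (simp add: add.commute)
    qed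
    also have "\<dots> = wprod (a * q) y q n / (qpoch q q n * qpoch c q n)"
      unfolding sum_distrib_left[symmetric] bailey_pair[OF q a c] by simp
    finally show "(\<Sum>r\<le>n. f r (n - r)) = wprod (a * q) y q n / (qpoch q q n * qpoch c q n)" .
  qed
qed

section \<open>The Jacobi triple product\<close>

definition theta :: "complex \<Rightarrow> complex \<Rightarrow> complex" where
  "theta z q = (\<Sum>\<^sub>\<infinity>n::int. (-1) powi n * q powi (n * (n - 1) div 2) * z powi n)"

lemma bij_betw_int_nat_pairs:
  "bij_betw (\<lambda>(n::int, k::nat). (k + nat n, k + nat (-n))) UNIV UNIV"
proof (rule bij_betwI[of _ _ _ "\<lambda>(i, j). (int i - int j, min i j)"])
  show "(case case p of (n, k) \<Rightarrow> (k + nat n, k + nat (- n)) of (i, j) \<Rightarrow> (int i - int j, min i j)) = p"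
    for p :: "int \<times> nat" by (cases p) auto
  show "(case case p of (i, j) \<Rightarrow> (int i - int j, min i j) of (n, k) \<Rightarrow> (k + nat n, k + nat (- n))) = p"
    for p :: "nat \<times> nat" by (cases p) auto
qed auto

lemma powi_half_square_nonneg: "q powi (int m * (int m - 1) div 2) = q ^ (m choose 2)"
proof -
  have "int m * (int m - 1) div 2 = int (m choose 2)"
    using choose_two_int[of m] by simp
  thus ?thesis by simp
qed

lemma powi_half_square_neg: "q powi (- int m * (- int m - 1) div 2) = q ^ ((m choose 2) + m)"
proof -
  have "- int m * (- int m - 1) = 2 * int ((m choose 2) + m)"
    using choose_two_int[of m] by (simp add: algebra_simps)
  hence "- int m * (- int m - 1) div 2 = int ((m choose 2) + m)" by simp
  thus ?thesis by (metis power_int_of_nat)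
qed

text \<open>The degenerate case y = 0 of the q-Gauss sum. Combinatorially, partitions are sorted by their Durfee rectangle with excess m.\<close>

lemma has_sum_durfee:
  assumes q: "norm q < 1"
  shows "((\<lambda>k. q ^ (2 * (k choose 2) + (m + 1) * k) / (qpoch q q k * qpoch q q (k + m))) has_sum
            1 / qpoch_inf q q) UNIV"
proof -
  have ne: "q ^ Suc m * q ^ k \<noteq> 1" for k
    using self_mult_power_neq_1[OF q, of "m + k"] by (simp add: power_add mult_ac)
  have "((\<lambda>k. 1 / qpoch q q m * (wprod (q ^ Suc m) 0 q k / (qpoch q q k * qpoch (q ^ Suc m) q k))) has_sum
           1 / qpoch q q m * (qpoch_inf 0 q / qpoch_inf (q ^ Suc m) q)) UNIV"
    by (intro has_sum_cmult_right has_sum_gauss q ne)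
  also have "(\<lambda>k. 1 / qpoch q q m * (wprod (q ^ Suc m) 0 q k / (qpoch q q k * qpoch (q ^ Suc m) q k))) =
      (\<lambda>k. q ^ (2 * (k choose 2) + (m + 1) * k) / (qpoch q q k * qpoch q q (k + m)))"
  proof
    fix k
    have "wprod (q ^ Suc m) 0 q k = q ^ (2 * (k choose 2) + (m + 1) * k)"
    proof (induction k)
      case (Suc k)
      have "2 * (Suc k choose 2) + (m + 1) * Suc k = (2 * (k choose 2) + (m + 1) * k) + (Suc m + k + k)"
        by (simp add: Suc_choose_two)
      thus ?case unfolding wprod_Suc Suc.IH by (simp only: power_add diff_zero mult.assoc)
    qed auto
    thus "1 / qpoch q q m * (wprod (q ^ Suc m) 0 q k / (qpoch q q k * qpoch (q ^ Suc m) q k)) =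
       q ^ (2 * (k choose 2) + (m + 1) * k) / (qpoch q q k * qpoch q q (k + m))"
      using qpoch_add[of q q m k] by (simp add: add.commute mult_ac)
  qed
  also have "1 / qpoch q q m * (qpoch_inf 0 q / qpoch_inf (q ^ Suc m) q) = 1 / qpoch_inf q q"
    using qpoch_inf_shift_self[OF q, of m] q by (simp add: field_simps)
  finally show ?thesis .
qed

text \<open>Both products in z are expanded by Euler's series. The pairs (i, j) of summation indices are regrouped by n = i - j; for
fixed n the sum over the smaller of the two indices gives 1/(q)_inf.\<close>

theorem jacobi_triple_product:
  assumes q: "norm q < 1" "q \<noteq> 0" and z: "z \<noteq> 0"
  shows "((\<lambda>n::int. (-1) powi n * q powi (n * (n - 1) div 2) * z powi n) has_sum
            qpoch_inf z q * qpoch_inf (q / z) q * qpoch_inf q q) UNIV"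
proof -
  define e where "e = (\<lambda>y n. q ^ (n choose 2) * (-y) ^ n / qpoch q q n)"
  define f where "f = (\<lambda>i j. e z i * e (q / z) j)"
  have e: "(e y has_sum qpoch_inf y q) UNIV" for y
    unfolding e_def by (rule has_sum_euler[OF q(1)])
  have e_abs: "(\<lambda>n. norm (e y n)) summable_on UNIV" for y
    using e[of y] by (metis has_sum_imp_summable summable_on_iff_abs_summable_on_complex)
  have "(\<lambda>(i, j). norm (e z i) * norm (e (q / z) j)) summable_on UNIV \<times> UNIV"
    by (intro summable_on_times_real e_abs) auto
  hence summable: "(\<lambda>(i, j). f i j) summable_on UNIV"
    unfolding UNIV_Times_UNIV
    by (rule summable_on_complex_majorant) (auto simp: f_def norm_mult)
  have f: "((\<lambda>(i, j). f i j) has_sum qpoch_inf z q * qpoch_inf (q / z) q) UNIV"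
  proof (rule has_sum_iterated_rev[OF summable])
    show "(f i has_sum e z i * qpoch_inf (q / z) q) UNIV" for i
      unfolding f_def by (intro has_sum_cmult_right e)
  qed (intro has_sum_cmult_left e)
  define h where "h = (\<lambda>(n::int) k. f (k + nat n) (k + nat (-n)))"
  have "((\<lambda>(n, k). h n k) has_sum qpoch_inf z q * qpoch_inf (q / z) q) UNIV"
    using has_sum_reindex_bij_betw[OF bij_betw_int_nat_pairs, of "\<lambda>(i, j). f i j"] f
    by (simp add: h_def case_prod_unfold)
  hence "((\<lambda>n::int. (-1) powi n * q powi (n * (n - 1) div 2) * z powi n * (1 / qpoch_inf q q)) has_sum
            qpoch_inf z q * qpoch_inf (q / z) q) UNIV"
  proof (rule has_sum_iterated)
    fix n :: int
    have zq: "(-z) ^ k * (-(q / z)) ^ k = q ^ k" for k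
      using z by (simp flip: power_mult_distrib)
    have "((\<lambda>k. (-1) powi n * q powi (n * (n - 1) div 2) * z powi n *
              (q ^ (2 * (k choose 2) + (nat \<bar>n\<bar> + 1) * k) / (qpoch q q k * qpoch q q (k + nat \<bar>n\<bar>)))) has_sum
            (-1) powi n * q powi (n * (n - 1) div 2) * z powi n * (1 / qpoch_inf q q)) UNIV"
      by (intro has_sum_cmult_right has_sum_durfee q)
    also have "(\<lambda>k. (-1) powi n * q powi (n * (n - 1) div 2) * z powi n *
              (q ^ (2 * (k choose 2) + (nat \<bar>n\<bar> + 1) * k) / (qpoch q q k * qpoch q q (k + nat \<bar>n\<bar>)))) = h n"
    proof
      fix k
      show "(-1) powi n * q powi (n * (n - 1) div 2) * z powi n *
              (q ^ (2 * (k choose 2) + (nat \<bar>n\<bar> + 1) * k) / (qpoch q q k * qpoch q q (k + nat \<bar>n\<bar>))) = h n k"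
      proof (cases n rule: int_cases2)
        case (nonneg m)
        have "h n k = q ^ ((k + m) choose 2) * q ^ (k choose 2) * ((-z) ^ m * ((-z) ^ k * (-(q / z)) ^ k)) /
             (qpoch q q k * qpoch q q (k + m))"
          by (simp add: h_def f_def e_def nonneg power_add mult_ac)
        also have "\<dots> = ((-1) ^ m * q ^ (m choose 2) * z ^ m) * (q ^ (2 * (k choose 2) + (m + 1) * k) /
             (qpoch q q k * qpoch q q (k + m)))"
          unfolding zq by (simp add: choose_two_add power_add power_minus[of z] mult_2 mult_ac)
        finally show ?thesis unfolding nonneg powi_half_square_nonneg by simp
      next
        case (nonpos m)
        have "h n k = q ^ ((k + m) choose 2) * q ^ (k choose 2) * ((-(q / z)) ^ m * ((-z) ^ k * (-(q / z)) ^ k)) /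
             (qpoch q q k * qpoch q q (k + m))"
          by (simp add: h_def f_def e_def nonpos power_add mult_ac)
        also have "\<dots> = ((-1) ^ m * q ^ ((m choose 2) + m) * (1 / z) ^ m) * (q ^ (2 * (k choose 2) + (m + 1) * k) /
             (qpoch q q k * qpoch q q (k + m)))"
          unfolding zq by (simp add: choose_two_add power_add power_minus[of "q / z"] power_divide mult_2 mult_ac)
        also have "(1 / z) ^ m = z powi (- int m)"
          by (simp add: power_int_minus inverse_eq_divide power_one_over)
        also have "(-1) ^ m = ((-1) powi (- int m) :: complex)"
          by (simp add: power_int_minus flip: power_inverse)
        finally show ?thesis unfolding nonpos powi_half_square_neg by simp
      qed
    qed
    finally show "(h n has_sum (-1) powi n * q powi (n * (n - 1) div 2) * z powi n * (1 / qpoch_inf q q)) UNIV" .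
  qed
  from has_sum_cmult_left[OF this, of "qpoch_inf q q"] show ?thesis using q(1) by simp
qed

lemma theta_product:
  assumes "norm q < 1" "q \<noteq> 0" "z \<noteq> 0"
  shows "theta z q = qpoch_inf z q * qpoch_inf (q / z) q * qpoch_inf q q"
  unfolding theta_def by (rule infsumI[OF jacobi_triple_product[OF assms]])

definition qsum :: "int \<Rightarrow> int \<Rightarrow> complex \<Rightarrow> complex" where
  "qsum a b q = (\<Sum>\<^sub>\<infinity>n::int. q powi (a * n\<^sup>2 + b * n))"

lemma theta_term_eq:
  assumes "q \<noteq> (0::complex)"
  shows "(-1) powi n * (q powi (2 * a)) powi (n * (n - 1) div 2) * (-(q powi (a + b))) powi n = q powi (a * n\<^sup>2 + b * n)"
proof -
  define h where "h = n * (n - 1) div 2"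
  have h: "2 * h = n * (n - 1)" by (simp add: h_def)
  have e: "a * n\<^sup>2 + b * n = 2 * a * h + (a + b) * n"
  proof -
    have "2 * a * h = a * (n * (n - 1))" by (simp only: h[symmetric] mult_ac)
    thus ?thesis by (simp add: algebra_simps power2_eq_square)
  qed
  have "q powi (2 * a * h + (a + b) * n) = q powi (2 * a * h) * q powi ((a + b) * n)"
    by (rule power_int_add) (use assms in auto)
  hence *: "q powi (a * n\<^sup>2 + b * n) = (q powi (2 * a)) powi h * (q powi (a + b)) powi n"
    by (simp only: e power_int_mult)
  have "(-(q powi (a + b))) powi n = (-1) powi n * (q powi (a + b)) powi n"
    by (subst mult_minus1[symmetric], rule power_int_mult_distrib)
  moreover have "(-1) powi n * (-1) powi n = (1::complex)"
    by (subst power_int_mult_distrib[symmetric]) simp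
  ultimately show ?thesis unfolding * h_def[symmetric] by (simp add: mult_ac)
qed

lemma norm_powi_less_1: "norm (q::complex) < 1 \<Longrightarrow> q \<noteq> 0 \<Longrightarrow> 0 < m \<Longrightarrow> norm (q powi m) < 1"
  by (metis norm_power_less_1 zero_less_imp_eq_int power_int_of_nat)

lemma has_sum_qsum:
  assumes "norm q < 1" "q \<noteq> 0" "a > 0"
  shows "((\<lambda>n::int. q powi (a * n\<^sup>2 + b * n)) has_sum qsum a b q) UNIV"
proof -
  have "((\<lambda>n::int. (-1) powi n * (q powi (2 * a)) powi (n * (n - 1) div 2) * (-(q powi (a + b))) powi n) has_sum
       qpoch_inf (-(q powi (a + b))) (q powi (2 * a)) * qpoch_inf (q powi (2 * a) / (-(q powi (a + b)))) (q powi (2 * a)) *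
         qpoch_inf (q powi (2 * a)) (q powi (2 * a))) UNIV"
    using assms by (intro jacobi_triple_product norm_powi_less_1) auto
  from has_sum_imp_summable[OF this] show ?thesis
    unfolding theta_term_eq[OF assms(2)] qsum_def by (rule has_sum_infsum)
qed

lemma qsum_product:
  assumes "norm q < 1" "q \<noteq> 0" "a > 0"
  shows "qsum a b q = qpoch_inf (-(q powi (a + b))) (q powi (2 * a)) *
           qpoch_inf (-(q powi (a - b))) (q powi (2 * a)) * qpoch_inf (q powi (2 * a)) (q powi (2 * a))"
proof -
  have H: "((\<lambda>n::int. (-1) powi n * (q powi (2 * a)) powi (n * (n - 1) div 2) * (-(q powi (a + b))) powi n) has_sum
       qpoch_inf (-(q powi (a + b))) (q powi (2 * a)) * qpoch_inf (q powi (2 * a) / (-(q powi (a + b)))) (q powi (2 * a)) *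
         qpoch_inf (q powi (2 * a)) (q powi (2 * a))) UNIV"
    using assms by (intro jacobi_triple_product norm_powi_less_1) auto
  have eq: "q powi (2 * a) / (-(q powi (a + b))) = -(q powi (a - b))"
  proof -
    have "q powi (2 * a - (a + b)) = q powi (2 * a) / q powi (a + b)"
      by (rule power_int_diff) (use assms(2) in auto)
    moreover have "2 * a - (a + b) = a - b" by simp
    ultimately show ?thesis by (metis divide_minus_right)
  qed
  show ?thesis
    by (rule has_sum_unique[OF has_sum_qsum[OF assms] H[unfolded theta_term_eq[OF assms(2)] eq]])
qed

text \<open>The index -1 - r is paired with r, or -r with r, according to the symmetry of the theta series.\<close>

lemma has_sum_int_fold:
  fixes f :: "int \<Rightarrow> complex"
  assumes "(f has_sum S) UNIV"
  shows "((\<lambda>r::nat. f (int r) + f (-1 - int r)) has_sum S) UNIV"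
    and "((\<lambda>r::nat. if r = 0 then f 0 else f (int r) + f (- int r)) has_sum S) UNIV"
proof -
  have un: "(UNIV :: int set) = range int \<union> range (\<lambda>r. -1 - int r)"
  proof -
    have "k \<in> range int \<union> range (\<lambda>r. -1 - int r)" for k :: int
    proof (cases "k \<ge> 0")
      case False
      hence "k = -1 - int (nat (-1 - k))" by simp
      thus ?thesis by blast
    qed (metis UnI1 nonneg_int_cases rangeI)
    thus ?thesis by auto
  qed
  have "f summable_on UNIV" using assms by (rule has_sum_imp_summable)
  hence "f summable_on range int" "f summable_on range (\<lambda>r. -1 - int r)"
    by (auto intro: summable_on_subset)
  note A = has_sum_infsum[OF this(1)] and B = has_sum_infsum[OF this(2)]
  define A B where "A = infsum f (range int)" and "B = infsum f (range (\<lambda>r. -1 - int r))"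
  note A = A[folded A_def] and B = B[folded B_def]
  have "(f has_sum (A + B)) UNIV" unfolding un by (intro has_sum_Un_disjoint A B) auto
  hence S: "S = A + B" using assms has_sum_unique by blast
  have A': "((\<lambda>r. f (int r)) has_sum A) UNIV"
    using A by (subst (asm) has_sum_reindex) (auto simp: o_def)
  have B': "((\<lambda>r. f (-1 - int r)) has_sum B) UNIV"
    using B by (subst (asm) has_sum_reindex) (auto simp: o_def inj_on_def)
  show "((\<lambda>r::nat. f (int r) + f (-1 - int r)) has_sum S) UNIV"
    unfolding S by (intro has_sum_add A' B')
  have "((\<lambda>r. (\<lambda>n. f (- int n)) (Suc r)) has_sum B) UNIV"
    using B' by (simp add: algebra_simps)
  hence "((\<lambda>n. f (- int n)) has_sum B) (range Suc)"
    by (subst has_sum_reindex) (auto simp: o_def)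
  also have "?this \<longleftrightarrow> ((\<lambda>n::nat. if n = 0 then 0 else f (- int n)) has_sum B) UNIV"
  proof (rule has_sum_cong_neutral)
    fix n :: nat assume "n \<in> UNIV - range Suc"
    hence "n = 0" by (metis DiffD2 not0_implies_Suc rangeI)
    thus "(if n = 0 then 0 else f (- int n)) = 0" by simp
  qed auto
  finally have "((\<lambda>r. f (int r) + (if r = 0 then 0 else f (- int r))) has_sum S) UNIV"
    unfolding S by (intro has_sum_add A')
  moreover have "(\<lambda>r. f (int r) + (if r = 0 then 0 else f (- int r))) =
    (\<lambda>r::nat. if r = 0 then f 0 else f (int r) + f (- int r))" by auto
  ultimately show "((\<lambda>r::nat. if r = 0 then f 0 else f (int r) + f (- int r)) has_sum S) UNIV"
    by simp
qed

lemma power_int_eq_power: "e = int n \<Longrightarrow> q powi e = q ^ n"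
  by simp

lemma qsum_fold_zero:
  assumes "norm q < 1" "q \<noteq> 0" "a > 0"
  shows "((\<lambda>r::nat. if r = 0 then 1 else 2 * q ^ (a * r\<^sup>2)) has_sum qsum (int a) 0 q) UNIV"
proof -
  have e: "q powi (int a * (int r)\<^sup>2 + 0 * int r) = q ^ (a * r\<^sup>2)" for r
    by (rule power_int_eq_power) simp
  have e': "q powi (int a * (- int r)\<^sup>2 + 0 * (- int r)) = q ^ (a * r\<^sup>2)" for r
    by (rule power_int_eq_power) simp
  have "int a > 0" using assms(3) by simp
  from has_sum_int_fold(2)[OF has_sum_qsum[OF assms(1,2) this, of 0], unfolded e e']
  show ?thesis
    by (rule has_sum_cong[THEN iffD1, rotated]) simp
qed

lemma qsum_fold:
  assumes "norm q < 1" "q \<noteq> 0" "a > 0" "b \<le> a"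
  shows "((\<lambda>r::nat. q ^ (a * r\<^sup>2 + b * r) + q ^ (a * r\<^sup>2 + (2 * a - b) * r + (a - b))) has_sum qsum (int a) (int b) q) UNIV"
proof -
  have e: "q powi (int a * (int r)\<^sup>2 + int b * int r) = q ^ (a * r\<^sup>2 + b * r)" for r
    by (rule power_int_eq_power) simp
  have e': "q powi (int a * (-1 - int r)\<^sup>2 + int b * (-1 - int r)) =
     q ^ (a * r\<^sup>2 + (2 * a - b) * r + (a - b))" for r
  proof (rule power_int_eq_power)
    obtain d where "a = b + d" using assms(4) le_Suc_ex by blast
    thus "int a * (-1 - int r)\<^sup>2 + int b * (-1 - int r) = int (a * r\<^sup>2 + (2 * a - b) * r + (a - b))"
      by (simp add: power2_eq_square algebra_simps)
  qed
  have "int a > 0" using assms(3) by simp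
  from has_sum_int_fold(1)[OF has_sum_qsum[OF assms(1,2) this, of "int b"], unfolded e e']
  show ?thesis .
qed

lemma qsum_fold_sym:
  assumes "norm q < 1" "q \<noteq> 0" "a > 0" "b \<le> a"
  shows "((\<lambda>r::nat. if r = 0 then 1 else q ^ (a * r\<^sup>2 - b * r) + q ^ (a * r\<^sup>2 + b * r)) has_sum qsum (int a) (int b) q) UNIV"
proof -
  have e: "q powi (int a * (int r)\<^sup>2 + int b * int r) = q ^ (a * r\<^sup>2 + b * r)" for r
    by (rule power_int_eq_power) simp
  have e': "q powi (int a * (- int r)\<^sup>2 + int b * (- int r)) = q ^ (a * r\<^sup>2 - b * r)" for r
  proof (rule power_int_eq_power)
    have "b * r \<le> a * r\<^sup>2" using assms(4) by (simp add: mult_le_mono power2_eq_square)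
    thus "int a * (- int r)\<^sup>2 + int b * (- int r) = int (a * r\<^sup>2 - b * r)" by (simp add: of_nat_diff)
  qed
  have "int a > 0" using assms(3) by simp
  from has_sum_int_fold(2)[OF has_sum_qsum[OF assms(1,2) this, of "int b"], unfolded e e']
  show ?thesis
    by (rule has_sum_cong[THEN iffD1, rotated]) (simp add: add.commute)
qed

section \<open>Identities of Rogers-Ramanujan type\<close>

lemma one_plus_power_nonzero:
  fixes q :: complex
  assumes "norm q < 1"
  shows "1 + q * q ^ n \<noteq> 0"
proof
  assume "1 + q * q ^ n = 0"
  hence "- q * q ^ n = 1" by (simp add: add_eq_0_iff2)
  thus False using mult_power_neq_1[of q "-q" n] assms norm_less_1_neq_1[of "-q"] by auto
qed

lemma one_minus_power_nonzero:
  fixes q :: complex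
  assumes "norm q < 1"
  shows "1 - q * q ^ n \<noteq> 0"
  using self_mult_power_neq_1[OF assms, of n] by simp

lemma bailey_alpha_one:
  assumes "norm q < 1"
  shows "bailey_alpha 1 c q r = (if r = 0 then 1 else
      (\<Prod>i<r. (c - q ^ Suc i) / (1 - c * q ^ i)) * q ^ (2 * (r choose 2)) * (1 + q ^ r))"
proof (cases r)
  case (Suc n)
  have nz: "qpoch q q n \<noteq> 0" "1 - q * q ^ n \<noteq> 0"
    using assms one_minus_power_nonzero[OF assms] by auto
  have "1 - q ^ (2 * r) = (1 - q * q ^ n) * (1 + q ^ r)"
    by (simp add: Suc algebra_simps power_add mult_2 power2_eq_square power_mult)
  thus ?thesis using nz by (simp add: bailey_alpha_def Suc qpoch_Suc)
qed (simp add: bailey_alpha_def)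

lemma bailey_alpha_self:
  assumes "norm q < 1"
  shows "bailey_alpha q c q r =
      (\<Prod>i<r. (c - q * q ^ Suc i) / (1 - c * q ^ i)) * q ^ (2 * (r choose 2)) * ((1 - q * q ^ (2 * r)) / (1 - q))"
proof (cases r)
  case (Suc n)
  have "qpoch q q r = (1 - q) * qpoch (q * q) q n"
    unfolding Suc by (rule qpoch_Suc_left)
  moreover from this have "qpoch (q * q) q n \<noteq> 0"
    using assms by (metis mult_zero_right qpoch_self_nonzero)
  ultimately show ?thesis using assms by (simp add: bailey_alpha_def Suc)
qed (use assms in \<open>auto simp: bailey_alpha_def\<close>)

text \<open>Used to evaluate the telescoping products inside the Bailey coefficients.\<close>

lemma prod_eq_ratio:
  fixes f :: "nat \<Rightarrow> complex"
  assumes "g 0 = 1" "\<And>n. g (Suc n) = g n * f n"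
  shows "(\<Prod>i<n. f i) = g n"
  by (induction n) (simp_all add: assms)

lemma qpoch_mult_neg_self: "qpoch q q n * qpoch (-q) q n = qpoch (q\<^sup>2) (q\<^sup>2) n"
  by (rule qpoch_neg_mult)

lemma power_square_Suc: "t ^ (Suc n)\<^sup>2 = t ^ n\<^sup>2 * (t * (t ^ n * t ^ n))" for t :: complex
proof -
  have "(Suc n)\<^sup>2 = n\<^sup>2 + Suc (n + n)" by (simp add: power2_eq_square)
  thus ?thesis by (simp only: power_add power_Suc)
qed

lemma power_double: "t ^ (2 * n) = t ^ n * t ^ n" "(t\<^sup>2) ^ n = t ^ n * t ^ n" for t :: complex
  by (simp_all add: mult_2 power_add power2_eq_square power_mult_distrib)

lemma wprod_half: "wprod (t\<^sup>2) (-t) (t\<^sup>2) n = t ^ n\<^sup>2 * qpoch (-t) (t\<^sup>2) n"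
proof (induction n)
  case (Suc n)
  have 2: "(t\<^sup>2 * (t\<^sup>2) ^ n - - t) * (t\<^sup>2) ^ n = t * (t ^ n * t ^ n) * (1 - (-t) * (t\<^sup>2) ^ n)"
    unfolding power_double by (simp add: power2_eq_square algebra_simps)
  show ?case unfolding wprod_Suc qpoch_Suc Suc.IH power_square_Suc 2 by (simp only: mult_ac)
qed auto

lemma wprod_neg: "wprod q (-q) q n = q ^ ((n choose 2) + n) * qpoch (-1) q n"
  by (induction n) (simp_all add: wprod_Suc qpoch_Suc Suc_choose_two power_add algebra_simps)

lemma wprod_shift_half: "wprod (t\<^sup>2 * t\<^sup>2) (-(t ^ 3)) (t\<^sup>2) n = t ^ (n\<^sup>2 + 2 * n) * qpoch (-t) (t\<^sup>2) n"
proof (induction n)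
  case (Suc n)
  have "(Suc n)\<^sup>2 + 2 * Suc n = (n\<^sup>2 + 2 * n) + (3 + (n + n))" by (simp add: power2_eq_square)
  hence 1: "t ^ ((Suc n)\<^sup>2 + 2 * Suc n) = t ^ (n\<^sup>2 + 2 * n) * (t ^ 3 * (t ^ n * t ^ n))"
    by (simp only: power_add)
  have 2: "(t\<^sup>2 * t\<^sup>2 * (t\<^sup>2) ^ n - - (t ^ 3)) * (t\<^sup>2) ^ n = t ^ 3 * (t ^ n * t ^ n) * (1 - (-t) * (t\<^sup>2) ^ n)"
    unfolding power_double by (simp add: algebra_simps eval_nat_numeral)
  show ?case unfolding wprod_Suc qpoch_Suc Suc.IH 1 2 by (simp only: mult_ac)
qed auto

lemma wprod_shift_neg: "wprod (q * q) (-q) q n = q ^ ((n choose 2) + n) * qpoch (-q) q n"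
  by (induction n) (simp_all add: wprod_Suc qpoch_Suc Suc_choose_two power_add algebra_simps)

lemma neg_power_neq_1:
  fixes q s :: complex
  assumes "norm q < 1" "norm s < 1"
  shows "- s * q ^ k \<noteq> 1"
  using mult_power_neq_1[of q "-s" k] assms norm_less_1_neq_1[of "-s"] by auto

lemma pos_power_neq_1:
  fixes q s :: complex
  assumes "norm q < 1" "norm s < 1"
  shows "s * q ^ k \<noteq> 1"
  using mult_power_neq_1[of q s k] assms norm_less_1_neq_1[of s] by auto

text \<open>For a = 1 the coefficient with index r combines the terms r and -r of a bilateral theta series.\<close>

lemma has_sum_bailey_one:
  assumes q: "norm q < 1" and c: "norm c < 1" and y: "norm y < 1"
  assumes "((\<lambda>r. if r = 0 then 1 else wprod q y q r / qpoch y q r *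
     ((\<Prod>i<r. (c - q ^ Suc i) / (1 - c * q ^ i)) * q ^ (2 * (r choose 2)) * (1 + q ^ r))) has_sum S) UNIV"
  shows "((\<lambda>n. wprod q y q n / (qpoch q q n * qpoch c q n)) has_sum (qpoch_inf y q / qpoch_inf q q * S)) UNIV"
proof -
  have "((\<lambda>r. wprod (1 * q) y q r / qpoch y q r * bailey_alpha 1 c q r) has_sum S) UNIV"
    by (rule has_sum_cong[THEN iffD1, rotated], rule assms(4)) (simp add: bailey_alpha_one[OF q])
  from has_sum_bailey[OF q _ _ _ this] show ?thesis
    using self_mult_power_neq_1[OF q] pos_power_neq_1[OF q c] pos_power_neq_1[OF q y] by simp
qed

text \<open>For a = q the coefficient with index r combines the terms r and -1 - r of a bilateral theta series.\<close>

lemma has_sum_bailey_self: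
  assumes q: "norm q < 1" and c: "norm c < 1" and y: "norm y < 1"
  assumes "((\<lambda>r. wprod (q * q) y q r / qpoch y q r *
     ((\<Prod>i<r. (c - q * q ^ Suc i) / (1 - c * q ^ i)) * q ^ (2 * (r choose 2)) *
       ((1 - q * q ^ (2 * r)) / (1 - q)))) has_sum S) UNIV"
  shows "((\<lambda>n. wprod (q * q) y q n / (qpoch q q n * qpoch c q n)) has_sum
            (qpoch_inf y q / qpoch_inf (q * q) q * S)) UNIV"
proof -
  have "((\<lambda>r. wprod (q * q) y q r / qpoch y q r * bailey_alpha q c q r) has_sum S) UNIV"
    by (rule has_sum_cong[THEN iffD1, rotated], rule assms(4)) (simp add: bailey_alpha_self[OF q])
  from has_sum_bailey[OF q _ _ _ this] show ?thesis
    using self_mult_power_neq_1[OF q, of "Suc _"] pos_power_neq_1[OF q c] pos_power_neq_1[OF q y] by simp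
qed

lemma prod_alpha_neg:
  fixes q :: complex
  assumes "norm q < 1"
  shows "(\<Prod>i<r. (- q - q ^ Suc i) / (1 - (-q) * q ^ i)) = (-q) ^ r * (2 / (1 + q ^ r))"
proof (rule prod_eq_ratio)
  fix n
  have nz: "1 + q * q ^ n \<noteq> 0" "1 + q ^ n \<noteq> 0"
    using one_plus_power_nonzero[OF assms, of n] one_plus_power_nonzero[OF assms, of "n - 1"]
    by (auto simp: power_eq_if split: if_splits)
  thus "(- q) ^ Suc n * (2 / (1 + q ^ Suc n)) =
         (- q) ^ n * (2 / (1 + q ^ n)) * ((- q - q ^ Suc n) / (1 - - q * q ^ n))"
    by (simp add: divide_simps) (simp add: algebra_simps)
qed auto

lemma minus_one_power_three_square: "(-1) ^ (3 * r\<^sup>2) = ((-1) ^ r :: complex)"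
  by (cases "even r") auto

text \<open>Number 25 of Slater's list: the case a = 1, c = -x^2, y = -x of the Bailey transformation with base x^2.\<close>

lemma has_sum_slater25:
  fixes x :: complex
  assumes x: "norm x < 1" "x \<noteq> 0"
  shows "((\<lambda>k. x ^ k\<^sup>2 * qpoch (-x) (x\<^sup>2) k / qpoch (x ^ 4) (x ^ 4) k) has_sum
           qpoch_inf (-x) (x\<^sup>2) / qpoch_inf (x\<^sup>2) (x\<^sup>2) * qsum 3 0 (-x)) UNIV"
proof -
  define q where "q = x\<^sup>2"
  have q: "norm q < 1" using x by (simp add: q_def norm_power_less_1)
  have nz: "1 + q ^ r \<noteq> 0" for r
    using one_plus_power_nonzero[OF q, of "r - 1"] by (cases r) auto
  have "((\<lambda>r::nat. if r = 0 then 1 else 2 * (-x) ^ (3 * r\<^sup>2)) has_sum qsum 3 0 (-x)) UNIV"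
    using qsum_fold_zero[of "-x" 3] x by simp
  hence "((\<lambda>r. if r = 0 then 1 else wprod q (-x) q r / qpoch (-x) q r *
     ((\<Prod>i<r. (- q - q ^ Suc i) / (1 - (-q) * q ^ i)) * q ^ (2 * (r choose 2)) * (1 + q ^ r))) has_sum qsum 3 0 (-x)) UNIV"
  proof (rule has_sum_cong[THEN iffD1, rotated])
    fix r
    have h: "x ^ (2 * r\<^sup>2) = q ^ (2 * (r choose 2)) * q ^ r"
      by (simp add: power_add[symmetric] q_def power_mult[symmetric] square_nat_choose_two add_ac)
    have h': "x ^ (3 * r\<^sup>2) = x ^ r\<^sup>2 * x ^ (2 * r\<^sup>2)"
      by (simp add: power_add[symmetric])
    have "2 * (-x) ^ (3 * r\<^sup>2) = x ^ r\<^sup>2 * ((-q) ^ r * 2 * q ^ (2 * (r choose 2)))"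
      unfolding power_minus[of x "3 * r\<^sup>2"] power_minus[of q] minus_one_power_three_square h' h
      by (simp only: mult_ac)
    moreover have "wprod q (-x) q r / qpoch (-x) q r = x ^ r\<^sup>2"
      using q x by (simp add: wprod_half q_def)
    ultimately show "(if r = 0 then 1 else 2 * (-x) ^ (3 * r\<^sup>2)) = (if r = 0 then 1 else wprod q (-x) q r / qpoch (-x) q r *
     ((\<Prod>i<r. (- q - q ^ Suc i) / (1 - (-q) * q ^ i)) * q ^ (2 * (r choose 2)) * (1 + q ^ r)))"
      unfolding prod_alpha_neg[OF q] using nz[of r] by simp
  qed
  from has_sum_bailey_one[OF q _ _ this]
  have "((\<lambda>n. wprod q (-x) q n / (qpoch q q n * qpoch (-q) q n)) has_sum
        (qpoch_inf (-x) q / qpoch_inf q q * qsum 3 0 (-x))) UNIV"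
    using q x by simp
  moreover have "wprod q (-x) q n / (qpoch q q n * qpoch (-q) q n) =
        x ^ n\<^sup>2 * qpoch (-x) (x\<^sup>2) n / qpoch (x ^ 4) (x ^ 4) n" for n
    unfolding qpoch_mult_neg_self by (simp add: q_def wprod_half power_mult[symmetric])
  ultimately show ?thesis by (simp add: q_def)
qed

text \<open>The q-Gauss sum with base x^2, c = -x^2 and y = -x. It is what number 25 of Slater's list turns into when the sign of x is changed in the shifted factorial only.\<close>

lemma has_sum_gauss_square:
  fixes x :: complex
  assumes x: "norm x < 1"
  shows "((\<lambda>k. x ^ k\<^sup>2 * qpoch x (x\<^sup>2) k / qpoch (x ^ 4) (x ^ 4) k) has_sum
           qpoch_inf (-x) (x\<^sup>2) / qpoch_inf (-(x\<^sup>2)) (x\<^sup>2)) UNIV"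
proof -
  define q where "q = x\<^sup>2"
  have q: "norm q < 1" using x by (simp add: q_def norm_power_less_1)
  have "((\<lambda>n. wprod (-q) (-x) q n / (qpoch q q n * qpoch (-q) q n)) has_sum (qpoch_inf (-x) q / qpoch_inf (-q) q)) UNIV"
    by (rule has_sum_gauss[OF q neg_power_neq_1[OF q q]])
  moreover have "wprod (-q) (-x) q n = x ^ n\<^sup>2 * qpoch x q n" for n
    by (induction n)
       (simp_all add: q_def wprod_Suc qpoch_Suc power_square_Suc power_double power2_eq_square[of x] algebra_simps)
  ultimately show ?thesis
    unfolding qpoch_mult_neg_self by (simp add: q_def power_mult[symmetric])
qed

lemma prod_alpha_half:
  fixes t :: complex
  assumes "norm t < 1"
  shows "(\<Prod>i<r. (t - (t\<^sup>2) ^ Suc i) / (1 - t * (t\<^sup>2) ^ i)) = t ^ r"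
proof (rule prod_eq_ratio)
  fix n
  have "1 - t * (t\<^sup>2) ^ n \<noteq> 0"
    using pos_power_neq_1[of "t\<^sup>2" t n] assms norm_power_less_1[of t 2] by simp
  moreover have "t - (t\<^sup>2) ^ Suc n = t * (1 - t * (t\<^sup>2) ^ n)"
    by (simp add: algebra_simps power2_eq_square)
  ultimately show "t ^ Suc n = t ^ n * ((t - (t\<^sup>2) ^ Suc n) / (1 - t * (t\<^sup>2) ^ n))" by simp
qed auto

text \<open>Number 29 of Slater's list: a = 1, c = t, y = -t in base t^2. The choice c = t merges the denominator into (t; t)_{2k}.\<close>

lemma has_sum_slater29:
  fixes t :: complex
  assumes t: "norm t < 1" "t \<noteq> 0"
  shows "((\<lambda>k. t ^ k\<^sup>2 * qpoch (-t) (t\<^sup>2) k / qpoch t t (2 * k)) has_sum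
           qpoch_inf (-t) (t\<^sup>2) / qpoch_inf (t\<^sup>2) (t\<^sup>2) * qsum 3 1 t) UNIV"
proof -
  define q where "q = t\<^sup>2"
  have q: "norm q < 1" using t by (simp add: q_def norm_power_less_1)
  have "((\<lambda>r::nat. if r = 0 then 1 else t ^ (3 * r\<^sup>2 - 1 * r) + t ^ (3 * r\<^sup>2 + 1 * r)) has_sum qsum 3 1 t) UNIV"
    using qsum_fold_sym[of t 3 1] t by simp
  hence "((\<lambda>r. if r = 0 then 1 else wprod q (-t) q r / qpoch (-t) q r *
     ((\<Prod>i<r. (t - q ^ Suc i) / (1 - t * q ^ i)) * q ^ (2 * (r choose 2)) * (1 + q ^ r))) has_sum qsum 3 1 t) UNIV"
  proof (rule has_sum_cong[THEN iffD1, rotated])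
    fix r
    have e: "3 * r\<^sup>2 - 1 * r = r\<^sup>2 + (r + 2 * (2 * (r choose 2)))" "3 * r\<^sup>2 + 1 * r = r\<^sup>2 + (r + 2 * (2 * (r choose 2))) + 2 * r"
      by (simp_all add: square_nat_choose_two)
    have w: "wprod q (-t) q r / qpoch (-t) q r = t ^ r\<^sup>2"
      using q t by (simp add: wprod_half q_def)
    have t4: "t ^ (2 * (2 * (r choose 2))) = q ^ (2 * (r choose 2))" "t ^ (2 * r) = q ^ r"
      by (simp_all add: q_def power_mult[symmetric])
    have "t ^ (3 * r\<^sup>2 - 1 * r) + t ^ (3 * r\<^sup>2 + 1 * r) = t ^ r\<^sup>2 * (t ^ r * q ^ (2 * (r choose 2)) * (1 + q ^ r))"
      unfolding e power_add t4 by (simp add: algebra_simps)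
    thus "(if r = 0 then 1 else t ^ (3 * r\<^sup>2 - 1 * r) + t ^ (3 * r\<^sup>2 + 1 * r)) = (if r = 0 then 1 else wprod q (-t) q r / qpoch (-t) q r *
     ((\<Prod>i<r. (t - q ^ Suc i) / (1 - t * q ^ i)) * q ^ (2 * (r choose 2)) * (1 + q ^ r)))"
      unfolding w unfolding q_def prod_alpha_half[OF t(1)] by simp
  qed
  from has_sum_bailey_one[OF q _ _ this]
  have "((\<lambda>n. wprod q (-t) q n / (qpoch q q n * qpoch t q n)) has_sum
        (qpoch_inf (-t) q / qpoch_inf q q * qsum 3 1 t)) UNIV"
    using q t by simp
  moreover have "wprod q (-t) q n / (qpoch q q n * qpoch t q n) =
        t ^ n\<^sup>2 * qpoch (-t) (t\<^sup>2) n / qpoch t t (2 * n)" for n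
    unfolding qpoch_double by (simp add: q_def wprod_half mult.commute)
  ultimately show ?thesis by (simp add: q_def)
qed

text \<open>Number 48 of Slater's list: a = 1, c = t, y = -t^2 in base t^2.\<close>

lemma has_sum_slater48:
  fixes t :: complex
  assumes t: "norm t < 1" "t \<noteq> 0"
  shows "((\<lambda>k. t ^ (k\<^sup>2 + k) * qpoch (-1) (t\<^sup>2) k / qpoch t t (2 * k)) has_sum
           qpoch_inf (-(t\<^sup>2)) (t\<^sup>2) / qpoch_inf (t\<^sup>2) (t\<^sup>2) * qsum 3 0 t) UNIV"
proof -
  define q where "q = t\<^sup>2"
  have q: "norm q < 1" using t by (simp add: q_def norm_power_less_1)
  have nz: "1 + q ^ r \<noteq> 0" for r
    using one_plus_power_nonzero[OF q, of "r - 1"] by (cases r) auto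
  have qp: "qpoch (-1) q r = qpoch (-q) q r * (2 / (1 + q ^ r))" for r
  proof (induction r)
    case (Suc r)
    thus ?case using nz[of r] nz[of "Suc r"] by (simp add: qpoch_Suc)
  qed simp
  have "((\<lambda>r::nat. if r = 0 then 1 else 2 * t ^ (3 * r\<^sup>2)) has_sum qsum 3 0 t) UNIV"
    using qsum_fold_zero[of t 3] t by simp
  hence "((\<lambda>r. if r = 0 then 1 else wprod q (-q) q r / qpoch (-q) q r *
     ((\<Prod>i<r. (t - q ^ Suc i) / (1 - t * q ^ i)) * q ^ (2 * (r choose 2)) * (1 + q ^ r))) has_sum qsum 3 0 t) UNIV"
  proof (rule has_sum_cong[THEN iffD1, rotated])
    fix r
    have e: "3 * r\<^sup>2 = 2 * ((r choose 2) + r) + (r + 2 * (2 * (r choose 2)))"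
      by (simp_all add: square_nat_choose_two)
    have "wprod q (-q) q r / qpoch (-q) q r * (1 + q ^ r) = 2 * q ^ ((r choose 2) + r)"
      using q nz[of r] by (simp add: wprod_neg qp)
    note * = this
    have "wprod q (-q) q r / qpoch (-q) q r * (t ^ r * q ^ (2 * (r choose 2)) * (1 + q ^ r)) =
       (wprod q (-q) q r / qpoch (-q) q r * (1 + q ^ r)) * (t ^ r * q ^ (2 * (r choose 2)))"
      by (simp only: mult_ac)
    also have "\<dots> = 2 * q ^ ((r choose 2) + r) * (t ^ r * q ^ (2 * (r choose 2)))"
      by (simp only: *)
    also have "\<dots> = 2 * t ^ (3 * r\<^sup>2)"
      unfolding e q_def by (simp only: power_add power_mult mult_ac)
    finally have "2 * t ^ (3 * r\<^sup>2) = wprod q (-q) q r / qpoch (-q) q r * (t ^ r * q ^ (2 * (r choose 2)) * (1 + q ^ r))" ..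
    thus "(if r = 0 then 1 else 2 * t ^ (3 * r\<^sup>2)) = (if r = 0 then 1 else wprod q (-q) q r / qpoch (-q) q r *
     ((\<Prod>i<r. (t - q ^ Suc i) / (1 - t * q ^ i)) * q ^ (2 * (r choose 2)) * (1 + q ^ r)))"
      unfolding q_def prod_alpha_half[OF t(1)] by simp
  qed
  from has_sum_bailey_one[OF q _ _ this]
  have "((\<lambda>n. wprod q (-q) q n / (qpoch q q n * qpoch t q n)) has_sum
        (qpoch_inf (-q) q / qpoch_inf q q * qsum 3 0 t)) UNIV"
    using q t by simp
  moreover have "wprod q (-q) q n / (qpoch q q n * qpoch t q n) =
        t ^ (n\<^sup>2 + n) * qpoch (-1) (t\<^sup>2) n / qpoch t t (2 * n)" for n
    unfolding qpoch_double wprod_neg square_nat_choose_two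
    by (simp add: q_def mult.commute power_mult[symmetric] power_add[symmetric] algebra_simps)
  ultimately show ?thesis by (simp add: q_def)
qed

lemma prod_alpha_self_neg:
  fixes q :: complex
  assumes "norm q < 1"
  shows "(\<Prod>i<r. (- q - q * q ^ Suc i) / (1 - (-q) * q ^ i)) = (-q) ^ r"
proof (rule prod_eq_ratio)
  fix n
  have "1 + q * q ^ n \<noteq> 0" by (rule one_plus_power_nonzero[OF assms])
  moreover have "- q - q * q ^ Suc n = - q * (1 + q * q ^ n)" by (simp add: algebra_simps)
  ultimately show "(- q) ^ Suc n = (- q) ^ n * ((- q - q * q ^ Suc n) / (1 - - q * q ^ n))" by simp
qed auto

lemma prod_alpha_self_half:
  fixes t :: complex
  assumes "norm t < 1"
  shows "(\<Prod>i<r. (t ^ 3 - t\<^sup>2 * (t\<^sup>2) ^ Suc i) / (1 - t ^ 3 * (t\<^sup>2) ^ i)) = t ^ (3 * r) * ((1 - t) / (1 - t * (t\<^sup>2) ^ r))"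
proof (rule prod_eq_ratio)
  have nz: "1 - t * (t\<^sup>2) ^ n \<noteq> 0" for n
    using pos_power_neq_1[of "t\<^sup>2" t n] assms norm_power_less_1[of t 2] by simp
  show "t ^ (3 * 0) * ((1 - t) / (1 - t * (t\<^sup>2) ^ 0)) = 1" using nz[of 0] by simp
  fix n
  have e: "1 - t * (t\<^sup>2) ^ Suc n = 1 - t ^ 3 * (t\<^sup>2) ^ n" "t ^ 3 - t\<^sup>2 * (t\<^sup>2) ^ Suc n = t ^ 3 * (1 - t * (t\<^sup>2) ^ n)"
    by (simp_all add: algebra_simps eval_nat_numeral)
  show "t ^ (3 * Suc n) * ((1 - t) / (1 - t * (t\<^sup>2) ^ Suc n)) = t ^ (3 * n) * ((1 - t) / (1 - t * (t\<^sup>2) ^ n)) *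
       ((t ^ 3 - t\<^sup>2 * (t\<^sup>2) ^ Suc n) / (1 - t ^ 3 * (t\<^sup>2) ^ n))"
    unfolding e using nz[of n] by (simp add: power_add)
qed

lemma qpoch_ratio_half:
  fixes t :: complex
  assumes "norm t < 1"
  shows "qpoch (-t) (t\<^sup>2) r / qpoch (-(t ^ 3)) (t\<^sup>2) r = (1 + t) / (1 + t * (t\<^sup>2) ^ r)"
proof -
  have nz: "1 + t * (t\<^sup>2) ^ n \<noteq> 0" for n
    using neg_power_neq_1[of "t\<^sup>2" t n] assms norm_power_less_1[of t 2] by (auto simp: add_eq_0_iff2)
  have "norm (-(t ^ 3)) < 1" using assms norm_power_less_1[of t 3] by simp
  hence "qpoch (-(t ^ 3)) (t\<^sup>2) r \<noteq> 0" using assms norm_power_less_1[of t 2] by (intro qpoch_nonzero_less) auto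
  moreover have "qpoch (-t) (t\<^sup>2) r * (1 + t * (t\<^sup>2) ^ r) = (1 + t) * qpoch (-(t ^ 3)) (t\<^sup>2) r"
    using qpoch_Suc[of "-t" "t\<^sup>2" r] qpoch_Suc_left[of "-t" "t\<^sup>2" r]
    by (simp add: eval_nat_numeral mult_ac)
  ultimately show ?thesis using nz[of r] by (simp add: frac_eq_eq)
qed

text \<open>The partner of number 25 of Slater's list for a = q: base x^2, c = -x^2 and y = -x^3. The factor 1/(1 - x) that appears with the
theta series is absorbed when the shifted infinite products are moved back by one step.\<close>

lemma has_sum_slater25_companion:
  fixes x :: complex
  assumes x: "norm x < 1" "x \<noteq> 0"
  shows "((\<lambda>k. x ^ (k\<^sup>2 + 2 * k) * qpoch (-x) (x\<^sup>2) k / qpoch (x ^ 4) (x ^ 4) k) has_sum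
           qpoch_inf (-x) (x\<^sup>2) / qpoch_inf (x\<^sup>2) (x\<^sup>2) * qsum 3 2 (-x)) UNIV"
proof -
  define q where "q = x\<^sup>2"
  have q: "norm q < 1" using x by (simp add: q_def norm_power_less_1)
  have nz: "1 + x * q ^ r \<noteq> 0" for r
    using neg_power_neq_1[of q x r] q x by (auto simp: add_eq_0_iff2)
  have x1: "1 - x \<noteq> 0" "1 + x \<noteq> 0" using nz[of 0] x by auto
  have q1: "1 - q = (1 - x) * (1 + x)" by (simp add: q_def algebra_simps power2_eq_square)
  have x3: "norm (x ^ 3) < 1" using x by (simp add: norm_power_less_1)
  have "((\<lambda>r::nat. (-x) ^ (3 * r\<^sup>2 + 2 * r) + (-x) ^ (3 * r\<^sup>2 + (2 * 3 - 2) * r + (3 - 2))) has_sum qsum 3 2 (-x)) UNIV"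
    using qsum_fold[of "-x" 3 2] x by simp
  from has_sum_cmult_right[OF this, of "1 / (1 - x)"]
  have "((\<lambda>r. wprod (q * q) (-(x ^ 3)) q r / qpoch (-(x ^ 3)) q r *
     ((\<Prod>i<r. (- q - q * q ^ Suc i) / (1 - (-q) * q ^ i)) * q ^ (2 * (r choose 2)) *
       ((1 - q * q ^ (2 * r)) / (1 - q)))) has_sum (1 / (1 - x) * qsum 3 2 (-x))) UNIV"
  proof (rule has_sum_cong[THEN iffD1, rotated])
    fix r
    have w: "wprod (q * q) (-(x ^ 3)) q r / qpoch (-(x ^ 3)) q r = x ^ (r\<^sup>2 + 2 * r) * ((1 + x) / (1 + x * q ^ r))"
      using qpoch_ratio_half[OF x(1), of r] unfolding q_def wprod_shift_half times_divide_eq_right[symmetric] by simp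
    have e1: "(-x) ^ (3 * r\<^sup>2 + 2 * r) = (-1) ^ r * x ^ (3 * r\<^sup>2 + 2 * r)"
      unfolding power_add power_minus[of x "3 * r\<^sup>2"] minus_one_power_three_square by simp
    have e2: "3 * r\<^sup>2 + (2 * 3 - 2) * r + (3 - 2) = (3 * r\<^sup>2 + 2 * r) + (2 * r + 1)" by simp
    have e3: "(-x) ^ (2 * r + 1) = - (x * q ^ r)" by (simp add: q_def power_mult)
    have e4: "(1 - q * q ^ (2 * r)) = (1 - x * q ^ r) * (1 + x * q ^ r)"
      by (simp add: q_def algebra_simps power2_eq_square power_mult_distrib power_mult)
    have e5: "x ^ (r\<^sup>2 + 2 * r) * ((-q) ^ r * q ^ (2 * (r choose 2))) = (-1) ^ r * x ^ (3 * r\<^sup>2 + 2 * r)"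
    proof -
      have "q ^ r * q ^ (2 * (r choose 2)) = x ^ (2 * r\<^sup>2)"
        by (simp add: power_add[symmetric] q_def power_mult[symmetric] square_nat_choose_two add_ac)
      moreover have "x ^ (3 * r\<^sup>2 + 2 * r) = x ^ (r\<^sup>2 + 2 * r) * x ^ (2 * r\<^sup>2)"
        by (simp add: power_add[symmetric])
      ultimately show ?thesis by (simp add: power_minus[of q] mult_ac)
    qed
    have "1 / (1 - x) * ((-x) ^ (3 * r\<^sup>2 + 2 * r) + (-x) ^ (3 * r\<^sup>2 + (2 * 3 - 2) * r + (3 - 2))) =
      (x ^ (r\<^sup>2 + 2 * r) * ((-q) ^ r * q ^ (2 * (r choose 2)))) * ((1 - x * q ^ r) / (1 - x))"
      unfolding e2 power_add[of "-x" "3 * r\<^sup>2 + 2 * r"] e3 e1 e5 by (simp add: algebra_simps diff_divide_distrib)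
    also have "\<dots> = wprod (q * q) (-(x ^ 3)) q r / qpoch (-(x ^ 3)) q r *
     ((-q) ^ r * q ^ (2 * (r choose 2)) * ((1 - q * q ^ (2 * r)) / (1 - q)))"
      unfolding w e4 q1 using nz[of r] x1 by simp
    finally show "1 / (1 - x) * ((-x) ^ (3 * r\<^sup>2 + 2 * r) + (-x) ^ (3 * r\<^sup>2 + (2 * 3 - 2) * r + (3 - 2))) =
      wprod (q * q) (-(x ^ 3)) q r / qpoch (-(x ^ 3)) q r *
     ((\<Prod>i<r. (- q - q * q ^ Suc i) / (1 - (-q) * q ^ i)) * q ^ (2 * (r choose 2)) *
       ((1 - q * q ^ (2 * r)) / (1 - q)))"
      unfolding prod_alpha_self_neg[OF q] .
  qed
  from has_sum_bailey_self[OF q _ _ this]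
  have "((\<lambda>n. wprod (q * q) (-(x ^ 3)) q n / (qpoch q q n * qpoch (-q) q n)) has_sum
        (qpoch_inf (-(x ^ 3)) q / qpoch_inf (q * q) q * (1 / (1 - x) * qsum 3 2 (-x)))) UNIV"
    using q x3 by simp
  moreover have "wprod (q * q) (-(x ^ 3)) q n / (qpoch q q n * qpoch (-q) q n) =
        x ^ (n\<^sup>2 + 2 * n) * qpoch (-x) (x\<^sup>2) n / qpoch (x ^ 4) (x ^ 4) n" for n
    unfolding qpoch_mult_neg_self q_def wprod_shift_half by (simp add: power_mult[symmetric])
  moreover have "qpoch_inf (-(x ^ 3)) q / qpoch_inf (q * q) q * (1 / (1 - x)) = qpoch_inf (-x) q / qpoch_inf q q"
  proof -
    have "qpoch_inf (-x) q = (1 + x) * qpoch_inf (-(x ^ 3)) q" "qpoch_inf q q = (1 - q) * qpoch_inf (q * q) q"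
      using qpoch_inf_Suc[OF q, of "-x"] qpoch_inf_Suc[OF q, of q]
      by (simp_all add: q_def eval_nat_numeral mult_ac)
    thus ?thesis unfolding q1 using x1 by simp
  qed
  ultimately show ?thesis by (simp only: mult.assoc[symmetric] q_def)
qed

lemma qpoch_double_Suc_split:
  fixes t :: complex
  assumes "norm t < 1"
  shows "qpoch (t\<^sup>2) (t\<^sup>2) n * qpoch (t ^ 3) (t\<^sup>2) n * (1 - t) = qpoch t t (2 * n + 1)"
  unfolding qpoch_double_Suc qpoch_Suc_left[of t] by (simp add: eval_nat_numeral mult_ac)

text \<open>Number 28 of Slater's list: a = t^2, c = t^3, y = -t^2 in base t^2. With c = t^3 the denominator is (t; t)_{2k+1} up to the factor 1 - t.\<close>

lemma has_sum_slater28: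
  fixes t :: complex
  assumes t: "norm t < 1" "t \<noteq> 0"
  shows "((\<lambda>k. t ^ (k\<^sup>2 + k) * qpoch (-(t\<^sup>2)) (t\<^sup>2) k / qpoch t t (2 * k + 1)) has_sum
           qpoch_inf (-(t\<^sup>2)) (t\<^sup>2) / qpoch_inf (t\<^sup>2) (t\<^sup>2) * qsum 3 2 t) UNIV"
proof -
  define q where "q = t\<^sup>2"
  have q: "norm q < 1" using t by (simp add: q_def norm_power_less_1)
  have t3: "norm (t ^ 3) < 1" using t by (simp add: norm_power_less_1)
  have nz: "1 + t * q ^ r \<noteq> 0" "1 - t * q ^ r \<noteq> 0" for r
    using neg_power_neq_1[of q t r] pos_power_neq_1[of q t r] q t by (auto simp: add_eq_0_iff2)
  have t1: "1 - t \<noteq> 0" "1 + t \<noteq> 0" using nz[of 0] by auto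
  have q1: "1 - q = (1 - t) * (1 + t)" by (simp add: q_def algebra_simps power2_eq_square)
  have "((\<lambda>r::nat. t ^ (3 * r\<^sup>2 + 2 * r) + t ^ (3 * r\<^sup>2 + (2 * 3 - 2) * r + (3 - 2))) has_sum qsum 3 2 t) UNIV"
    using qsum_fold[of t 3 2] t by simp
  from has_sum_cmult_right[OF this, of "1 / (1 + t)"]
  have "((\<lambda>r. wprod (q * q) (-q) q r / qpoch (-q) q r *
     ((\<Prod>i<r. (t ^ 3 - q * q ^ Suc i) / (1 - t ^ 3 * q ^ i)) * q ^ (2 * (r choose 2)) *
       ((1 - q * q ^ (2 * r)) / (1 - q)))) has_sum (1 / (1 + t) * qsum 3 2 t)) UNIV"
  proof (rule has_sum_cong[THEN iffD1, rotated])
    fix r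
    have w: "wprod (q * q) (-q) q r / qpoch (-q) q r = q ^ ((r choose 2) + r)"
      using q by (simp add: wprod_shift_neg)
    have e2: "3 * r\<^sup>2 + (2 * 3 - 2) * r + (3 - 2) = (3 * r\<^sup>2 + 2 * r) + (2 * r + 1)" by simp
    have e3: "t ^ (2 * r + 1) = t * q ^ r" by (simp add: q_def power_mult)
    have e4: "(1 - q * q ^ (2 * r)) = (1 - t * q ^ r) * (1 + t * q ^ r)"
      by (simp add: q_def algebra_simps power2_eq_square power_mult_distrib power_mult)
    have e5: "q ^ ((r choose 2) + r) * (t ^ (3 * r) * q ^ (2 * (r choose 2))) = t ^ (3 * r\<^sup>2 + 2 * r)"
      by (simp add: q_def power_mult[symmetric] power_add[symmetric] square_nat_choose_two)
    have "1 / (1 + t) * (t ^ (3 * r\<^sup>2 + 2 * r) + t ^ (3 * r\<^sup>2 + (2 * 3 - 2) * r + (3 - 2))) =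
      (q ^ ((r choose 2) + r) * (t ^ (3 * r) * q ^ (2 * (r choose 2)))) * ((1 + t * q ^ r) / (1 + t))"
      unfolding e2 power_add[of t "3 * r\<^sup>2 + 2 * r"] e3 e5 by (simp add: algebra_simps add_divide_distrib)
    also have "\<dots> = wprod (q * q) (-q) q r / qpoch (-q) q r *
     (t ^ (3 * r) * ((1 - t) / (1 - t * q ^ r)) * q ^ (2 * (r choose 2)) * ((1 - q * q ^ (2 * r)) / (1 - q)))"
      unfolding w e4 q1 using nz[of r] t1 by simp
    finally show "1 / (1 + t) * (t ^ (3 * r\<^sup>2 + 2 * r) + t ^ (3 * r\<^sup>2 + (2 * 3 - 2) * r + (3 - 2))) =
      wprod (q * q) (-q) q r / qpoch (-q) q r *
     ((\<Prod>i<r. (t ^ 3 - q * q ^ Suc i) / (1 - t ^ 3 * q ^ i)) * q ^ (2 * (r choose 2)) *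
       ((1 - q * q ^ (2 * r)) / (1 - q)))"
      unfolding q_def prod_alpha_self_half[OF t(1)] .
  qed
  from has_sum_cmult_right[OF has_sum_bailey_self[OF q _ _ this], of "1 / (1 - t)"]
  have "((\<lambda>n. 1 / (1 - t) * (wprod (q * q) (-q) q n / (qpoch q q n * qpoch (t ^ 3) q n))) has_sum
        1 / (1 - t) * (qpoch_inf (-q) q / qpoch_inf (q * q) q * (1 / (1 + t) * qsum 3 2 t))) UNIV"
    using q t3 by simp
  moreover have "1 / (1 - t) * (wprod (q * q) (-q) q n / (qpoch q q n * qpoch (t ^ 3) q n)) =
        t ^ (n\<^sup>2 + n) * qpoch (-(t\<^sup>2)) (t\<^sup>2) n / qpoch t t (2 * n + 1)" for n
    unfolding qpoch_double_Suc_split[OF t(1), symmetric] wprod_shift_neg square_nat_choose_two q_def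
    by (simp add: mult_ac power_mult[symmetric] power_add[symmetric] add_ac)
  moreover have "1 / (1 - t) * (qpoch_inf (-q) q / qpoch_inf (q * q) q * (1 / (1 + t) * qsum 3 2 t)) =
       qpoch_inf (-q) q / qpoch_inf q q * qsum 3 2 t"
    using qpoch_inf_Suc[OF q, of q] q1 by (simp add: mult_ac)
  ultimately show ?thesis by (simp only: q_def)
qed

text \<open>Number 50 of Slater's list: a = t^2, c = t^3, y = -t^3 in base t^2. The two halves of the theta series coincide here, which explains the factor 1/2.\<close>

lemma has_sum_slater50:
  fixes t :: complex
  assumes t: "norm t < 1" "t \<noteq> 0"
  shows "((\<lambda>k. t ^ (k\<^sup>2 + 2 * k) * qpoch (-t) (t\<^sup>2) k / qpoch t t (2 * k + 1)) has_sum
           qpoch_inf (-t) (t\<^sup>2) / qpoch_inf (t\<^sup>2) (t\<^sup>2) * (qsum 3 3 t / 2)) UNIV"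
proof -
  define q where "q = t\<^sup>2"
  have q: "norm q < 1" using t by (simp add: q_def norm_power_less_1)
  have t3: "norm (t ^ 3) < 1" using t by (simp add: norm_power_less_1)
  have nz: "1 + t * q ^ r \<noteq> 0" "1 - t * q ^ r \<noteq> 0" for r
    using neg_power_neq_1[of q t r] pos_power_neq_1[of q t r] q t by (auto simp: add_eq_0_iff2)
  have t1: "1 - t \<noteq> 0" "1 + t \<noteq> 0" using nz[of 0] by auto
  have q1: "1 - q = (1 - t) * (1 + t)" by (simp add: q_def algebra_simps power2_eq_square)
  have "((\<lambda>r::nat. t ^ (3 * r\<^sup>2 + 3 * r) + t ^ (3 * r\<^sup>2 + (2 * 3 - 3) * r + (3 - 3))) has_sum qsum 3 3 t) UNIV"
    using qsum_fold[of t 3 3] t by simp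
  hence "((\<lambda>r::nat. t ^ (3 * r\<^sup>2 + 3 * r) + t ^ (3 * r\<^sup>2 + 3 * r)) has_sum qsum 3 3 t) UNIV"
    by simp
  from has_sum_divide_const[OF this, of 2]
  have "((\<lambda>r. wprod (q * q) (-(t ^ 3)) q r / qpoch (-(t ^ 3)) q r *
     ((\<Prod>i<r. (t ^ 3 - q * q ^ Suc i) / (1 - t ^ 3 * q ^ i)) * q ^ (2 * (r choose 2)) *
       ((1 - q * q ^ (2 * r)) / (1 - q)))) has_sum (qsum 3 3 t / 2)) UNIV"
  proof (rule has_sum_cong[THEN iffD1, rotated])
    fix r
    have w: "wprod (q * q) (-(t ^ 3)) q r / qpoch (-(t ^ 3)) q r = t ^ (r\<^sup>2 + 2 * r) * ((1 + t) / (1 + t * q ^ r))"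
      using qpoch_ratio_half[OF t(1), of r] unfolding q_def wprod_shift_half times_divide_eq_right[symmetric] by simp
    have e4: "(1 - q * q ^ (2 * r)) = (1 - t * q ^ r) * (1 + t * q ^ r)"
      by (simp add: q_def algebra_simps power2_eq_square power_mult_distrib power_mult)
    have e5: "t ^ (r\<^sup>2 + 2 * r) * (t ^ (3 * r) * q ^ (2 * (r choose 2))) = t ^ (3 * r\<^sup>2 + 3 * r)"
      by (simp add: q_def power_mult[symmetric] power_add[symmetric] square_nat_choose_two)
    have "(t ^ (3 * r\<^sup>2 + 3 * r) + t ^ (3 * r\<^sup>2 + 3 * r)) / 2 =
      t ^ (r\<^sup>2 + 2 * r) * (t ^ (3 * r) * q ^ (2 * (r choose 2)))"
      unfolding e5 by simp
    also have "\<dots> = wprod (q * q) (-(t ^ 3)) q r / qpoch (-(t ^ 3)) q r *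
     (t ^ (3 * r) * ((1 - t) / (1 - t * q ^ r)) * q ^ (2 * (r choose 2)) * ((1 - q * q ^ (2 * r)) / (1 - q)))"
      unfolding w e4 q1 using nz[of r] t1 by simp
    finally show "(t ^ (3 * r\<^sup>2 + 3 * r) + t ^ (3 * r\<^sup>2 + 3 * r)) / 2 =
      wprod (q * q) (-(t ^ 3)) q r / qpoch (-(t ^ 3)) q r *
     ((\<Prod>i<r. (t ^ 3 - q * q ^ Suc i) / (1 - t ^ 3 * q ^ i)) * q ^ (2 * (r choose 2)) *
       ((1 - q * q ^ (2 * r)) / (1 - q)))"
      unfolding q_def prod_alpha_self_half[OF t(1)] .
  qed
  from has_sum_cmult_right[OF has_sum_bailey_self[OF q _ _ this], of "1 / (1 - t)"]
  have "((\<lambda>n. 1 / (1 - t) * (wprod (q * q) (-(t ^ 3)) q n / (qpoch q q n * qpoch (t ^ 3) q n))) has_sum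
        1 / (1 - t) * (qpoch_inf (-(t ^ 3)) q / qpoch_inf (q * q) q * (qsum 3 3 t / 2))) UNIV"
    using q t3 by simp
  moreover have "1 / (1 - t) * (wprod (q * q) (-(t ^ 3)) q n / (qpoch q q n * qpoch (t ^ 3) q n)) =
        t ^ (n\<^sup>2 + 2 * n) * qpoch (-t) (t\<^sup>2) n / qpoch t t (2 * n + 1)" for n
    unfolding qpoch_double_Suc_split[OF t(1), symmetric] wprod_shift_half q_def
    by (simp add: mult_ac)
  moreover have "1 / (1 - t) * (qpoch_inf (-(t ^ 3)) q / qpoch_inf (q * q) q * (qsum 3 3 t / 2)) =
       qpoch_inf (-t) q / qpoch_inf q q * (qsum 3 3 t / 2)"
  proof -
    have "qpoch_inf (-t) q = (1 + t) * qpoch_inf (-(t ^ 3)) q"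
      using qpoch_inf_Suc[OF q, of "-t"] by (simp add: q_def eval_nat_numeral mult_ac)
    thus ?thesis using qpoch_inf_Suc[OF q, of q] q1 t1 by (simp add: mult_ac)
  qed
  ultimately show ?thesis by (simp only: q_def)
qed

section \<open>Summing out the first two variables\<close>

text \<open>Absolute convergence of all multiple series below. The map g is a linear change of indices after which the quadratic form is a sum of squares
up to a linear error; the series is then dominated by a product of four Gaussian series. With fewer than four indices the spare coordinates of g are 0.\<close>

lemma summable_quadratic_exponent:
  fixes f :: "'a \<Rightarrow> complex" and g :: "'a \<Rightarrow> int \<times> int \<times> int \<times> int" and r :: real
  assumes r: "0 < r" "r < 1" and inj: "inj g" and C: "C \<ge> 0" and N: "N \<ge> 0"
  assumes f: "\<And>x. norm (f x) \<le> C * r powi E x"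
  assumes E: "\<And>x a b c d. g x = (a, b, c, d) \<Longrightarrow>
     a\<^sup>2 + b\<^sup>2 + c\<^sup>2 + d\<^sup>2 - N * (\<bar>a\<bar> + \<bar>b\<bar> + \<bar>c\<bar> + \<bar>d\<bar>) - N \<le> E x"
  shows "f summable_on UNIV"
proof -
  define B where "B = (1 / r) ^ nat N"
  have B: "B \<ge> 1" using r by (simp add: B_def one_le_power)
  define G where "G = (\<lambda>n::int. B ^ nat \<bar>n\<bar> * r ^ nat (n\<^sup>2))"
  have G: "G summable_on UNIV" unfolding G_def using r B by (intro summable_gauss_int) auto
  have G0: "G n \<ge> 0" for n using r B by (simp add: G_def)
  have G_powi: "G n = r powi (n\<^sup>2 - N * \<bar>n\<bar>)" for n
  proof -
    have "N * \<bar>n\<bar> = int (nat N * nat \<bar>n\<bar>)" using N by simp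
    hence "r powi (n\<^sup>2 - N * \<bar>n\<bar>) = r powi n\<^sup>2 / r powi (int (nat N * nat \<bar>n\<bar>))"
      using r N by (simp add: power_int_diff)
    also have "r powi n\<^sup>2 = r ^ nat (n\<^sup>2)"
      by (metis int_nat_eq power_int_of_nat zero_le_power2)
    also have "r powi (int (nat N * nat \<bar>n\<bar>)) = (r ^ nat N) ^ nat \<bar>n\<bar>"
      by (simp only: power_int_of_nat power_mult)
    finally show ?thesis by (simp add: G_def B_def power_one_over field_simps)
  qed
  define h where "h = (\<lambda>(a, b, c, d). G a * (G b * (G c * G d)))"
  have "(\<lambda>(c, d). G c * G d) summable_on UNIV"
    using summable_on_times_real[OF G G] G0 by simp
  hence "(\<lambda>(b, p). G b * (case p of (c, d) \<Rightarrow> G c * G d)) summable_on UNIV \<times> UNIV"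
    by (intro summable_on_times_real G) (use G0 in auto)
  hence "(\<lambda>(a, p). G a * (case p of (b, p) \<Rightarrow> G b * (case p of (c, d) \<Rightarrow> G c * G d))) summable_on UNIV \<times> UNIV"
    by (intro summable_on_times_real G) (use G0 in auto)
  hence "h summable_on UNIV" by (simp add: h_def case_prod_unfold)
  hence "h summable_on range g" by (rule summable_on_subset) auto
  hence "(h \<circ> g) summable_on UNIV" using inj by (subst (asm) summable_on_reindex) auto
  hence "(\<lambda>x. C * r powi (-N) * h (g x)) summable_on UNIV"
    by (intro summable_on_cmult_right) (simp add: o_def)
  thus ?thesis
  proof (rule summable_on_complex_majorant)
    fix x
    obtain a b c d where g: "g x = (a, b, c, d)" by (cases "g x") auto
    have "r powi E x \<le> r powi (a\<^sup>2 + b\<^sup>2 + c\<^sup>2 + d\<^sup>2 - N * (\<bar>a\<bar> + \<bar>b\<bar> + \<bar>c\<bar> + \<bar>d\<bar>) - N)"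
      using E[OF g] r by (intro power_int_decreasing) auto
    also have "\<dots> = r powi ((-N) + ((a\<^sup>2 - N * \<bar>a\<bar>) + ((b\<^sup>2 - N * \<bar>b\<bar>) + ((c\<^sup>2 - N * \<bar>c\<bar>) + (d\<^sup>2 - N * \<bar>d\<bar>)))))"
      by (rule arg_cong[of _ _ "power_int r"]) (simp add: algebra_simps)
    also have "\<dots> = r powi (-N) * h (g x)"
      using r by (simp only: h_def g prod.case G_powi power_int_add[OF disjI1[OF less_imp_neq[OF r(1), symmetric]]])
    finally have "C * r powi E x \<le> C * r powi (-N) * h (g x)"
      using C by (simp add: mult_left_mono mult.assoc)
    thus "norm (f x) \<le> C * r powi (-N) * h (g x)" using f[of x] by linarith
  qed
qed

lemma powi_mult_eq: "y \<noteq> (0::complex) \<Longrightarrow> a + b = c \<Longrightarrow> y powi a * y powi b = y powi c"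
  by (simp add: power_int_add[symmetric])

text \<open>The factors 1 - t^(i-M) = -t^(i-M) (1 - t^(M-i)) are reversed one by one.\<close>

lemma qpoch_inverse_power:
  fixes t :: complex
  assumes t: "norm t < 1" "t \<noteq> 0" and "k \<le> M"
  shows "(-1) ^ k * qpoch (t powi (- int M)) t k =
           t ^ (k choose 2) * t powi (- int M * int k) * qpoch t t M / qpoch t t (M - k)"
  using assms(3)
proof (induction k)
  case (Suc k)
  have nz: "qpoch t t n \<noteq> 0" for n using t by simp
  have M: "M - k = Suc (M - Suc k)" using Suc by simp
  have r: "qpoch t t (M - k) = qpoch t t (M - Suc k) * (1 - t ^ (M - k))"
    unfolding M qpoch_Suc by simp
  hence nz': "1 - t ^ (M - k) \<noteq> 0" using nz[of "M - k"] by auto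
  have "t powi (- int M) * t powi int k = t powi (- int M + int k)"
    by (rule powi_mult_eq) (use t in auto)
  moreover have "t powi (- int M + int k) * t powi int (M - k) = t powi (- int M + int k + int (M - k))"
    by (rule powi_mult_eq) (use t in auto)
  ultimately have "t powi (- int M) * t ^ k * t ^ (M - k) = t powi (- int M + int k + int (M - k))"
    by (simp only: power_int_of_nat)
  also have "- int M + int k + int (M - k) = 0" using Suc by simp
  finally have e: "t powi (- int M) * t ^ k * t ^ (M - k) = 1" by simp
  have f: "- (1 - t powi (- int M) * t ^ k) = t powi (- int M) * t ^ k * (1 - t ^ (M - k))"
    unfolding right_diff_distrib e by simp
  have "(-1) ^ Suc k * qpoch (t powi (- int M)) t (Suc k) =
     ((-1) ^ k * qpoch (t powi (- int M)) t k) * (- (1 - t powi (- int M) * t ^ k))"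
    by (simp only: qpoch_Suc power_Suc mult_minus_left mult_minus_right mult_1 mult.assoc)
  also have "\<dots> = t ^ (k choose 2) * t powi (- int M * int k) * qpoch t t M / qpoch t t (M - k) *
      (t powi (- int M) * t ^ k * (1 - t ^ (M - k)))"
    using Suc f by simp
  also have "\<dots> = t ^ (k choose 2) * t ^ k * (t powi (- int M * int k) * t powi (- int M)) * qpoch t t M / qpoch t t (M - Suc k)"
    unfolding r using nz' nz[of "M - Suc k"] by (simp add: field_simps)
  also have "t powi (- int M * int k) * t powi (- int M) = t powi (- int M * int (Suc k))"
    using t by (intro powi_mult_eq) (auto simp: algebra_simps)
  also have "t ^ (k choose 2) * t ^ k = t ^ (Suc k choose 2)"
    by (simp add: Suc_choose_two power_add)
  finally show ?case .
qed (use t in auto)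

lemma qpoch_inverse_power_eq_0:
  fixes t :: complex
  assumes "t \<noteq> 0" and "k > M"
  shows "qpoch (t powi (- int M)) t k = 0"
  unfolding qpoch_eq_0_iff using assms by (intro exI[of _ M]) (simp add: power_int_minus)

text \<open>The value depends only on the parity of p. An arbitrary integer p is allowed because completing a square
produces shifts that are known only up to an even number.\<close>

definition theta_class :: "complex \<Rightarrow> int \<Rightarrow> complex" where
  "theta_class y p = (\<Sum>\<^sub>\<infinity>n::int. y powi ((2 * n + p)\<^sup>2))"

lemma theta_class_shift: "theta_class y (p + 2 * j) = theta_class y p"
proof -
  have "bij_betw (\<lambda>n::int. n + j) UNIV UNIV"
    by (rule bij_betwI[of _ _ _ "\<lambda>n. n - j"]) auto
  from infsum_reindex_bij_betw[OF this, of "\<lambda>n. y powi ((2 * n + p)\<^sup>2)"]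
  show ?thesis unfolding theta_class_def by (simp add: algebra_simps)
qed

lemma theta_class_eq:
  assumes "y \<noteq> 0"
  shows "theta_class y 0 = qsum 2 0 (y\<^sup>2)" "theta_class y 1 = y * qsum 2 2 (y\<^sup>2)"
proof -
  have "y powi ((2 * n)\<^sup>2) = (y\<^sup>2) powi (2 * n\<^sup>2)" for n :: int
    by (simp add: power2_eq_square power_int_mult_distrib flip: power_int_add)
       (use assms in \<open>simp add: power_int_add[symmetric]\<close>)
  thus "theta_class y 0 = qsum 2 0 (y\<^sup>2)" by (simp add: theta_class_def qsum_def)
  have "y powi ((2 * n + 1)\<^sup>2) = y * (y\<^sup>2) powi (2 * n\<^sup>2 + 2 * n)" for n :: int
  proof -
    have "(y\<^sup>2) powi (2 * n\<^sup>2 + 2 * n) = y powi (2 * (2 * n\<^sup>2 + 2 * n))"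
      by (metis power_int_mult power_int_numeral)
    hence "y * (y\<^sup>2) powi (2 * n\<^sup>2 + 2 * n) = y powi (1 + 2 * (2 * n\<^sup>2 + 2 * n))"
      using assms by (simp add: power_int_add)
    also have "1 + 2 * (2 * n\<^sup>2 + 2 * n) = (2 * n + 1)\<^sup>2"
      by (simp add: power2_eq_square algebra_simps)
    finally show ?thesis ..
  qed
  thus "theta_class y 1 = y * qsum 2 2 (y\<^sup>2)"
    by (simp add: theta_class_def qsum_def infsum_cmult_right')
qed

lemma has_sum_theta_class:
  assumes y: "norm y < 1" "y \<noteq> 0"
  shows "((\<lambda>n::int. y powi ((2 * n + p)\<^sup>2)) has_sum theta_class y p) UNIV"
proof -
  have "(\<lambda>n::int. y powi ((2 * n + p)\<^sup>2)) summable_on UNIV"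
  proof (rule summable_quadratic_exponent[where g = "\<lambda>n. (2 * n + p, 0, 0, 0)" and C = 1 and N = 0
        and r = "norm y" and E = "\<lambda>n. (2 * n + p)\<^sup>2"])
    show "inj (\<lambda>n. (2 * n + p, 0::int, 0::int, 0::int))" by (auto simp: inj_on_def)
  qed (use y in \<open>auto simp: norm_power_int\<close>)
  thus ?thesis unfolding theta_class_def by (rule has_sum_infsum)
qed

lemma theta_class_bounded:
  obtains C where "C \<ge> 1" "\<And>p. norm (theta_class y p) \<le> C"
proof (rule that[of "max 1 (max (norm (theta_class y 0)) (norm (theta_class y 1)))"])
  fix p :: int
  have "theta_class y p = theta_class y (p mod 2)"
    using theta_class_shift[of y "p mod 2" "p div 2"] by simp
  moreover have "p mod 2 = 0 \<or> p mod 2 = 1" by auto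
  ultimately show "norm (theta_class y p) \<le> max 1 (max (norm (theta_class y 0)) (norm (theta_class y 1)))"
    by (auto simp: le_max_iff_disj)
qed auto

lemma has_sum_assoc:
  assumes "((\<lambda>(a, b, c). f a b c) has_sum S) UNIV"
  shows "((\<lambda>((a, b), c). f a b c) has_sum S) UNIV"
proof -
  have "bij_betw (\<lambda>((a, b), c). (a, b, c)) UNIV UNIV"
    by (rule bij_betwI[of _ _ _ "\<lambda>(a, b, c). ((a, b), c)"]) auto
  from has_sum_reindex_bij_betw[OF this, of "\<lambda>(a, b, c). f a b c" S] assms
  show ?thesis by (simp add: case_prod_unfold)
qed

lemma powi_double:
  fixes y :: complex
  assumes "y \<noteq> 0"
  shows "(y\<^sup>2) powi E = y powi (2 * E)"
  using assms power_int_mult[of y 2 E] by simp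

lemma powi_choose_two:
  fixes q :: complex
  assumes "q \<noteq> 0"
  shows "(q\<^sup>2) ^ (n choose 2) = q powi (int n * (int n - 1))"
  unfolding choose_two_int[symmetric] powi_double[OF assms, symmetric] by simp

text \<open>The quadratic part k^2 with k = n + m dominates n^2 + m^2, since n and m are natural numbers; everything else is linear.\<close>

lemma exponent_nonneg_bound:
  fixes s :: int and n m M :: nat and al :: int
  assumes "al \<in> {0, 1}"
  defines "k \<equiv> int n + int m"
  shows "s\<^sup>2 + (int n)\<^sup>2 + (int m)\<^sup>2 + 0\<^sup>2 - (4 * int M + 4) * (\<bar>s\<bar> + \<bar>int n\<bar> + \<bar>int m\<bar> + \<bar>0\<bar>) - (4 * int M + 4)
     \<le> s\<^sup>2 + (k\<^sup>2 + 2 * k - 2 * al * k - al) + (2 * (int n)\<^sup>2 - 2 * int n - 4 * int M * int n)"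
proof -
  have "int M * \<bar>s\<bar> \<ge> 0" "int M * int m \<ge> 0" "int n * int m \<ge> 0" "(int n)\<^sup>2 \<ge> 0" by simp_all
  moreover have "k\<^sup>2 = (int n)\<^sup>2 + (int m)\<^sup>2 + 2 * (int n * int m)"
    by (simp add: k_def power2_eq_square algebra_simps)
  moreover have "al = 0 \<or> al = 1" using assms(1) by simp
  ultimately show ?thesis
    by (elim disjE) (simp_all add: k_def algebra_simps)
qed

text \<open>One triple series over n1 in Z and n2, m in N is evaluated in two ways. Summing over m first gives
(t^(n1+1))_inf, which vanishes for n1 < 0 and otherwise is (t)_inf / (t)_{n1}: this is the left hand side. Summing over
n1 first gives a theta series whose class depends only on n2 + m; collecting the terms with n2 + m = k leaves a
finite q-binomial sum, which terminates at k = M.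

Square roots y of q are used because completing the square in n1 produces exponents that are half-integral in q.\<close>

lemma has_sum_pair:
  fixes y q t :: complex and al :: int and M :: nat
  assumes y: "norm y < 1" "y \<noteq> 0" and qy: "q = y\<^sup>2" and tq: "t = q\<^sup>2" and al: "al \<in> {0, 1}"
  shows "((\<lambda>(n1, n2). q powi (2 * (int n1)\<^sup>2 + 2 * (int n2)\<^sup>2 - 2 * int n1 * int n2 + 2 * al * (int n1 - int n2)
              - 2 * int M * int n2) / (qpoch t t n1 * qpoch t t n2)) has_sum
           (\<Sum>k\<le>M. y powi ((int k)\<^sup>2 + 2 * int k - 2 * al * int k - al) * theta_class y (int k + al) *
              (t ^ (k choose 2) * t powi (- int M * int k) * qpoch t t M / qpoch t t (M - k)) / qpoch t t k) / qpoch_inf t t) UNIV"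
proof -
  have q: "norm q < 1" "q \<noteq> 0" using y by (auto simp: qy norm_power_less_1)
  have t: "norm t < 1" "t \<noteq> 0" using q by (auto simp: tq norm_power_less_1)
  define r where "r = norm y"
  have r: "0 < r" "r < 1" using y by (auto simp: r_def)
  obtain C where C: "C \<ge> 1" "\<And>n. norm (1 / qpoch t t n) \<le> C"
    using inverse_qpoch_bounded[OF t(1) self_mult_power_neq_1[OF t(1)]] by metis
  \<comment> \<open>The exponent of the triple series; E2 completes the square in n1, and what remains depends on n2 + m and n2 only.\<close>
  define E where "E = (\<lambda>(n1::int) (n2::nat) (m::nat). 2 * n1\<^sup>2 + 2 * al * n1 - 2 * n1 * int n2 + 2 * n1 * int m
      + (int m)\<^sup>2 + int m + 2 * (int n2)\<^sup>2 - 2 * al * int n2 - 2 * int M * int n2)"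
  define f where "f = (\<lambda>n1 n2 m. (-1) ^ m * q powi (E n1 n2 m) / (qpoch t t n2 * qpoch t t m))"
  have E2: "2 * E n1 n2 m = (2 * n1 + (int m - int n2 + al))\<^sup>2 +
      ((int n2 + int m)\<^sup>2 + 2 * (int n2 + int m) - 2 * al * (int n2 + int m) - al) +
      (2 * (int n2)\<^sup>2 - 2 * int n2 - 4 * int M * int n2)" for n1 n2 m
    using al by (auto simp: E_def power2_eq_square algebra_simps)
  have summable: "(\<lambda>(n1, n2, m). f n1 n2 m) summable_on UNIV"
  proof (rule summable_quadratic_exponent[OF r,
      where g = "\<lambda>(n1, n2, m). (2 * n1 + (int m - int n2 + al), int n2, int m, 0)" and C = "C * C"
        and N = "4 * int M + 4" and E = "\<lambda>(n1, n2, m). 2 * E n1 n2 m"])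
    show "inj (\<lambda>(n1, n2, m). (2 * n1 + (int m - int n2 + al), int n2, int m, 0::int))"
      by (auto simp: inj_on_def)
    show "0 \<le> C * C" "0 \<le> 4 * int M + 4" using C by auto
    fix x :: "int \<times> nat \<times> nat"
    obtain n1 n2 m where x: "x = (n1, n2, m)" by (cases x) auto
    have "norm (f n1 n2 m) = norm (1 / qpoch t t n2) * norm (1 / qpoch t t m) * r powi (2 * E n1 n2 m)"
      unfolding f_def qy powi_double[OF y(2)]
      by (simp add: norm_mult norm_divide norm_power norm_power_int r_def)
    also have "\<dots> \<le> C * C * r powi (2 * E n1 n2 m)"
      using C r by (intro mult_right_mono mult_mono) auto
    finally show "norm (case x of (n1, n2, m) \<Rightarrow> f n1 n2 m) \<le> C * C * r powi (case x of (n1, n2, m) \<Rightarrow> 2 * E n1 n2 m)"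
      by (simp add: x)
    fix a b c d :: int
    assume "(case x of (n1, n2, m) \<Rightarrow> (2 * n1 + (int m - int n2 + al), int n2, int m, 0)) = (a, b, c, d)"
    thus "a\<^sup>2 + b\<^sup>2 + c\<^sup>2 + d\<^sup>2 - (4 * int M + 4) * (\<bar>a\<bar> + \<bar>b\<bar> + \<bar>c\<bar> + \<bar>d\<bar>) - (4 * int M + 4) \<le> (case x of (n1, n2, m) \<Rightarrow> 2 * E n1 n2 m)"
      using exponent_nonneg_bound[OF al, of a n2 m M] unfolding x prod.case E2 by auto
  qed
  define S where "S = infsum (\<lambda>(n1, n2, m). f n1 n2 m) UNIV"
  have S: "((\<lambda>(n1, n2, m). f n1 n2 m) has_sum S) UNIV"
    unfolding S_def by (rule has_sum_infsum[OF summable])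
  \<comment> \<open>For fixed n1 and n2 the sum over m restores the infinite product.\<close>
  define F where "F = (\<lambda>(n1::int) (n2::nat). q powi (2 * n1\<^sup>2 + 2 * (int n2)\<^sup>2 - 2 * n1 * int n2 + 2 * al * (n1 - int n2)
              - 2 * int M * int n2) / qpoch t t n2)"
  have "((\<lambda>((n1, n2), m). f n1 n2 m) has_sum S) UNIV"
    using has_sum_assoc[OF S] .
  hence "((\<lambda>(p, m). f (fst p) (snd p) m) has_sum S) UNIV"
    by (simp add: case_prod_unfold)
  hence "((\<lambda>p. F (fst p) (snd p) * qpoch_inf (t powi (fst p + 1)) t) has_sum S) UNIV"
  proof (rule has_sum_iterated)
    fix p :: "int \<times> nat"
    obtain n1 n2 where p: "p = (n1, n2)" by (cases p)
    have "((\<lambda>m. F n1 n2 * (t ^ (m choose 2) * (-(t powi (n1 + 1))) ^ m / qpoch t t m)) has_sum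
        F n1 n2 * qpoch_inf (t powi (n1 + 1)) t) UNIV"
      by (intro has_sum_cmult_right has_sum_euler t)
    moreover have "F n1 n2 * (t ^ (m choose 2) * (-(t powi (n1 + 1))) ^ m / qpoch t t m) = f n1 n2 m" for m
    proof -
      have "(t powi (n1 + 1)) ^ m = q powi (2 * ((n1 + 1) * int m))"
        unfolding tq powi_double[OF q(2)] by (metis (no_types, opaque_lifting) mult.assoc power_int_mult power_int_of_nat)
      moreover have "t ^ (m choose 2) = q powi (int m * (int m - 1))"
        unfolding tq by (rule powi_choose_two[OF q(2)])
      moreover have "q powi (int m * (int m - 1)) * q powi (2 * ((n1 + 1) * int m)) = q powi ((int m)\<^sup>2 + int m + 2 * n1 * int m)"
        by (rule powi_mult_eq[OF q(2)]) (simp add: power2_eq_square algebra_simps)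
      ultimately have 1: "t ^ (m choose 2) * (-(t powi (n1 + 1))) ^ m = (-1) ^ m * q powi ((int m)\<^sup>2 + int m + 2 * n1 * int m)"
        by (simp add: power_minus[of "t powi (n1 + 1)"] mult_ac)
      have 2: "q powi (2 * n1\<^sup>2 + 2 * (int n2)\<^sup>2 - 2 * n1 * int n2 + 2 * al * (n1 - int n2) - 2 * int M * int n2) *
         q powi ((int m)\<^sup>2 + int m + 2 * n1 * int m) = q powi (E n1 n2 m)"
        by (rule powi_mult_eq[OF q(2)]) (simp add: E_def algebra_simps)
      show ?thesis unfolding 1 f_def F_def 2[symmetric] by simp
    qed
    ultimately show "(f (fst p) (snd p) has_sum F (fst p) (snd p) * qpoch_inf (t powi (fst p + 1)) t) UNIV"
      by (simp add: p)
  qed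
  also have "?this \<longleftrightarrow> ((\<lambda>p. F (fst p) (snd p) * qpoch_inf (t powi (fst p + 1)) t) has_sum S) (range (\<lambda>(n1, n2). (int n1, n2)))"
  proof (rule has_sum_cong_neutral)
    fix p :: "int \<times> nat" assume p: "p \<in> UNIV - range (\<lambda>(n1, n2). (int n1, n2))"
    obtain n1 n2 where p': "p = (n1, n2)" by (cases p)
    have "n1 < 0"
    proof (rule ccontr)
      assume "\<not> n1 < 0"
      hence "p = (\<lambda>(n1, n2). (int n1, n2)) (nat n1, n2)" by (simp add: p')
      with p show False by blast
    qed
    hence "t powi (- (n1 + 1)) = t ^ nat (- (n1 + 1))"
      by (intro power_int_eq_power) simp
    hence "t powi (n1 + 1) * t ^ nat (- (n1 + 1)) = t powi (n1 + 1) * t powi (- (n1 + 1))"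
      by (simp only:)
    also have "\<dots> = t powi 0" by (rule powi_mult_eq) (use t in auto)
    finally have "qpoch_inf (t powi (n1 + 1)) t = 0"
      using qpoch_inf_nonzero_iff[OF t(1), of "t powi (n1 + 1)"] by auto
    thus "F (fst p) (snd p) * qpoch_inf (t powi (fst p + 1)) t = 0" by (simp add: p')
  qed auto
  also have "\<dots> \<longleftrightarrow> ((\<lambda>(n1, n2). F (int n1) n2 * qpoch_inf (t powi (int n1 + 1)) t) has_sum S) UNIV"
    by (subst has_sum_reindex) (auto simp: inj_on_def o_def case_prod_unfold)
  finally have "((\<lambda>(n1, n2). F (int n1) n2 * qpoch_inf (t powi (int n1 + 1)) t) has_sum S) UNIV" .
  from has_sum_divide_const[OF this, of "qpoch_inf t t"]
  have main: "((\<lambda>(n1, n2). F (int n1) n2 / qpoch t t n1) has_sum S / qpoch_inf t t) UNIV"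
  proof (rule has_sum_cong[THEN iffD1, rotated])
    fix p :: "nat \<times> nat"
    obtain n1 n2 where p: "p = (n1, n2)" by (cases p)
    have "t powi (int n1 + 1) = t ^ Suc n1"
      by (rule power_int_eq_power) simp
    hence "qpoch_inf (t powi (int n1 + 1)) t = qpoch_inf t t / qpoch t t n1"
      using qpoch_inf_shift_self[OF t(1), of n1] by simp
    moreover have "qpoch_inf t t \<noteq> 0" using t by simp
    ultimately show "(case p of (n1, n2) \<Rightarrow> F (int n1) n2 * qpoch_inf (t powi (int n1 + 1)) t) / qpoch_inf t t =
        (case p of (n1, n2) \<Rightarrow> F (int n1) n2 / qpoch t t n1)"
      by (simp add: p)
  qed
  \<comment> \<open>For fixed n2 and m the sum over n1 is a theta series.\<close>
  define c where "c = (\<lambda>n2 m. (-1) ^ m * y powi ((int n2 + int m)\<^sup>2 + 2 * (int n2 + int m) - 2 * al * (int n2 + int m) - al) *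
     (t ^ (n2 choose 2) * (t powi (- int M)) ^ n2) / (qpoch t t n2 * qpoch t t m) * theta_class y (int n2 + int m + al))"
  have "((\<lambda>(p, n1). (\<lambda>(n2, m). f n1 n2 m) p) has_sum S) UNIV"
    using has_sum_swap_UNIV[of "\<lambda>n1 (n2, m). f n1 n2 m"] S by (simp add: case_prod_unfold)
  hence "((\<lambda>(n2, m). c n2 m) has_sum S) UNIV"
  proof (rule has_sum_iterated)
    fix p :: "nat \<times> nat"
    obtain n2 m where p: "p = (n2, m)" by (cases p)
    define c' where "c' = (-1) ^ m * y powi ((int n2 + int m)\<^sup>2 + 2 * (int n2 + int m) - 2 * al * (int n2 + int m) - al) *
       (t ^ (n2 choose 2) * (t powi (- int M)) ^ n2) / (qpoch t t n2 * qpoch t t m)"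
    have "((\<lambda>n1. c' * y powi ((2 * n1 + (int m - int n2 + al))\<^sup>2)) has_sum c' * theta_class y (int m - int n2 + al)) UNIV"
      by (intro has_sum_cmult_right has_sum_theta_class y)
    moreover have "c' * y powi ((2 * n1 + (int m - int n2 + al))\<^sup>2) = f n1 n2 m" for n1
    proof -
      have tn: "t ^ (n2 choose 2) * (t powi (- int M)) ^ n2 = y powi (2 * (int n2)\<^sup>2 - 2 * int n2 - 4 * int M * int n2)"
      proof -
        have "(t powi (- int M)) ^ n2 = q powi (2 * (- int M * int n2))"
          unfolding tq powi_double[OF q(2), symmetric] by (metis power_int_mult power_int_of_nat)
        moreover have "t ^ (n2 choose 2) = q powi (int n2 * (int n2 - 1))"
          unfolding tq by (rule powi_choose_two[OF q(2)])
        moreover have "q powi (int n2 * (int n2 - 1)) * q powi (2 * (- int M * int n2)) =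
            q powi ((int n2)\<^sup>2 - int n2 - 2 * int M * int n2)"
          by (rule powi_mult_eq[OF q(2)]) (simp add: power2_eq_square algebra_simps)
        moreover have "2 * ((int n2)\<^sup>2 - int n2 - 2 * int M * int n2) = 2 * (int n2)\<^sup>2 - 2 * int n2 - 4 * int M * int n2"
          by simp
        ultimately show ?thesis unfolding qy by (metis powi_double[OF y(2)])
      qed
      have "q powi (E n1 n2 m) = y powi ((2 * n1 + (int m - int n2 + al))\<^sup>2) *
          (y powi ((int n2 + int m)\<^sup>2 + 2 * (int n2 + int m) - 2 * al * (int n2 + int m) - al) *
           (t ^ (n2 choose 2) * (t powi (- int M)) ^ n2))"
        unfolding qy powi_double[OF y(2)] E2 tn[unfolded qy]
        unfolding power_int_add[OF disjI1[OF y(2)]] by (simp only: mult.assoc)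
      thus ?thesis by (simp add: f_def c'_def)
    qed
    moreover have "theta_class y (int m - int n2 + al) = theta_class y (int n2 + int m + al)"
      using theta_class_shift[of y "int m - int n2 + al" "int n2"] by (simp add: algebra_simps)
    ultimately show "((\<lambda>n1. (\<lambda>(n2, m). f n1 n2 m) p) has_sum (case p of (n2, m) \<Rightarrow> c n2 m)) UNIV"
      by (simp add: p c_def c'_def)
  qed
  from has_sum_antidiagonal[OF this]
  have "((\<lambda>k. y powi ((int k)\<^sup>2 + 2 * int k - 2 * al * int k - al) * theta_class y (int k + al) *
     ((-1) ^ k * qpoch (t powi (- int M)) t k) / qpoch t t k) has_sum S) UNIV"
  proof (rule has_sum_cong[THEN iffD1, rotated])
    fix k
    define Y where "Y = y powi ((int k)\<^sup>2 + 2 * int k - 2 * al * int k - al) * theta_class y (int k + al) * (-1) ^ k"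
    have "(\<Sum>i\<le>k. c i (k - i)) = (\<Sum>i\<le>k. Y * ((-1) ^ i * t ^ (i choose 2) * (t powi (- int M)) ^ i /
        (qpoch t t i * qpoch t t (k - i))))"
    proof (intro sum.cong refl)
      fix i assume "i \<in> {..k}"
      then obtain m where k: "k = i + m" by (metis atMost_iff le_Suc_ex)
      have "(-1) ^ i * (-1) ^ i = (1 :: complex)" by (simp flip: power_mult_distrib)
      thus "c i (k - i) = Y * ((-1) ^ i * t ^ (i choose 2) * (t powi (- int M)) ^ i /
        (qpoch t t i * qpoch t t (k - i)))"
        by (simp add: c_def Y_def k power_add mult_ac)
    qed
    also have "\<dots> = Y * (qpoch (t powi (- int M)) t k / qpoch t t k)"
      unfolding sum_distrib_left[symmetric] qbinomial_finite[OF t(1)] ..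
    finally show "(\<Sum>i\<le>k. c i (k - i)) = y powi ((int k)\<^sup>2 + 2 * int k - 2 * al * int k - al) * theta_class y (int k + al) *
     ((-1) ^ k * qpoch (t powi (- int M)) t k) / qpoch t t k"
      by (simp add: Y_def)
  qed
  also have "?this \<longleftrightarrow> ((\<lambda>k. y powi ((int k)\<^sup>2 + 2 * int k - 2 * al * int k - al) * theta_class y (int k + al) *
     (t ^ (k choose 2) * t powi (- int M * int k) * qpoch t t M / qpoch t t (M - k)) / qpoch t t k) has_sum S) {..M}"
    by (rule has_sum_cong_neutral)
       (use t in \<open>auto simp: qpoch_inverse_power qpoch_inverse_power_eq_0\<close>)
  finally have "S = (\<Sum>k\<le>M. y powi ((int k)\<^sup>2 + 2 * int k - 2 * al * int k - al) * theta_class y (int k + al) *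
     (t ^ (k choose 2) * t powi (- int M * int k) * qpoch t t M / qpoch t t (M - k)) / qpoch t t k)"
    by (metis (no_types, lifting) finite_atMost has_sum_finite has_sum_unique)
  with main show ?thesis
    by (simp add: F_def case_prod_unfold mult_ac)
qed

text \<open>Geometric growth is rewritten as a linear term in the exponent, in the form required by the convergence criterion.\<close>

lemma power_le_powi_neg:
  fixes r B :: real
  assumes "0 < r" "r < 1" "B \<ge> 0"
  obtains N :: nat where "\<And>M. B ^ M \<le> r powi (- int N * int M)"
proof -
  have "1 / r > 1" using assms by simp
  then obtain N where N: "B < (1 / r) ^ N" using real_arch_pow by blast
  show ?thesis
  proof (rule that[of N])
    fix M
    have "B ^ M \<le> ((1 / r) ^ N) ^ M" using N assms(3) by (intro power_mono) auto
    also have "((1 / r) ^ N) ^ M = r powi (- int N * int M)"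
    proof -
      have "r powi (- int N * int M) = inverse (r powi (int (N * M)))"
        using power_int_minus[of r "int (N * M)"] by simp
      thus ?thesis by (simp only: power_int_of_nat power_one_over power_mult inverse_eq_divide)
    qed
    finally show "B ^ M \<le> r powi (- int N * int M)" .
  qed
qed

text \<open>For each M the double sum over n1, n2 is a finite sum over k by the preceding lemma. With M = k + j the exponents of q that
involve M and k combine to j^2, so the remaining double series over k and j factors into V(k) and a theta series.\<close>

theorem rank_reduction:
  fixes y q t :: complex and al :: int and w V :: "nat \<Rightarrow> complex"
  assumes y: "norm y < 1" "y \<noteq> 0" and qy: "q = y\<^sup>2" and tq: "t = q\<^sup>2" and al: "al \<in> {0, 1}"
  assumes w: "B \<ge> 0" "D \<ge> 0" "\<And>M. norm (w M) \<le> D * B ^ M"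
  assumes V: "\<And>k. ((\<lambda>j. q ^ j\<^sup>2 * w (k + j) / qpoch t t j) has_sum V k) UNIV"
  assumes T: "((\<lambda>k. y powi ((int k)\<^sup>2 - 2 * al * int k - al) * theta_class y (int k + al) * V k / qpoch t t k) has_sum T) UNIV"
  shows "((\<lambda>(M, n1, n2). q powi (2 * (int n1)\<^sup>2 + 2 * (int n2)\<^sup>2 - 2 * int n1 * int n2 + 2 * al * (int n1 - int n2)
              - 2 * int M * int n2 + (int M)\<^sup>2) * w M / (qpoch t t n1 * qpoch t t n2 * qpoch t t M)) has_sum
            T / qpoch_inf t t) UNIV"
proof -
  have q: "norm q < 1" "q \<noteq> 0" using y by (auto simp: qy norm_power_less_1)
  have t: "norm t < 1" "t \<noteq> 0" using q by (auto simp: tq norm_power_less_1)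
  obtain C where C: "C \<ge> 1" "\<And>n. norm (1 / qpoch t t n) \<le> C"
    using inverse_qpoch_bounded[OF t(1) self_mult_power_neq_1[OF t(1)]] by metis
  obtain Ct where Ct: "Ct \<ge> 1" "\<And>p. norm (theta_class y p) \<le> Ct"
    using theta_class_bounded[of y] by metis
  define P where "P = (\<lambda>k j. y powi ((int k)\<^sup>2 - 2 * al * int k - al) * theta_class y (int k + al) *
     (q ^ j\<^sup>2 * w (k + j)) / (qpoch t t k * qpoch t t j))"
  have P_summable: "(\<lambda>(k, j). P k j) summable_on UNIV"
  proof -
    define r where "r = norm y"
    have r: "0 < r" "r < 1" using y by (auto simp: r_def)
    obtain N where N: "\<And>M. B ^ M \<le> r powi (- int N * int M)"
      using power_le_powi_neg[OF r w(1)] by metis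
    show ?thesis
    proof (rule summable_quadratic_exponent[OF r,
        where g = "\<lambda>(k, j). (int k, int j, 0, 0)" and C = "C * C * Ct * D" and N = "int N + 2"
          and E = "\<lambda>(k, j). ((int k)\<^sup>2 - 2 * al * int k - al) + 2 * (int j)\<^sup>2 + - int N * int (k + j)"])
      show "inj (\<lambda>(k, j). (int k, int j, 0::int, 0::int))" by (auto simp: inj_on_def)
      show "0 \<le> C * C * Ct * D" "0 \<le> int N + 2" using C Ct w by auto
      fix x :: "nat \<times> nat"
      obtain k j where x: "x = (k, j)" by (cases x)
      have qj: "norm (q ^ j\<^sup>2) = r powi (2 * (int j)\<^sup>2)"
      proof -
        have "r powi (2 * (int j)\<^sup>2) = r ^ (2 * j\<^sup>2)" by (rule power_int_eq_power) simp
        thus ?thesis by (simp add: qy r_def norm_power power_mult)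
      qed
      have "norm (P k j) = norm (1 / qpoch t t k) * norm (1 / qpoch t t j) * norm (theta_class y (int k + al)) *
          norm (w (k + j)) * (norm (y powi ((int k)\<^sup>2 - 2 * al * int k - al)) * norm (q ^ j\<^sup>2))"
        by (simp add: P_def norm_mult norm_divide)
      also have "\<dots> \<le> C * C * Ct * (D * r powi (- int N * int (k + j))) *
          (norm (y powi ((int k)\<^sup>2 - 2 * al * int k - al)) * norm (q ^ j\<^sup>2))"
        using C Ct w(2) N[of "k + j"]
        by (intro mult_right_mono mult_mono order_trans[OF w(3)] mult_left_mono) (auto simp: r_def)
      also have "\<dots> = C * C * Ct * D * (r powi ((int k)\<^sup>2 - 2 * al * int k - al) * r powi (2 * (int j)\<^sup>2) * r powi (- int N * int (k + j)))"
        unfolding qj by (simp add: norm_power_int r_def mult_ac)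
      also have "r powi ((int k)\<^sup>2 - 2 * al * int k - al) * r powi (2 * (int j)\<^sup>2) * r powi (- int N * int (k + j)) =
          r powi (((int k)\<^sup>2 - 2 * al * int k - al) + 2 * (int j)\<^sup>2 + - int N * int (k + j))"
        using r(1) by (simp only: power_int_add[OF disjI1[OF less_imp_neq[OF r(1), symmetric]]])
      finally show "norm (case x of (k, j) \<Rightarrow> P k j) \<le> C * C * Ct * D *
          r powi (case x of (k, j) \<Rightarrow> ((int k)\<^sup>2 - 2 * al * int k - al) + 2 * (int j)\<^sup>2 + - int N * int (k + j))"
        by (simp add: x)
      fix a b c d :: int
      assume "(case x of (k, j) \<Rightarrow> (int k, int j, 0, 0)) = (a, b, c, d)"
      hence "a = int k" "b = int j" "c = 0" "d = 0" by (auto simp: x)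
      moreover have "al = 0 \<or> al = 1" using al by auto
      moreover have "(int j)\<^sup>2 \<ge> 0" by simp
      ultimately show "a\<^sup>2 + b\<^sup>2 + c\<^sup>2 + d\<^sup>2 - (int N + 2) * (\<bar>a\<bar> + \<bar>b\<bar> + \<bar>c\<bar> + \<bar>d\<bar>) - (int N + 2)
          \<le> (case x of (k, j) \<Rightarrow> ((int k)\<^sup>2 - 2 * al * int k - al) + 2 * (int j)\<^sup>2 + - int N * int (k + j))"
        unfolding x prod.case by (elim disjE) (simp_all add: algebra_simps)
    qed
  qed
  have "((\<lambda>(k, j). P k j) has_sum T) UNIV"
  proof (rule has_sum_iterated_rev[OF P_summable])
    fix k
    have "((\<lambda>j. y powi ((int k)\<^sup>2 - 2 * al * int k - al) * theta_class y (int k + al) / qpoch t t k *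
       (q ^ j\<^sup>2 * w (k + j) / qpoch t t j)) has_sum
       y powi ((int k)\<^sup>2 - 2 * al * int k - al) * theta_class y (int k + al) / qpoch t t k * V k) UNIV"
      by (intro has_sum_cmult_right V)
    thus "(P k has_sum y powi ((int k)\<^sup>2 - 2 * al * int k - al) * theta_class y (int k + al) * V k / qpoch t t k) UNIV"
      by (simp add: P_def[abs_def] mult_ac)
  qed (fact T)
  from has_sum_divide_const[OF has_sum_antidiagonal[OF this], of "qpoch_inf t t"]
  have PT: "((\<lambda>M. (\<Sum>k\<le>M. P k (M - k)) / qpoch_inf t t) has_sum T / qpoch_inf t t) UNIV" .
  define H where "H = (\<lambda>M n1 n2. q powi (2 * (int n1)\<^sup>2 + 2 * (int n2)\<^sup>2 - 2 * int n1 * int n2 + 2 * al * (int n1 - int n2)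
              - 2 * int M * int n2 + (int M)\<^sup>2) * w M / (qpoch t t n1 * qpoch t t n2 * qpoch t t M))"
  have H_summable: "(\<lambda>(M, n1, n2). H M n1 n2) summable_on UNIV"
  proof -
    define r where "r = norm q"
    have r: "0 < r" "r < 1" using q by (auto simp: r_def)
    obtain N where N: "\<And>M. B ^ M \<le> r powi (- int N * int M)"
      using power_le_powi_neg[OF r w(1)] by metis
    define E where "E = (\<lambda>M n1 n2. 2 * (int n1)\<^sup>2 + 2 * (int n2)\<^sup>2 - 2 * int n1 * int n2 + 2 * al * (int n1 - int n2)
              - 2 * int M * int n2 + (int M)\<^sup>2)"
    show ?thesis
    proof (rule summable_quadratic_exponent[OF r,
        where g = "\<lambda>(M, n1, n2). (int n1, int n1 - int n2, int n2 - int M, 0)" and C = "C * C * C * D" and N = "int N + 2"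
          and E = "\<lambda>(M, n1, n2). E M n1 n2 + - int N * int M"])
      show "inj (\<lambda>(M, n1, n2). (int n1, int n1 - int n2, int n2 - int M, 0::int))" by (auto simp: inj_on_def)
      show "0 \<le> C * C * C * D" "0 \<le> int N + 2" using C w by auto
      fix x :: "nat \<times> nat \<times> nat"
      obtain M n1 n2 where x: "x = (M, n1, n2)" by (cases x) auto
      have "norm (H M n1 n2) = norm (1 / qpoch t t n1) * norm (1 / qpoch t t n2) * norm (1 / qpoch t t M) *
          norm (w M) * norm (q powi E M n1 n2)"
        by (simp add: H_def E_def norm_mult norm_divide)
      also have "\<dots> \<le> C * C * C * (D * r powi (- int N * int M)) * norm (q powi E M n1 n2)"
        using C w(2) N[of M]
        by (intro mult_right_mono mult_mono order_trans[OF w(3)] mult_left_mono) (auto simp: r_def)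
      also have "\<dots> = C * C * C * D * (r powi E M n1 n2 * r powi (- int N * int M))"
        by (simp add: norm_power_int r_def mult_ac)
      also have "r powi E M n1 n2 * r powi (- int N * int M) = r powi (E M n1 n2 + - int N * int M)"
        by (simp only: power_int_add[OF disjI1[OF less_imp_neq[OF r(1), symmetric]]])
      finally show "norm (case x of (M, n1, n2) \<Rightarrow> H M n1 n2) \<le> C * C * C * D *
          r powi (case x of (M, n1, n2) \<Rightarrow> E M n1 n2 + - int N * int M)"
        by (simp add: x)
      fix a b c d :: int
      assume "(case x of (M, n1, n2) \<Rightarrow> (int n1, int n1 - int n2, int n2 - int M, 0)) = (a, b, c, d)"
      hence abc: "int n1 = a" "int n2 = a - b" "int M = a - b - c" "d = 0" by (auto simp: x)
      define u v z where "u = int N * (a - b - c)" and "v = int N * (\<bar>a\<bar> + \<bar>b\<bar> + \<bar>c\<bar>)" and "z = 2 * al * b"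
      have 1: "E M n1 n2 = a\<^sup>2 + b\<^sup>2 + c\<^sup>2 + z"
        unfolding E_def abc z_def by (simp add: power2_eq_square algebra_simps)
      have 2: "u \<le> v" unfolding u_def v_def by (intro mult_left_mono) auto
      have 3: "z \<ge> - 2 * \<bar>b\<bar>" using al by (auto simp: z_def)
      have 4: "(int N + 2) * (\<bar>a\<bar> + \<bar>b\<bar> + \<bar>c\<bar> + \<bar>d\<bar>) = v + 2 * (\<bar>a\<bar> + \<bar>b\<bar> + \<bar>c\<bar>)"
        by (simp add: abc(4) v_def algebra_simps)
      have 5: "- int N * int M = - u" by (simp add: abc(3) u_def)
      have "a\<^sup>2 + b\<^sup>2 + c\<^sup>2 + d\<^sup>2 - (v + 2 * (\<bar>a\<bar> + \<bar>b\<bar> + \<bar>c\<bar>)) - (int N + 2) \<le> (a\<^sup>2 + b\<^sup>2 + c\<^sup>2 + z) + - u"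
        using 2 3 abc(4) by simp
      thus "a\<^sup>2 + b\<^sup>2 + c\<^sup>2 + d\<^sup>2 - (int N + 2) * (\<bar>a\<bar> + \<bar>b\<bar> + \<bar>c\<bar> + \<bar>d\<bar>) - (int N + 2)
          \<le> (case x of (M, n1, n2) \<Rightarrow> E M n1 n2 + - int N * int M)"
        unfolding x prod.case 1 4 5 .
    qed
  qed
  have "((\<lambda>(M, p). (\<lambda>(n1, n2). H M n1 n2) p) has_sum T / qpoch_inf t t) UNIV"
  proof (rule has_sum_iterated_rev)
    show "(\<lambda>(M, p). (\<lambda>(n1, n2). H M n1 n2) p) summable_on UNIV"
      using H_summable by (simp add: case_prod_unfold)
    fix M
    define c where "c = q powi ((int M)\<^sup>2) * w M / qpoch t t M"
    have "((\<lambda>(n1, n2). H M n1 n2) has_sum c *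
       ((\<Sum>k\<le>M. y powi ((int k)\<^sup>2 + 2 * int k - 2 * al * int k - al) * theta_class y (int k + al) *
              (t ^ (k choose 2) * t powi (- int M * int k) * qpoch t t M / qpoch t t (M - k)) / qpoch t t k) / qpoch_inf t t)) UNIV"
    proof (rule has_sum_cong[THEN iffD1, rotated, OF has_sum_cmult_right[OF has_sum_pair[OF y qy tq al, of M]]])
      fix p :: "nat \<times> nat"
      obtain n1 n2 where p: "p = (n1, n2)" by (cases p)
      show "c * (case p of (n1, n2) \<Rightarrow> q powi (2 * (int n1)\<^sup>2 + 2 * (int n2)\<^sup>2 - 2 * int n1 * int n2 + 2 * al * (int n1 - int n2)
              - 2 * int M * int n2) / (qpoch t t n1 * qpoch t t n2)) = (case p of (n1, n2) \<Rightarrow> H M n1 n2)"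
        unfolding p prod.case H_def c_def power_int_add[OF disjI1[OF q(2)], of _ "(int M)\<^sup>2"] by (simp add: mult_ac)
    qed
    also have "c * ((\<Sum>k\<le>M. y powi ((int k)\<^sup>2 + 2 * int k - 2 * al * int k - al) * theta_class y (int k + al) *
              (t ^ (k choose 2) * t powi (- int M * int k) * qpoch t t M / qpoch t t (M - k)) / qpoch t t k) / qpoch_inf t t) =
          (\<Sum>k\<le>M. P k (M - k)) / qpoch_inf t t"
    proof -
      have "(\<Sum>k\<le>M. P k (M - k)) = (\<Sum>k\<le>M. c * (y powi ((int k)\<^sup>2 + 2 * int k - 2 * al * int k - al) * theta_class y (int k + al) *
              (t ^ (k choose 2) * t powi (- int M * int k) * qpoch t t M / qpoch t t (M - k)) / qpoch t t k))"
      proof (intro sum.cong refl)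
      fix k assume "k \<in> {..M}"
      then obtain j where M: "M = k + j" by (metis atMost_iff le_Suc_ex)
      define Y where "Y = (int k)\<^sup>2 - 2 * al * int k - al"
      have "(int k)\<^sup>2 + 2 * int k - 2 * al * int k - al = Y + 2 * int k" by (simp add: Y_def)
      hence e1: "y powi ((int k)\<^sup>2 + 2 * int k - 2 * al * int k - al) = y powi Y * q powi (int k)"
        using y(2) unfolding qy powi_double[OF y(2)] by (simp only: power_int_add[OF disjI1[OF y(2)]])
      have e2: "t ^ (k choose 2) = q powi (int k * (int k - 1))"
        unfolding tq by (rule powi_choose_two[OF q(2)])
      have e3: "t powi (- int M * int k) = q powi (2 * (- int M * int k))"
        unfolding tq by (rule powi_double[OF q(2)])
      have "q powi ((int M)\<^sup>2) * q powi (int k) * (q powi (int k * (int k - 1)) * q powi (2 * (- int M * int k))) =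
         q powi ((int M)\<^sup>2 + int k + (int k * (int k - 1) + 2 * (- int M * int k)))"
        by (simp only: power_int_add[OF disjI1[OF q(2)]])
      also have "(int M)\<^sup>2 + int k + (int k * (int k - 1) + 2 * (- int M * int k)) = int (j\<^sup>2)"
        by (simp add: M power2_eq_square algebra_simps)
      also have "q powi int (j\<^sup>2) = q ^ j\<^sup>2" by (rule power_int_of_nat)
      finally have e4: "q ^ j\<^sup>2 = q powi ((int M)\<^sup>2) * q powi (int k) * (q powi (int k * (int k - 1)) * q powi (2 * (- int M * int k)))" ..
      have "M - k = j" by (simp add: M)
      show "P k (M - k) = c * (y powi ((int k)\<^sup>2 + 2 * int k - 2 * al * int k - al) * theta_class y (int k + al) *
              (t ^ (k choose 2) * t powi (- int M * int k) * qpoch t t M / qpoch t t (M - k)) / qpoch t t k)"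
        unfolding P_def Y_def[symmetric] e1 e2 e3 \<open>M - k = j\<close> e4 M[symmetric] c_def using t(1)
        by (simp add: mult_ac)
      qed
      thus ?thesis unfolding sum_distrib_left[symmetric] by (simp only: times_divide_eq_right)
    qed
    finally show "((\<lambda>(n1, n2). H M n1 n2) has_sum (\<Sum>k\<le>M. P k (M - k)) / qpoch_inf t t) UNIV" .
  qed (fact PT)
  thus ?thesis by (simp add: H_def case_prod_unfold)
qed

text \<open>The sum over k in the preceding theorem is assembled from its even and odd parts, which carry different theta series.\<close>

lemma has_sum_merge:
  fixes f :: "nat \<Rightarrow> complex"
  assumes "((\<lambda>i. f (2 * i)) has_sum A) UNIV" "((\<lambda>i. f (2 * i + 1)) has_sum B) UNIV"
  shows "(f has_sum (A + B)) UNIV"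
proof -
  have "(f has_sum A) (range (\<lambda>i. 2 * i))"
    using assms(1) by (subst has_sum_reindex) (auto simp: o_def inj_on_def)
  moreover have "(f has_sum B) (range (\<lambda>i. 2 * i + 1))"
    by (subst has_sum_reindex) (use assms(2) in \<open>auto simp: o_def inj_on_def\<close>)
  moreover have "range (\<lambda>i::nat. 2 * i) \<inter> range (\<lambda>i. 2 * i + 1) = {}"
    by (auto, presburger)
  moreover have "range (\<lambda>i::nat. 2 * i) \<union> range (\<lambda>i. 2 * i + 1) = UNIV"
  proof -
    have "k \<in> range (\<lambda>i::nat. 2 * i) \<union> range (\<lambda>i. 2 * i + 1)" for k
      by (cases "even k") (auto elim!: evenE oddE)
    thus ?thesis by blast
  qed
  ultimately show ?thesis by (metis has_sum_Un_disjoint)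
qed

text \<open>The exponent that remains after the last variable has been summed out. The summation index of the third variable comes first.\<close>

abbreviation nahm_exponent :: "nat \<Rightarrow> nat \<Rightarrow> nat \<Rightarrow> int" where
  "nahm_exponent M n1 n2 \<equiv> 2 * (int n1)\<^sup>2 + 2 * (int n2)\<^sup>2 - 2 * int n1 * int n2 - 2 * int M * int n2 + (int M)\<^sup>2"

text \<open>The linear term comes from the arguments x1 = q^2 and x2 = q^(-2).\<close>

abbreviation nahm_exponent_shifted :: "nat \<Rightarrow> nat \<Rightarrow> nat \<Rightarrow> int" where
  "nahm_exponent_shifted M n1 n2 \<equiv> 2 * (int n1)\<^sup>2 + 2 * (int n2)\<^sup>2 - 2 * int n1 * int n2 + 2 * (int n1 - int n2)
     - 2 * int M * int n2 + (int M)\<^sup>2"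

corollary rank_reduction_0:
  fixes q t :: complex and w V :: "nat \<Rightarrow> complex"
  assumes q: "norm q < 1" "q \<noteq> 0" and tq: "t = q\<^sup>2"
  assumes w: "B \<ge> 0" "D \<ge> 0" "\<And>M. norm (w M) \<le> D * B ^ M"
  assumes V: "\<And>k. ((\<lambda>j. q ^ j\<^sup>2 * w (k + j) / qpoch t t j) has_sum V k) UNIV"
  assumes Ev: "((\<lambda>i. q ^ (2 * i\<^sup>2) * V (2 * i) / qpoch t t (2 * i)) has_sum Ev) UNIV"
  assumes Od: "((\<lambda>i. q ^ (2 * i\<^sup>2 + 2 * i) * V (2 * i + 1) / qpoch t t (2 * i + 1)) has_sum Od) UNIV"
  shows "((\<lambda>(M, n1, n2). q powi (nahm_exponent M n1 n2) * w M / (qpoch t t n1 * qpoch t t n2 * qpoch t t M)) has_sum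
            (qsum 2 0 q * Ev + q * qsum 2 2 q * Od) / qpoch_inf t t) UNIV"
proof -
  define y where "y = csqrt q"
  have y2: "q = y\<^sup>2" by (simp add: y_def)
  have y: "norm y < 1" "y \<noteq> 0"
    using q by (auto simp: y_def norm_csqrt)
  define f where "f = (\<lambda>k. y powi ((int k)\<^sup>2 - 2 * 0 * int k - 0) * theta_class y (int k + 0) * V k / qpoch t t k)"
  have "((\<lambda>i. f (2 * i)) has_sum qsum 2 0 q * Ev) UNIV"
  proof (rule has_sum_cong[THEN iffD1, rotated, OF has_sum_cmult_right[OF Ev]])
    fix i
    have "y powi ((int (2 * i))\<^sup>2 - 2 * 0 * int (2 * i) - 0) = y ^ (2 * (2 * i\<^sup>2))"
      by (rule power_int_eq_power) (simp add: power2_eq_square)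
    hence "y powi ((int (2 * i))\<^sup>2 - 2 * 0 * int (2 * i) - 0) = q ^ (2 * i\<^sup>2)"
      by (simp only: power_mult y2)
    moreover have "theta_class y (int (2 * i) + 0) = qsum 2 0 q"
      using theta_class_shift[of y 0 "int i"] theta_class_eq(1)[OF y(2)] by (simp add: y2)
    ultimately show "qsum 2 0 q * (q ^ (2 * i\<^sup>2) * V (2 * i) / qpoch t t (2 * i)) = f (2 * i)"
      by (simp only: f_def mult_ac times_divide_eq_right)
  qed
  moreover have "((\<lambda>i. f (2 * i + 1)) has_sum q * qsum 2 2 q * Od) UNIV"
  proof (rule has_sum_cong[THEN iffD1, rotated, OF has_sum_cmult_right[OF Od]])
    fix i
    have "y powi ((int (2 * i + 1))\<^sup>2 - 2 * 0 * int (2 * i + 1) - 0) = y ^ (2 * (2 * i\<^sup>2 + 2 * i) + 1)"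
      by (rule power_int_eq_power) (simp add: power2_eq_square algebra_simps)
    hence "y powi ((int (2 * i + 1))\<^sup>2 - 2 * 0 * int (2 * i + 1) - 0) = q ^ (2 * i\<^sup>2 + 2 * i) * y"
      by (simp only: power_add power_mult y2 power_one_right)
    moreover have "theta_class y (int (2 * i + 1) + 0) = y * qsum 2 2 q"
      using theta_class_shift[of y 1 "int i"] theta_class_eq(2)[OF y(2)] by (simp add: y2 add.commute)
    moreover have "q = y * y" by (simp add: y2 power2_eq_square)
    ultimately show "q * qsum 2 2 q * (q ^ (2 * i\<^sup>2 + 2 * i) * V (2 * i + 1) / qpoch t t (2 * i + 1)) = f (2 * i + 1)"
      by (simp add: f_def mult_ac)
  qed
  ultimately have "(f has_sum qsum 2 0 q * Ev + q * qsum 2 2 q * Od) UNIV"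
    by (rule has_sum_merge)
  from rank_reduction[OF y y2 tq _ w V this[unfolded f_def]] show ?thesis by simp
qed

corollary rank_reduction_1:
  fixes q t :: complex and w V :: "nat \<Rightarrow> complex"
  assumes q: "norm q < 1" "q \<noteq> 0" and tq: "t = q\<^sup>2"
  assumes w: "B \<ge> 0" "D \<ge> 0" "\<And>M. norm (w M) \<le> D * B ^ M"
  assumes V: "\<And>k. ((\<lambda>j. q ^ j\<^sup>2 * w (k + j) / qpoch t t j) has_sum V k) UNIV"
  assumes Ev: "((\<lambda>i. q ^ (4 * (i choose 2)) * V (2 * i) / qpoch t t (2 * i)) has_sum Ev) UNIV"
  assumes Od: "((\<lambda>i. q ^ (2 * i\<^sup>2) * V (2 * i + 1) / qpoch t t (2 * i + 1)) has_sum Od) UNIV"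
  shows "((\<lambda>(M, n1, n2). q powi (nahm_exponent_shifted M n1 n2) * w M / (qpoch t t n1 * qpoch t t n2 * qpoch t t M)) has_sum
            (qsum 2 2 q * Ev + qsum 2 0 q / q * Od) / qpoch_inf t t) UNIV"
proof -
  define y where "y = csqrt q"
  have y2: "q = y\<^sup>2" by (simp add: y_def)
  have y: "norm y < 1" "y \<noteq> 0"
    using q by (auto simp: y_def norm_csqrt)
  have qyy: "q = y * y" by (simp add: y2 power2_eq_square)
  define f where "f = (\<lambda>k. y powi ((int k)\<^sup>2 - 2 * 1 * int k - 1) * theta_class y (int k + 1) * V k / qpoch t t k)"
  have "((\<lambda>i. f (2 * i)) has_sum qsum 2 2 q * Ev) UNIV"
  proof (rule has_sum_cong[THEN iffD1, rotated, OF has_sum_cmult_right[OF Ev]])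
    fix i
    have "y powi ((int (2 * i))\<^sup>2 - 2 * 1 * int (2 * i) - 1) * y powi 1 = y powi (int (2 * (4 * (i choose 2))))"
      using choose_two_int[of i] by (intro powi_mult_eq[OF y(2)]) (simp add: power2_eq_square algebra_simps)
    hence e: "y powi ((int (2 * i))\<^sup>2 - 2 * 1 * int (2 * i) - 1) * y = q ^ (4 * (i choose 2))"
      by (simp only: power_int_of_nat power_mult y2 power_int_1_right)
    have "theta_class y (int (2 * i) + 1) = y * qsum 2 2 q"
      using theta_class_shift[of y 1 "int i"] theta_class_eq(2)[OF y(2)] by (simp add: y2 add.commute)
    hence "f (2 * i) = (y powi ((int (2 * i))\<^sup>2 - 2 * 1 * int (2 * i) - 1) * y) * qsum 2 2 q * V (2 * i) / qpoch t t (2 * i)"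
      by (simp only: f_def mult.assoc)
    thus "qsum 2 2 q * (q ^ (4 * (i choose 2)) * V (2 * i) / qpoch t t (2 * i)) = f (2 * i)"
      unfolding e by simp
  qed
  moreover have "((\<lambda>i. f (2 * i + 1)) has_sum qsum 2 0 q / q * Od) UNIV"
  proof (rule has_sum_cong[THEN iffD1, rotated, OF has_sum_cmult_right[OF Od]])
    fix i
    have "y powi ((int (2 * i + 1))\<^sup>2 - 2 * 1 * int (2 * i + 1) - 1) * y powi 2 = y powi (int (2 * (2 * i\<^sup>2)))"
      by (intro powi_mult_eq[OF y(2)]) (simp add: power2_eq_square algebra_simps)
    hence "y powi ((int (2 * i + 1))\<^sup>2 - 2 * 1 * int (2 * i + 1) - 1) * y\<^sup>2 = y ^ (2 * (2 * i\<^sup>2))"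
      by (simp only: power_int_of_nat power_int_numeral)
    hence "y powi ((int (2 * i + 1))\<^sup>2 - 2 * 1 * int (2 * i + 1) - 1) * q = q ^ (2 * i\<^sup>2)"
      by (simp only: power_mult y2)
    hence "y powi ((int (2 * i + 1))\<^sup>2 - 2 * 1 * int (2 * i + 1) - 1) = q ^ (2 * i\<^sup>2) / q"
      using q(2) by (simp add: eq_divide_eq)
    moreover have "theta_class y (int (2 * i + 1) + 1) = qsum 2 0 q"
      using theta_class_shift[of y 0 "int i + 1"] theta_class_eq(1)[OF y(2)] by (simp add: y2 algebra_simps)
    ultimately show "qsum 2 0 q / q * (q ^ (2 * i\<^sup>2) * V (2 * i + 1) / qpoch t t (2 * i + 1)) = f (2 * i + 1)"
      by (simp only: f_def mult_ac times_divide_eq_right times_divide_eq_left)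
  qed
  ultimately have "(f has_sum qsum 2 2 q * Ev + qsum 2 0 q / q * Od) UNIV"
    by (rule has_sum_merge)
  from rank_reduction[OF y y2 tq _ w V this[unfolded f_def]] show ?thesis by simp
qed

section \<open>Summing out the last variable\<close>

lemma tadpole_form_4:
  "tadpole_form [a, b, c, d] = 2 * (int a)\<^sup>2 + 2 * (int b)\<^sup>2 - 2 * int a * int b - 2 * int c * int b + 2 * (int c)\<^sup>2
     + ((int d)\<^sup>2 - 2 * int c * int d)"
  by (simp add: tadpole_form_def tadpole_def eval_nat_numeral algebra_simps)

text \<open>The order of the factors is reversed and the leading power of q is taken out of each of them.\<close>

lemma qpoch_reflect:
  fixes q x :: complex
  assumes "q \<noteq> 0" "x \<noteq> 0"
  shows "qpoch (-(x * q powi (1 - 2 * int N))) (q\<^sup>2) N = x ^ N * q powi (- (int N)\<^sup>2) * qpoch (-(q / x)) (q\<^sup>2) N"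
proof (induction N)
  case (Suc N)
  have e: "q powi (1 - 2 * int (Suc N)) * q\<^sup>2 = q powi (1 - 2 * int N)"
    using powi_mult_eq[OF assms(1), of "1 - 2 * int (Suc N)" 2 "1 - 2 * int N"] by simp
  have f: "q powi (1 - 2 * int (Suc N)) * (q * (q\<^sup>2) ^ N) = 1"
  proof -
    have "q powi (1 - 2 * int (Suc N)) * q powi (int (1 + 2 * N)) = q powi 0"
      by (rule powi_mult_eq[OF assms(1)]) simp
    moreover have "q powi (int (1 + 2 * N)) = q * (q\<^sup>2) ^ N"
      by (simp only: power_int_of_nat power_add power_mult power_one_right)
    ultimately show ?thesis by simp
  qed
  have g: "1 + x * q powi (1 - 2 * int (Suc N)) = x * q powi (1 - 2 * int (Suc N)) * (1 + q / x * (q\<^sup>2) ^ N)"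
  proof -
    have "x * q powi (1 - 2 * int (Suc N)) * (1 + q / x * (q\<^sup>2) ^ N) =
        x * q powi (1 - 2 * int (Suc N)) + q powi (1 - 2 * int (Suc N)) * (q * (q\<^sup>2) ^ N)"
      using assms by (simp add: field_simps)
    thus ?thesis unfolding f by simp
  qed
  have h: "q powi (1 - 2 * int (Suc N)) * q powi (- (int N)\<^sup>2) = q powi (- (int (Suc N))\<^sup>2)"
    by (rule powi_mult_eq[OF assms(1)]) (simp add: power2_eq_square algebra_simps)
  have "qpoch (-(x * q powi (1 - 2 * int (Suc N)))) (q\<^sup>2) (Suc N) =
      (1 + x * q powi (1 - 2 * int (Suc N))) * qpoch (-(x * (q powi (1 - 2 * int (Suc N)) * q\<^sup>2))) (q\<^sup>2) N"
    unfolding qpoch_Suc_left by (simp add: mult.assoc)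
  also have "\<dots> = x * (q powi (1 - 2 * int (Suc N)) * q powi (- (int N)\<^sup>2)) * (1 + q / x * (q\<^sup>2) ^ N) *
      (x ^ N * qpoch (-(q / x)) (q\<^sup>2) N)"
    unfolding e g Suc.IH by (simp only: mult_ac)
  also have "\<dots> = x ^ Suc N * q powi (- (int (Suc N))\<^sup>2) * qpoch (-(q / x)) (q\<^sup>2) (Suc N)"
    unfolding h by (simp add: qpoch_Suc mult_ac)
  finally show ?case .
qed auto

text \<open>Euler's series at -x q^(1 - 2N). The first N factors of the resulting product are reflected to (-q/x)_N, the others no longer depend on N.\<close>

lemma has_sum_euler_shifted:
  fixes q x :: complex
  assumes q: "norm q < 1" "q \<noteq> 0" and x: "x \<noteq> 0"
  shows "((\<lambda>d. q powi ((int d)\<^sup>2 - 2 * int N * int d) * x ^ d / qpoch (q\<^sup>2) (q\<^sup>2) d) has_sum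
            x ^ N * q powi (- (int N)\<^sup>2) * qpoch (-(q / x)) (q\<^sup>2) N * qpoch_inf (-(x * q)) (q\<^sup>2)) UNIV"
proof -
  have t: "norm (q\<^sup>2) < 1" using q by (simp add: norm_power_less_1)
  define z where "z = x * q powi (1 - 2 * int N)"
  have "((\<lambda>d. (q\<^sup>2) ^ (d choose 2) * (-(-z)) ^ d / qpoch (q\<^sup>2) (q\<^sup>2) d) has_sum qpoch_inf (-z) (q\<^sup>2)) UNIV"
    by (rule has_sum_euler[OF t])
  moreover have "(q\<^sup>2) ^ (d choose 2) * (-(-z)) ^ d = q powi ((int d)\<^sup>2 - 2 * int N * int d) * x ^ d" for d
  proof -
    have "(q powi (1 - 2 * int N)) ^ d = q powi ((1 - 2 * int N) * int d)"
      by (metis power_int_mult power_int_of_nat)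
    moreover have "q powi (int d * (int d - 1)) * q powi ((1 - 2 * int N) * int d) = q powi ((int d)\<^sup>2 - 2 * int N * int d)"
      by (rule powi_mult_eq[OF q(2)]) (simp add: power2_eq_square algebra_simps)
    ultimately show ?thesis
      by (simp add: z_def power_mult_distrib powi_choose_two[OF q(2)] mult_ac)
  qed
  moreover have "qpoch_inf (-z) (q\<^sup>2) = x ^ N * q powi (- (int N)\<^sup>2) * qpoch (-(q / x)) (q\<^sup>2) N * qpoch_inf (-(x * q)) (q\<^sup>2)"
  proof -
    have "q powi (1 - 2 * int N) * q powi (int (2 * N)) = q powi 1"
      by (rule powi_mult_eq[OF q(2)]) simp
    moreover have "q powi int (2 * N) = (q\<^sup>2) ^ N" by (simp only: power_int_of_nat power_mult)
    ultimately have *: "q powi (1 - 2 * int N) * (q\<^sup>2) ^ N = q" by (simp only: power_int_1_right)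
    have "- z * (q\<^sup>2) ^ N = -(x * (q powi (1 - 2 * int N) * (q\<^sup>2) ^ N))"
      by (simp only: z_def mult_minus_left mult.assoc)
    hence zN: "- z * (q\<^sup>2) ^ N = -(x * q)" unfolding * .
    show ?thesis
      unfolding qpoch_inf_shift[OF t, of "-z" N] zN
      using qpoch_reflect[OF q(2) x, of N] by (simp add: z_def)
  qed
  ultimately show ?thesis by simp
qed

lemma bij_betw_list4:
  "bij_betw (\<lambda>((N, a, b), d). [a, b, N, d]) UNIV {n :: nat list. length n = 4}"
  by (rule bij_betwI[of _ _ _ "\<lambda>n. ((n ! 2, n ! 0, n ! 1), n ! 3)"])
     (auto simp: eval_nat_numeral length_Suc_conv)

text \<open>The last index is coupled to the third one only, by -2 N d in the exponent. Its sum is the shifted Euler series; the factor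
x4^N q^(-N^2) that it produces changes q^(2 N^2) x3^N into q^(N^2) (x3 x4)^N.\<close>

theorem chi_reduction:
  fixes q x1 x2 x3 x4 :: complex
  assumes q: "norm q < 1" "q \<noteq> 0" and tq: "t = q\<^sup>2" and x4: "x4 \<noteq> 0"
  assumes T: "((\<lambda>(N, n1, n2). q powi (nahm_exponent N n1 n2) *
     (x1 ^ n1 * x2 ^ n2 * (x3 * x4) ^ N) * qpoch (-(q / x4)) t N / (qpoch t t n1 * qpoch t t n2 * qpoch t t N)) has_sum T) UNIV"
  shows "chi_sq [x1, x2, x3, x4] q = qpoch_inf (-(x4 * q)) t * T"
proof -
  have t: "norm t < 1" "t \<noteq> 0" using q by (auto simp: tq norm_power_less_1)
  obtain C where C: "C \<ge> 1" "\<And>n. norm (1 / qpoch t t n) \<le> C"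
    using inverse_qpoch_bounded[OF t(1) self_mult_power_neq_1[OF t(1)]] by metis
  define f where "f = (\<lambda>((N, a, b), d). q powi tadpole_form [a, b, N, d] * (x1 ^ a * x2 ^ b * x3 ^ N * x4 ^ d) /
     (qpoch t t a * qpoch t t b * qpoch t t N * qpoch t t d))"
  have chi: "chi_sq [x1, x2, x3, x4] q = infsum f UNIV"
  proof -
    have "chi_sq [x1, x2, x3, x4] q = (\<Sum>\<^sub>\<infinity>n\<in>{n :: nat list. length n = 4}.
        q powi tadpole_form n * (x1 ^ (n ! 0) * x2 ^ (n ! 1) * x3 ^ (n ! 2) * x4 ^ (n ! 3)) /
        (qpoch t t (n ! 0) * qpoch t t (n ! 1) * qpoch t t (n ! 2) * qpoch t t (n ! 3)))"
      by (simp add: chi_sq_def tq eval_nat_numeral mult.assoc)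
    also have "\<dots> = infsum f UNIV"
      unfolding f_def by (subst infsum_reindex_bij_betw[OF bij_betw_list4, symmetric]) (simp add: case_prod_unfold)
    finally show ?thesis .
  qed
  have summable: "f summable_on UNIV"
  proof -
    define r where "r = norm q"
    have r: "0 < r" "r < 1" using q by (auto simp: r_def)
    define B where "B = Max {1, norm x1, norm x2, norm x3, norm x4}"
    have B: "B \<ge> 1" "norm x1 \<le> B" "norm x2 \<le> B" "norm x3 \<le> B" "norm x4 \<le> B"
      by (auto simp: B_def intro: Max_ge)
    have B0: "B \<ge> 0" using B(1) by linarith
    obtain N0 where N0: "\<And>M. B ^ M \<le> r powi (- int N0 * int M)"
      using power_le_powi_neg[OF r B0] by metis
    define E where "E = (\<lambda>((N, a, b), d). tadpole_form [a, b, N, d] + - int N0 * int (a + b + N + d))"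
    show ?thesis
    proof (rule summable_quadratic_exponent[OF r,
        where g = "\<lambda>((N, a, b), d). (int a, int a - int b, int b - int N, int N - int d)" and C = "C * C * C * C"
          and N = "4 * int N0" and E = E])
      show "inj (\<lambda>((N, a, b), d). (int a, int a - int b, int b - int N, int N - int d))" by (auto simp: inj_on_def)
      show "0 \<le> C * C * C * C" "0 \<le> 4 * int N0" using C by auto
      fix x :: "(nat \<times> nat \<times> nat) \<times> nat"
      obtain N a b d where x: "x = ((N, a, b), d)" by (cases x) auto
      have "norm (x1 ^ a * x2 ^ b * x3 ^ N * x4 ^ d) \<le> B ^ a * B ^ b * B ^ N * B ^ d"
        unfolding norm_mult norm_power using B B0
        by (intro mult_mono power_mono mult_nonneg_nonneg zero_le_power) auto
      also have "\<dots> = B ^ (a + b + N + d)" by (simp add: power_add)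
      also have "\<dots> \<le> r powi (- int N0 * int (a + b + N + d))" by (rule N0)
      finally have 1: "norm (x1 ^ a * x2 ^ b * x3 ^ N * x4 ^ d) \<le> r powi (- int N0 * int (a + b + N + d))" .
      have "norm (f x) = norm (1 / qpoch t t a) * norm (1 / qpoch t t b) * norm (1 / qpoch t t N) * norm (1 / qpoch t t d) *
          (norm (q powi tadpole_form [a, b, N, d]) * norm (x1 ^ a * x2 ^ b * x3 ^ N * x4 ^ d))"
        by (simp add: x f_def norm_mult norm_divide)
      also have "\<dots> \<le> C * C * C * C * (r powi tadpole_form [a, b, N, d] * r powi (- int N0 * int (a + b + N + d)))"
        using C r by (intro mult_mono C(2) 1 mult_nonneg_nonneg) (auto simp: norm_power_int r_def)
      also have "r powi tadpole_form [a, b, N, d] * r powi (- int N0 * int (a + b + N + d)) = r powi E x"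
        unfolding x E_def prod.case
        by (simp only: power_int_add[OF disjI1[OF less_imp_neq[OF r(1), symmetric]]])
      finally show "norm (f x) \<le> C * C * C * C * r powi E x" .
      fix a' b' c' d' :: int
      assume "(\<lambda>((N, a, b), d). (int a, int a - int b, int b - int N, int N - int d)) x = (a', b', c', d')"
      hence e: "int a = a'" "int b = a' - b'" "int N = a' - b' - c'" "int d = a' - b' - c' - d'" by (auto simp: x)
      define u v where "u = int N0 * (a' + (a' - b') + (a' - b' - c') + (a' - b' - c' - d'))"
        and "v = int N0 * (4 * (\<bar>a'\<bar> + \<bar>b'\<bar> + \<bar>c'\<bar> + \<bar>d'\<bar>))"
      have "u \<le> v" unfolding u_def v_def by (intro mult_left_mono) auto
      moreover have "E x = a'\<^sup>2 + b'\<^sup>2 + c'\<^sup>2 + d'\<^sup>2 - u"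
        unfolding x E_def prod.case tadpole_form_4 of_nat_add e u_def by (simp add: power2_eq_square algebra_simps)
      moreover have "4 * int N0 * (\<bar>a'\<bar> + \<bar>b'\<bar> + \<bar>c'\<bar> + \<bar>d'\<bar>) = v" by (simp add: v_def)
      ultimately show "a'\<^sup>2 + b'\<^sup>2 + c'\<^sup>2 + d'\<^sup>2 - 4 * int N0 * (\<bar>a'\<bar> + \<bar>b'\<bar> + \<bar>c'\<bar> + \<bar>d'\<bar>) - 4 * int N0 \<le> E x"
        by simp
    qed
  qed
  define K where "K = (\<lambda>(N, n1, n2). q powi (nahm_exponent N n1 n2) *
     (x1 ^ n1 * x2 ^ n2 * (x3 * x4) ^ N) * qpoch (-(q / x4)) t N / (qpoch t t n1 * qpoch t t n2 * qpoch t t N))"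
  have "((\<lambda>(p, d). f (p, d)) has_sum infsum f UNIV) UNIV"
    using has_sum_infsum[OF summable] by simp
  hence "((\<lambda>p. K p * qpoch_inf (-(x4 * q)) t) has_sum infsum f UNIV) UNIV"
  proof (rule has_sum_iterated)
    fix p :: "nat \<times> nat \<times> nat"
    obtain N a b where p: "p = (N, a, b)" by (cases p) auto
    define c where "c = q powi (2 * (int a)\<^sup>2 + 2 * (int b)\<^sup>2 - 2 * int a * int b - 2 * int N * int b + 2 * (int N)\<^sup>2) *
       (x1 ^ a * x2 ^ b * x3 ^ N) / (qpoch t t a * qpoch t t b * qpoch t t N)"
    have "((\<lambda>d. c * (q powi ((int d)\<^sup>2 - 2 * int N * int d) * x4 ^ d / qpoch t t d)) has_sum
        c * (x4 ^ N * q powi (- (int N)\<^sup>2) * qpoch (-(q / x4)) t N * qpoch_inf (-(x4 * q)) t)) UNIV"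
      unfolding tq by (intro has_sum_cmult_right has_sum_euler_shifted q x4)
    moreover have "c * (q powi ((int d)\<^sup>2 - 2 * int N * int d) * x4 ^ d / qpoch t t d) = f (p, d)" for d
    proof -
      have "q powi tadpole_form [a, b, N, d] = q powi (2 * (int a)\<^sup>2 + 2 * (int b)\<^sup>2 - 2 * int a * int b - 2 * int N * int b + 2 * (int N)\<^sup>2) *
          q powi ((int d)\<^sup>2 - 2 * int N * int d)"
        unfolding tadpole_form_4 by (rule power_int_add) (use q in auto)
      thus ?thesis unfolding f_def p prod.case c_def by (simp add: mult_ac)
    qed
    moreover have "c * (x4 ^ N * q powi (- (int N)\<^sup>2) * qpoch (-(q / x4)) t N * qpoch_inf (-(x4 * q)) t) =
        K p * qpoch_inf (-(x4 * q)) t"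
    proof -
      have e: "q powi (2 * (int a)\<^sup>2 + 2 * (int b)\<^sup>2 - 2 * int a * int b - 2 * int N * int b + 2 * (int N)\<^sup>2) * q powi (- (int N)\<^sup>2) =
         q powi (nahm_exponent N a b)"
        by (rule powi_mult_eq[OF q(2)]) simp
      show ?thesis unfolding K_def p prod.case c_def e[symmetric] by (simp add: power_mult_distrib mult_ac)
    qed
    ultimately show "((\<lambda>d. f (p, d)) has_sum K p * qpoch_inf (-(x4 * q)) t) UNIV" by simp
  qed
  moreover have "((\<lambda>p. K p * qpoch_inf (-(x4 * q)) t) has_sum T * qpoch_inf (-(x4 * q)) t) UNIV"
    using T unfolding K_def by (rule has_sum_cmult_left)
  ultimately have "infsum f UNIV = T * qpoch_inf (-(x4 * q)) t" by (rule has_sum_unique)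
  thus ?thesis by (simp add: chi mult.commute)
qed

lemma qsum_scale: "qsum (int k * a) (int k * b) x = qsum a b (x ^ k)"
proof -
  have "int k * a * n\<^sup>2 + int k * b * n = int k * (a * n\<^sup>2 + b * n)" for n
    by (simp add: algebra_simps)
  hence "x powi (int k * a * n\<^sup>2 + int k * b * n) = (x ^ k) powi (a * n\<^sup>2 + b * n)" for n
    by (metis power_int_mult power_int_of_nat)
  thus ?thesis by (simp add: qsum_def)
qed

lemma qsum_reflect:
  assumes "x \<noteq> 0"
  shows "qsum a b x = x powi (a - b) * qsum a (2 * a - b) x"
proof -
  have bij: "bij_betw (\<lambda>n::int. -1 - n) UNIV UNIV"
    by (rule bij_betwI[of _ _ _ "\<lambda>n. -1 - n"]) auto
  have "qsum a b x = (\<Sum>\<^sub>\<infinity>n. x powi (a * (-1 - n)\<^sup>2 + b * (-1 - n)))"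
    unfolding qsum_def by (rule infsum_reindex_bij_betw[OF bij, symmetric])
  also have "(\<lambda>n::int. x powi (a * (-1 - n)\<^sup>2 + b * (-1 - n))) = (\<lambda>n. x powi (a - b) * x powi (a * n\<^sup>2 + (2 * a - b) * n))"
    by (intro ext powi_mult_eq[OF assms, symmetric]) (simp add: power2_eq_square algebra_simps)
  finally show ?thesis by (simp add: qsum_def infsum_cmult_right')
qed

lemma powi_minus_base: "(-x) powi n = (if even n then x powi n else - (x powi n))" for x :: complex
proof -
  have "(-x) powi n = (-1) powi n * x powi n"
    by (subst mult_minus1[symmetric], rule power_int_mult_distrib)
  moreover have "(-1) powi n = (if even n then 1 else -1 :: complex)"
    by (cases "n \<ge> 0") (auto simp: power_int_def even_nat_iff power_inverse)
  ultimately show ?thesis by auto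
qed

text \<open>The exponent a n^2 + b n has the parity of n when a + b is odd, so replacing x by -x separates even and odd n.\<close>

lemma qsum_parity:
  assumes x: "norm x < 1" "x \<noteq> 0" and ab: "a > 0" "odd (a + b)"
  shows "qsum a b x + qsum a b (-x) = 2 * qsum (4 * a) (2 * b) x"
    and "qsum a b x - qsum a b (-x) = 2 * x powi (a + b) * qsum (4 * a) (4 * a + 2 * b) x"
proof -
  have par: "even (a * n\<^sup>2 + b * n) \<longleftrightarrow> even n" for n
    using ab(2) by auto
  have inj: "inj (\<lambda>n::int. 2 * n)" "inj (\<lambda>n::int. 2 * n + 1)" by (auto simp: inj_on_def)
  define f where "f = (\<lambda>n. x powi (a * n\<^sup>2 + b * n))"
  have f: "(f has_sum qsum a b x) UNIV"
    unfolding f_def by (rule has_sum_qsum[OF x ab(1)])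
  have g: "((\<lambda>n. if even n then f n else - f n) has_sum qsum a b (-x)) UNIV"
  proof -
    have "(-x) powi (a * n\<^sup>2 + b * n) = (if even n then f n else - f n)" for n
      by (simp only: powi_minus_base par f_def)
    moreover have "((\<lambda>n. (-x) powi (a * n\<^sup>2 + b * n)) has_sum qsum a b (-x)) UNIV"
      by (rule has_sum_qsum) (use x ab in auto)
    ultimately show ?thesis by simp
  qed
  have "((\<lambda>n. f n + (if even n then f n else - f n)) has_sum (qsum a b x + qsum a b (-x))) UNIV"
    by (intro has_sum_add f g)
  also have "?this \<longleftrightarrow> ((\<lambda>n. 2 * f n) has_sum (qsum a b x + qsum a b (-x))) (range (\<lambda>n. 2 * n))"
  proof (rule has_sum_cong_neutral)
    fix n assume "n \<in> UNIV - range (\<lambda>n::int. 2 * n)"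
    hence "odd n" by (auto elim!: evenE)
    thus "f n + (if even n then f n else - f n) = 0" by simp
  qed auto
  also have "\<dots> \<longleftrightarrow> ((\<lambda>n. 2 * f (2 * n)) has_sum (qsum a b x + qsum a b (-x))) UNIV"
    using inj by (subst has_sum_reindex) (auto simp: o_def)
  also have "(\<lambda>n. 2 * f (2 * n)) = (\<lambda>n. 2 * x powi (4 * a * n\<^sup>2 + 2 * b * n))"
    by (intro ext) (simp add: f_def power2_eq_square algebra_simps)
  finally show "qsum a b x + qsum a b (-x) = 2 * qsum (4 * a) (2 * b) x"
    by (subst infsumI[symmetric]) (auto simp: qsum_def infsum_cmult_right')
  have "((\<lambda>n. f n + - (if even n then f n else - f n)) has_sum (qsum a b x + - qsum a b (-x))) UNIV"
    by (intro has_sum_add has_sum_uminusI f g)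
  also have "?this \<longleftrightarrow> ((\<lambda>n. 2 * f n) has_sum (qsum a b x + - qsum a b (-x))) (range (\<lambda>n. 2 * n + 1))"
  proof (rule has_sum_cong_neutral)
    fix n assume "n \<in> UNIV - range (\<lambda>n::int. 2 * n + 1)"
    hence "even n" by (metis DiffD2 oddE range_eqI)
    thus "f n + - (if even n then f n else - f n) = 0" by simp
  qed auto
  also have "\<dots> \<longleftrightarrow> ((\<lambda>n. 2 * f (2 * n + 1)) has_sum (qsum a b x + - qsum a b (-x))) UNIV"
    using inj by (subst has_sum_reindex) (auto simp: o_def)
  also have "(\<lambda>n. 2 * f (2 * n + 1)) = (\<lambda>n. 2 * x powi (a + b) * x powi (4 * a * n\<^sup>2 + (4 * a + 2 * b) * n))"
  proof
    fix n
    have "x powi (a + b) * x powi (4 * a * n\<^sup>2 + (4 * a + 2 * b) * n) = f (2 * n + 1)"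
      unfolding f_def by (rule powi_mult_eq[OF x(2)]) (simp add: power2_eq_square algebra_simps)
    thus "2 * f (2 * n + 1) = 2 * x powi (a + b) * x powi (4 * a * n\<^sup>2 + (4 * a + 2 * b) * n)" by simp
  qed
  finally have "infsum (\<lambda>n. 2 * x powi (a + b) * x powi (4 * a * n\<^sup>2 + (4 * a + 2 * b) * n)) UNIV = qsum a b x + - qsum a b (-x)"
    by (rule infsumI)
  thus "qsum a b x - qsum a b (-x) = 2 * x powi (a + b) * qsum (4 * a) (4 * a + 2 * b) x"
    unfolding infsum_cmult_right' by (simp add: qsum_def)
qed

section \<open>Rescaled identities and a telescoping relation\<close>

lemma minus_one_power_times_square: "(-1) ^ k * x ^ k\<^sup>2 = (-x) ^ k\<^sup>2" for x :: complex
  by (cases "even k") (auto simp: power_minus[of x "k\<^sup>2"])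

lemma qpoch_inf_neg_mult_self:
  assumes "norm x < 1"
  shows "qpoch_inf x (x\<^sup>2) * qpoch_inf (-x) (x\<^sup>2) * qpoch_inf (x ^ 4) (x ^ 4) = qpoch_inf (x\<^sup>2) (x\<^sup>2)"
proof -
  have r: "norm (x\<^sup>2) < 1" using assms by (simp add: norm_power_less_1)
  have "qpoch_inf (x\<^sup>2) (x\<^sup>2) = qpoch_inf (x\<^sup>2) (x ^ 4) * qpoch_inf (x ^ 4) (x ^ 4)"
    using qpoch_inf_split[OF r, of 2 "x\<^sup>2"] by (simp add: eval_nat_numeral mult.assoc)
  moreover have "qpoch_inf x (x\<^sup>2) * qpoch_inf (-x) (x\<^sup>2) = qpoch_inf (x\<^sup>2) (x ^ 4)"
    using qpoch_inf_neg_mult[OF r, of x] by (simp add: power_mult[symmetric])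
  ultimately show ?thesis by simp
qed

lemma has_sum_slater25':
  assumes x: "norm x < 1" "x \<noteq> 0"
  shows "((\<lambda>k. x ^ k\<^sup>2 * (qpoch_inf x (x\<^sup>2) * qpoch (-x) (x\<^sup>2) k) / qpoch (x ^ 4) (x ^ 4) k) has_sum
           qsum 3 0 (-x) / qpoch_inf (x ^ 4) (x ^ 4)) UNIV"
proof -
  have r: "norm (x\<^sup>2) < 1" "norm (x ^ 4) < 1" using x by (simp_all add: norm_power_less_1)
  have "qpoch_inf x (x\<^sup>2) * (qpoch_inf (-x) (x\<^sup>2) / qpoch_inf (x\<^sup>2) (x\<^sup>2) * qsum 3 0 (-x)) =
      qsum 3 0 (-x) / qpoch_inf (x ^ 4) (x ^ 4)"
    unfolding qpoch_inf_neg_mult_self[OF x(1), symmetric] using x r by simp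
  with has_sum_cmult_right[OF has_sum_slater25[OF x], of "qpoch_inf x (x\<^sup>2)"] show ?thesis
    by (simp add: mult_ac)
qed

lemma has_sum_slater25_companion':
  assumes x: "norm x < 1" "x \<noteq> 0"
  shows "((\<lambda>k. x ^ (k\<^sup>2 + 2 * k) * (qpoch_inf x (x\<^sup>2) * qpoch (-x) (x\<^sup>2) k) / qpoch (x ^ 4) (x ^ 4) k) has_sum
           qsum 3 2 (-x) / qpoch_inf (x ^ 4) (x ^ 4)) UNIV"
proof -
  have r: "norm (x\<^sup>2) < 1" "norm (x ^ 4) < 1" using x by (simp_all add: norm_power_less_1)
  have "qpoch_inf x (x\<^sup>2) * (qpoch_inf (-x) (x\<^sup>2) / qpoch_inf (x\<^sup>2) (x\<^sup>2) * qsum 3 2 (-x)) =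
      qsum 3 2 (-x) / qpoch_inf (x ^ 4) (x ^ 4)"
    unfolding qpoch_inf_neg_mult_self[OF x(1), symmetric] using x r by simp
  with has_sum_cmult_right[OF has_sum_slater25_companion[OF x], of "qpoch_inf x (x\<^sup>2)"] show ?thesis
    by (simp add: mult_ac)
qed

lemma qsum_1_0:
  assumes x: "norm x < 1" "x \<noteq> 0"
  shows "qsum 1 0 x = qpoch_inf (-x) (x\<^sup>2) * qpoch_inf (-x) (x\<^sup>2) * qpoch_inf (x\<^sup>2) (x\<^sup>2)"
  using qsum_product[OF x, of 1 0] by simp

lemma has_sum_gauss_square':
  assumes x: "norm x < 1" "x \<noteq> 0"
  shows "((\<lambda>k. x ^ k\<^sup>2 * (qpoch_inf (-x) (x\<^sup>2) * qpoch x (x\<^sup>2) k) / qpoch (x ^ 4) (x ^ 4) k) has_sum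
           qsum 1 0 x / qpoch_inf (x ^ 4) (x ^ 4)) UNIV"
proof -
  have r: "norm (x\<^sup>2) < 1" "norm (x ^ 4) < 1" using x by (simp_all add: norm_power_less_1)
  have "qpoch_inf (x\<^sup>2) (x\<^sup>2) * qpoch_inf (-(x\<^sup>2)) (x\<^sup>2) = qpoch_inf (x ^ 4) (x ^ 4)"
    using qpoch_inf_neg_mult[OF r(1), of "x\<^sup>2"] by (simp add: power_mult[symmetric])
  moreover have "qpoch_inf (-(x\<^sup>2)) (x\<^sup>2) \<noteq> 0" using r by (intro qpoch_inf_nonzero_less) auto
  ultimately have "qpoch_inf (-x) (x\<^sup>2) * (qpoch_inf (-x) (x\<^sup>2) / qpoch_inf (-(x\<^sup>2)) (x\<^sup>2)) =
      qsum 1 0 x / qpoch_inf (x ^ 4) (x ^ 4)"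
    using r by (simp add: qsum_1_0[OF x] field_simps)
  with has_sum_cmult_right[OF has_sum_gauss_square[OF x(1)], of "qpoch_inf (-x) (x\<^sup>2)"] show ?thesis
    by (simp add: mult_ac)
qed

lemma qsum_parities:
  assumes x: "norm x < 1" "x \<noteq> 0"
  shows "qsum 1 0 x + qsum 1 0 (-x) = 2 * qsum 1 0 (x ^ 4)"
    and "qsum 1 0 x - qsum 1 0 (-x) = 2 * x * qsum 1 1 (x ^ 4)"
    and "qsum 3 0 x + qsum 3 0 (-x) = 2 * qsum 3 0 (x ^ 4)"
    and "qsum 3 0 x - qsum 3 0 (-x) = 2 * x ^ 3 * qsum 3 3 (x ^ 4)"
    and "qsum 3 2 x + qsum 3 2 (-x) = 2 * qsum 3 1 (x ^ 4)"
    and "qsum 3 2 x - qsum 3 2 (-x) = 2 * x * qsum 3 2 (x ^ 4)"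
proof -
  show "qsum 1 0 x + qsum 1 0 (-x) = 2 * qsum 1 0 (x ^ 4)"
    using qsum_parity(1)[OF x, of 1 0] qsum_scale[of 4 1 0 x] by simp
  show "qsum 1 0 x - qsum 1 0 (-x) = 2 * x * qsum 1 1 (x ^ 4)"
    using qsum_parity(2)[OF x, of 1 0] qsum_scale[of 4 1 1 x] by simp
  show "qsum 3 0 x + qsum 3 0 (-x) = 2 * qsum 3 0 (x ^ 4)"
    using qsum_parity(1)[OF x, of 3 0] qsum_scale[of 4 3 0 x] by simp
  show "qsum 3 0 x - qsum 3 0 (-x) = 2 * x ^ 3 * qsum 3 3 (x ^ 4)"
    using qsum_parity(2)[OF x, of 3 0] qsum_scale[of 4 3 3 x] by simp
  show "qsum 3 2 x + qsum 3 2 (-x) = 2 * qsum 3 1 (x ^ 4)"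
    using qsum_parity(1)[OF x, of 3 2] qsum_scale[of 4 3 1 x] by simp
  have "qsum 12 16 x = x powi (-4) * qsum 12 8 x"
    using qsum_reflect[OF x(2), of 12 16] by simp
  moreover have "x powi 5 * x powi (-4) = x powi 1"
    by (rule powi_mult_eq[OF x(2)]) simp
  ultimately show "qsum 3 2 x - qsum 3 2 (-x) = 2 * x * qsum 3 2 (x ^ 4)"
    using qsum_parity(2)[OF x, of 3 2] qsum_scale[of 4 3 2 x] by (simp add: mult.assoc[symmetric])
qed

text \<open>The sequence G(k) = (1 - x^(4k)) f(k) cancels the last factor of the denominator, hence G(k + 1) is f(k) times a polynomial in x^(2k). Since G(0) = 0,
the difference G(k + 1) - G(k) sums to 0.\<close>

lemma telescoping_sums:
  fixes x e :: complex
  assumes x: "norm x < 1" "x \<noteq> 0"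
  defines "f \<equiv> (\<lambda>k. x ^ k\<^sup>2 * qpoch e (x\<^sup>2) k / qpoch (x ^ 4) (x ^ 4) k)"
  shows "((\<lambda>k. x ^ (2 * k + 1) * (1 - e * x ^ (2 * k)) * f k - (1 - x ^ (4 * k)) * f k) has_sum 0) UNIV"
    and "f summable_on UNIV"
proof -
  have r: "norm (x\<^sup>2) < 1" "norm (x ^ 4) < 1" using x by (simp_all add: norm_power_less_1)
  have nz: "1 - x ^ 4 * (x ^ 4) ^ k \<noteq> 0" for k
    by (rule one_minus_power_nonzero[OF r(2)])
  obtain C1 where C1: "C1 \<ge> 1" "\<And>n. norm (qpoch e (x\<^sup>2) n) \<le> C1"
    using qpoch_bounded[OF r(1)] by metis
  obtain C2 where C2: "C2 \<ge> 1" "\<And>n. norm (1 / qpoch (x ^ 4) (x ^ 4) n) \<le> C2"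
    using inverse_qpoch_bounded[OF r(2) self_mult_power_neq_1[OF r(2)]] by metis
  have "(\<lambda>k. C1 * C2 * (1 ^ k * norm x ^ (k choose 2))) summable_on UNIV"
    using x by (intro summable_on_cmult_right summable_gauss_nat) auto
  thus f: "f summable_on UNIV"
  proof (rule summable_on_complex_majorant)
    fix k
    have "norm (f k) = norm (x ^ k\<^sup>2) * norm (qpoch e (x\<^sup>2) k) * norm (1 / qpoch (x ^ 4) (x ^ 4) k)"
      by (simp add: f_def norm_mult norm_divide)
    also have "\<dots> \<le> norm x ^ (k choose 2) * C1 * C2"
      using x C1 C2 by (intro mult_mono) (auto simp: norm_power square_nat_choose_two intro!: power_decreasing)
    finally show "norm (f k) \<le> C1 * C2 * (1 ^ k * norm x ^ (k choose 2))" by (simp add: mult_ac)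
  qed
  define G where "G = (\<lambda>k. (1 - x ^ (4 * k)) * f k)"
  have GS: "G (Suc k) = x ^ (2 * k + 1) * (1 - e * x ^ (2 * k)) * f k" for k
  proof -
    have "(Suc k)\<^sup>2 = k\<^sup>2 + (2 * k + 1)" by (simp add: power2_eq_square)
    hence "x ^ (Suc k)\<^sup>2 = x ^ k\<^sup>2 * x ^ (2 * k + 1)"
      by (simp only: power_add)
    moreover have "x ^ (4 * Suc k) = x ^ 4 * (x ^ 4) ^ k" by (simp add: power_mult[symmetric] power_add[symmetric])
    ultimately show ?thesis
      unfolding G_def f_def qpoch_Suc power_mult[of x 2, symmetric] using nz[of k] by simp
  qed
  have Gs: "G summable_on UNIV"
  proof -
    have "(\<lambda>k. norm (f k)) summable_on UNIV"
      using f by (simp add: summable_on_iff_abs_summable_on_complex)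
    hence "(\<lambda>k. 2 * norm (f k)) summable_on UNIV" by (rule summable_on_cmult_right)
    thus ?thesis
    proof (rule summable_on_complex_majorant)
      fix k
      have "norm (1 - x ^ (4 * k)) \<le> 1 + norm (x ^ (4 * k))" by (metis norm_one norm_triangle_ineq4)
      also have "\<dots> \<le> 2" using x by (simp add: norm_power power_le_one)
      finally show "norm (G k) \<le> 2 * norm (f k)" by (simp add: G_def norm_mult mult_right_mono)
    qed
  qed
  define S where "S = infsum G UNIV"
  have S: "(G has_sum S) UNIV" unfolding S_def by (rule has_sum_infsum[OF Gs])
  have S': "((\<lambda>k. G (Suc k)) has_sum S) UNIV"
  proof -
    have "(G has_sum S) UNIV \<longleftrightarrow> (G has_sum S) (range Suc)"
    proof (rule has_sum_cong_neutral)
      fix k assume "k \<in> UNIV - range Suc"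
      hence "k = 0" by (metis DiffD2 not0_implies_Suc rangeI)
      thus "G k = 0" by (simp add: G_def)
    qed auto
    thus ?thesis using S by (subst (asm) has_sum_reindex) (auto simp: o_def)
  qed
  from has_sum_add[OF S' has_sum_uminusI[OF S]]
  have "((\<lambda>k. G (Suc k) - G k) has_sum 0) UNIV" by simp
  thus "((\<lambda>k. x ^ (2 * k + 1) * (1 - e * x ^ (2 * k)) * f k - (1 - x ^ (4 * k)) * f k) has_sum 0) UNIV"
    unfolding GS unfolding G_def .
qed

lemma qpoch_inverse_relation:
  assumes "x \<noteq> (0::complex)"
  shows "(1 - 1 / x) * qpoch x (x\<^sup>2) k = qpoch (1 / x) (x\<^sup>2) k * (1 - x ^ (2 * k) / x)"
proof -
  have "1 / x * x\<^sup>2 = x" using assms by (simp add: power2_eq_square)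
  thus ?thesis
    using qpoch_Suc[of "1 / x" "x\<^sup>2" k] qpoch_Suc_left[of "1 / x" "x\<^sup>2" k] by (simp add: power_mult)
qed

text \<open>For e = 1/x the telescoping summand is a constant multiple of this one, because (x)_k is (1/x)_k times a linear polynomial in x^(2k).\<close>

lemma has_sum_inverse_difference:
  fixes x :: complex
  assumes x: "norm x < 1" "x \<noteq> 0"
  shows "((\<lambda>k. x ^ k\<^sup>2 * ((1 + 1 / x) * qpoch (1 / x) (x\<^sup>2) k - qpoch x (x\<^sup>2) k) / qpoch (x ^ 4) (x ^ 4) k) has_sum 0) UNIV"
proof -
  have x1: "x \<noteq> 1" using x by auto
  define e where "e = 1 / x"
  define f where "f = (\<lambda>k. x ^ k\<^sup>2 * qpoch e (x\<^sup>2) k / qpoch (x ^ 4) (x ^ 4) k)"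
  from has_sum_cmult_right[OF telescoping_sums(1)[OF x, of e], of "1 / (x\<^sup>2 * (1 - 1 / x))"]
  have "((\<lambda>k. 1 / (x\<^sup>2 * (1 - 1 / x)) *
     (x ^ (2 * k + 1) * (1 - e * x ^ (2 * k)) * f k - (1 - x ^ (4 * k)) * f k)) has_sum 0) UNIV" unfolding f_def by simp
  thus ?thesis
  proof (rule has_sum_cong[THEN iffD1, rotated])
    fix k
    define u where "u = x ^ (2 * k)"
    have u2: "x ^ (4 * k) = u * u" by (simp add: u_def power_add[symmetric])
    have nz: "1 - e \<noteq> 0" using x x1 by (simp add: e_def)
    have X: "qpoch x (x\<^sup>2) k = qpoch e (x\<^sup>2) k * (1 - u / x) / (1 - e)"
      using qpoch_inverse_relation[OF x(2), of k] nz by (simp add: e_def u_def field_simps)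
    have "(1 + 1 / x) * qpoch (1 / x) (x\<^sup>2) k - qpoch x (x\<^sup>2) k = qpoch e (x\<^sup>2) k * ((1 + e) - (1 - u / x) / (1 - e))"
      unfolding X by (simp add: e_def algebra_simps)
    also have "(1 + e) - (1 - u / x) / (1 - e) = 1 / (x\<^sup>2 * (1 - e)) * (x * u * (1 - e * u) - (1 - u * u))"
      using x x1 by (simp add: e_def field_simps power2_eq_square)
    finally have *: "(1 + e) * qpoch e (x\<^sup>2) k - qpoch x (x\<^sup>2) k =
      qpoch e (x\<^sup>2) k * (1 / (x\<^sup>2 * (1 - e)) * (x * u * (1 - e * u) - (1 - u * u)))"
      unfolding e_def .
    have gen: "c * (a * (X * Y / Z) - b * (X * Y / Z)) = X * (Y * (c * (a - b))) / Z" for a b c X Y Z :: complex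
      by (simp add: algebra_simps diff_divide_distrib)
    have p: "x ^ (2 * k + 1) = x * u" by (simp add: u_def)
    show "1 / (x\<^sup>2 * (1 - 1 / x)) * (x ^ (2 * k + 1) * (1 - e * x ^ (2 * k)) * f k - (1 - x ^ (4 * k)) * f k) =
      x ^ k\<^sup>2 * ((1 + 1 / x) * qpoch (1 / x) (x\<^sup>2) k - qpoch x (x\<^sup>2) k) / qpoch (x ^ 4) (x ^ 4) k"
      unfolding e_def[symmetric] * f_def p u2 u_def[symmetric] by (rule gen)
  qed
qed

text \<open>For e = -1/x the telescoping summand is no longer a constant multiple of the required one: the defect is a multiple of
x^(k^2 + 2k) (-x)_k / (x^4; x^4)_k, whose sum is known from Bailey's transformation.\<close>

lemma has_sum_inverse_difference_neg:
  fixes x :: complex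
  assumes x: "norm x < 1" "x \<noteq> 0"
  shows "((\<lambda>k. x ^ k\<^sup>2 * (qpoch_inf x (x\<^sup>2) * ((1 - 1 / x) * qpoch (-(1 / x)) (x\<^sup>2) k - qpoch (-x) (x\<^sup>2) k)) / qpoch (x ^ 4) (x ^ 4) k)
            has_sum (- (2 / x) * (qsum 3 2 (-x) / qpoch_inf (x ^ 4) (x ^ 4)))) UNIV"
proof -
  have x1: "x \<noteq> -1" using x by auto
  define e where "e = -(1 / x)"
  define f where "f = (\<lambda>k. x ^ k\<^sup>2 * qpoch e (x\<^sup>2) k / qpoch (x ^ 4) (x ^ 4) k)"
  define a where "a = qpoch_inf x (x\<^sup>2)"
  define c where "c = a / (x\<^sup>2 * (1 + 1 / x))"
  from has_sum_cmult_right[OF telescoping_sums(1)[OF x, of e], of c]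
  have "((\<lambda>k. c * (x ^ (2 * k + 1) * (1 - e * x ^ (2 * k)) * f k - (1 - x ^ (4 * k)) * f k)) has_sum 0) UNIV" unfolding f_def by simp
  from has_sum_add[OF this has_sum_cmult_right[OF has_sum_slater25_companion'[OF x], of "- (2 / x)"]]
  have "((\<lambda>k. c * (x ^ (2 * k + 1) * (1 - e * x ^ (2 * k)) * f k - (1 - x ^ (4 * k)) * f k) +
      - (2 / x) * (x ^ (k\<^sup>2 + 2 * k) * (a * qpoch (-x) (x\<^sup>2) k) / qpoch (x ^ 4) (x ^ 4) k))
     has_sum (- (2 / x) * (qsum 3 2 (-x) / qpoch_inf (x ^ 4) (x ^ 4)))) UNIV"
    unfolding a_def by simp
  thus ?thesis
  proof (rule has_sum_cong[THEN iffD1, rotated])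
    fix k
    define u where "u = x ^ (2 * k)"
    define Y where "Y = qpoch e (x\<^sup>2) k"
    have u2: "x ^ (4 * k) = u * u" by (simp add: u_def power_add[symmetric])
    have nz: "1 + 1 / x \<noteq> 0" using x x1 by (simp add: field_simps add_eq_0_iff)
    have X: "qpoch (-x) (x\<^sup>2) k = Y * (1 + u / x) / (1 + 1 / x)"
      using qpoch_inverse_relation[of "-x" k] x nz by (simp add: e_def Y_def u_def eq_divide_eq mult.commute)
    have main: "1 / (x\<^sup>2 * (1 + 1 / x)) * (x * u * (1 + u / x) - (1 - u * u)) - 2 / x * (u * ((1 + u / x) / (1 + 1 / x))) =
        (1 - 1 / x) - (1 + u / x) / (1 + 1 / x)"
    proof -
      have "x + 1 \<noteq> 0" using x1 by (simp add: add_eq_0_iff2)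
      thus ?thesis using x by (simp add: divide_simps) (simp add: algebra_simps power2_eq_square)
    qed
    have "c * (x ^ (2 * k + 1) * (1 - e * x ^ (2 * k)) * f k - (1 - x ^ (4 * k)) * f k) +
      - (2 / x) * (x ^ (k\<^sup>2 + 2 * k) * (a * qpoch (-x) (x\<^sup>2) k) / qpoch (x ^ 4) (x ^ 4) k) =
      x ^ k\<^sup>2 * a * Y / qpoch (x ^ 4) (x ^ 4) k *
       (1 / (x\<^sup>2 * (1 + 1 / x)) * (x * u * (1 + u / x) - (1 - u * u)) - 2 / x * (u * ((1 + u / x) / (1 + 1 / x))))"
    proof -
      have gen: "a0 / D * (A * (X * Y / Z) - B * (X * Y / Z)) + - (2 / x) * (X * u * (a0 * (Y * W / V')) / Z) =
          X * a0 * Y / Z * (1 / D * (A - B) - 2 / x * (u * (W / V')))" for a0 D A B X Y Z W V' :: complex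
        by (simp add: algebra_simps diff_divide_distrib)
      have p: "x ^ (2 * k + 1) = x * u" by (simp add: u_def)
      have q: "1 - e * u = 1 + u / x" by (simp add: e_def)
      show ?thesis unfolding u2 f_def c_def X p power_add[of x "k\<^sup>2"] u_def[symmetric] Y_def[symmetric] q by (rule gen)
    qed
    also have "\<dots> = x ^ k\<^sup>2 * (a * ((1 - 1 / x) * Y - qpoch (-x) (x\<^sup>2) k)) / qpoch (x ^ 4) (x ^ 4) k"
      unfolding main X by (simp add: algebra_simps)
    finally show "c * (x ^ (2 * k + 1) * (1 - e * x ^ (2 * k)) * f k - (1 - x ^ (4 * k)) * f k) +
      - (2 / x) * (x ^ (k\<^sup>2 + 2 * k) * (a * qpoch (-x) (x\<^sup>2) k) / qpoch (x ^ 4) (x ^ 4) k) =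
      x ^ k\<^sup>2 * (qpoch_inf x (x\<^sup>2) * ((1 - 1 / x) * qpoch (-(1 / x)) (x\<^sup>2) k - qpoch (-x) (x\<^sup>2) k)) / qpoch (x ^ 4) (x ^ 4) k"
      unfolding Y_def e_def a_def .
  qed
qed

section \<open>The five sums as bilinear forms in theta series\<close>

text \<open>For weights of the form (-q)_N one has q = -x^2, and V(k) is a combination of (x)_k and (-x)_k. The four sums here are what is needed to
separate even and odd k in both parts. Multiplication by (-1)^k amounts to changing x into -x in x^(k^2), since k^2 and k have the same parity.\<close>

lemma half_sums:
  fixes x :: complex
  assumes x: "norm x < 1" "x \<noteq> 0"
  defines "al \<equiv> (\<lambda>k. x ^ k\<^sup>2 * (qpoch_inf (-x) (x\<^sup>2) * qpoch x (x\<^sup>2) k) / qpoch (x ^ 4) (x ^ 4) k)"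
    and "be \<equiv> (\<lambda>k. x ^ k\<^sup>2 * (qpoch_inf x (x\<^sup>2) * qpoch (-x) (x\<^sup>2) k) / qpoch (x ^ 4) (x ^ 4) k)"
    and "Q \<equiv> qpoch_inf (x ^ 4) (x ^ 4)"
  shows "(al has_sum qsum 1 0 x / Q) UNIV" "((\<lambda>k. (-1) ^ k * al k) has_sum qsum 3 0 x / Q) UNIV"
    "(be has_sum qsum 3 0 (-x) / Q) UNIV" "((\<lambda>k. (-1) ^ k * be k) has_sum qsum 1 0 (-x) / Q) UNIV"
proof -
  have mx: "norm (-x) < 1" "-x \<noteq> 0" using x by auto
  have e: "(-1) ^ k * (x ^ k\<^sup>2 * c / d) = (-x) ^ k\<^sup>2 * c / d" for k c d
    using minus_one_power_times_square[of k x] by simp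
  show "(al has_sum qsum 1 0 x / Q) UNIV" unfolding al_def Q_def by (rule has_sum_gauss_square'[OF x])
  show "(be has_sum qsum 3 0 (-x) / Q) UNIV" unfolding be_def Q_def by (rule has_sum_slater25'[OF x])
  show "((\<lambda>k. (-1) ^ k * al k) has_sum qsum 3 0 x / Q) UNIV"
    unfolding al_def Q_def e using has_sum_slater25'[OF mx] by simp
  show "((\<lambda>k. (-1) ^ k * be k) has_sum qsum 1 0 (-x) / Q) UNIV"
    unfolding be_def Q_def e using has_sum_gauss_square'[OF mx] by simp
qed

lemma even_odd_powers:
  fixes x :: complex
  shows "x ^ (2 * i)\<^sup>2 = (-(x\<^sup>2)) ^ (2 * i\<^sup>2)" "x ^ (2 * i + 1)\<^sup>2 = x * (-(x\<^sup>2)) ^ (2 * i\<^sup>2 + 2 * i)"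
proof -
  have 1: "(-(x\<^sup>2)) ^ (2 * m) = x ^ (2 * (2 * m))" for m by (simp add: power_mult)
  show "x ^ (2 * i)\<^sup>2 = (-(x\<^sup>2)) ^ (2 * i\<^sup>2)" unfolding 1 by (simp add: power_mult_distrib)
  have "2 * i\<^sup>2 + 2 * i = 2 * (i\<^sup>2 + i)" by simp
  moreover have "(2 * i + 1)\<^sup>2 = 1 + 2 * (2 * (i\<^sup>2 + i))" by (simp add: power2_eq_square algebra_simps)
  ultimately show "x ^ (2 * i + 1)\<^sup>2 = x * (-(x\<^sup>2)) ^ (2 * i\<^sup>2 + 2 * i)"
    using 1[of "i\<^sup>2 + i"] by (simp only: power_add power_one_right)
qed

lemma has_sum_qpoch_kernel:
  fixes x q t :: complex
  assumes x: "norm x < 1" "x \<noteq> 0" and q: "q = -(x\<^sup>2)" and t: "t = q\<^sup>2"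
  shows "((\<lambda>j. q ^ j\<^sup>2 * qpoch (c\<^sup>2) t (k + j) / qpoch t t j) has_sum
     qpoch_inf (-q) t / 2 * (qpoch c (x\<^sup>2) k * qpoch_inf (-c) (x\<^sup>2) + qpoch (-c) (x\<^sup>2) k * qpoch_inf c (x\<^sup>2))) UNIV"
proof -
  have t4: "t = x ^ 4" by (simp add: t q power_mult[symmetric])
  show ?thesis
    using has_sum_kernel[OF x(1), of c k] unfolding minus_one_power_times_square by (simp add: q t4)
qed

lemma obtain_root:
  fixes q :: complex
  assumes "norm q < 1" "q \<noteq> 0"
  obtains x where "norm x < 1" "x \<noteq> 0" "q = -(x\<^sup>2)"
proof (rule that[of "csqrt (-q)"])
  show "norm (csqrt (-q)) < 1" using assms by (simp add: norm_csqrt)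
qed (use assms in auto)

lemma qsum_2: "qsum 2 0 q = qsum 1 0 (q\<^sup>2)" "qsum 2 2 q = qsum 1 1 (q\<^sup>2)"
  using qsum_scale[of 2 1 0 q] qsum_scale[of 2 1 1 q] by simp_all

text \<open>The weight is w(M) = (-q)_M = (x^2; x^4)_M, so V(k) comes from the even part of Euler's series at c = x.\<close>

lemma chi_0_0_0_0:
  fixes q t :: complex
  assumes q: "norm q < 1" "q \<noteq> 0" and tq: "t = q\<^sup>2"
  defines "P \<equiv> qpoch_inf (-q) t" and "Q \<equiv> qpoch_inf t t"
  shows "chi_sq [1, 1, 1, 1] q = P / Q * (P / (2 * Q)) *
     (qsum 1 0 t * (qsum 1 0 t + qsum 3 0 t) + q * qsum 1 1 t * (qsum 1 1 t + q * qsum 3 3 t))"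
proof -
  obtain x where x: "norm x < 1" "x \<noteq> 0" and qx: "q = -(x\<^sup>2)" using obtain_root[OF q] .
  have t: "norm t < 1" using q by (simp add: tq norm_power_less_1)
  have t4: "x ^ 4 = t" by (simp add: tq qx power_mult[symmetric])
  obtain D where D: "D \<ge> 1" "\<And>n. norm (qpoch (-q) t n) \<le> D" using qpoch_bounded[OF t] by metis
  define V where "V = (\<lambda>k. P / 2 * (qpoch x (x\<^sup>2) k * qpoch_inf (-x) (x\<^sup>2) + qpoch (-x) (x\<^sup>2) k * qpoch_inf x (x\<^sup>2)))"
  define f where "f = (\<lambda>k. x ^ k\<^sup>2 * V k / qpoch t t k)"
  note hs = half_sums[OF x, unfolded t4, folded Q_def]
  have V: "((\<lambda>j. q ^ j\<^sup>2 * qpoch (-q) t (k + j) / qpoch t t j) has_sum V k) UNIV" for k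
    using has_sum_qpoch_kernel[OF x qx tq, of x k] by (simp add: V_def P_def qx)
  have S: "(f has_sum P / 2 * (qsum 1 0 x / Q + qsum 3 0 (-x) / Q)) UNIV"
    using has_sum_cmult_right[OF has_sum_add[OF hs(1,3)], of "P / 2"]
    by (rule has_sum_cong[THEN iffD1, rotated]) (simp add: f_def V_def algebra_simps add_divide_distrib)
  have T: "((\<lambda>k. (-1) ^ k * f k) has_sum P / 2 * (qsum 3 0 x / Q + qsum 1 0 (-x) / Q)) UNIV"
    using has_sum_cmult_right[OF has_sum_add[OF hs(2,4)], of "P / 2"]
    by (rule has_sum_cong[THEN iffD1, rotated]) (simp add: f_def V_def algebra_simps add_divide_distrib)
  have Ev: "((\<lambda>i. q ^ (2 * i\<^sup>2) * V (2 * i) / qpoch t t (2 * i)) has_sum P / (2 * Q) * (qsum 1 0 t + qsum 3 0 t)) UNIV"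
  proof -
    have e: "(P / 2 * (qsum 1 0 x / Q + qsum 3 0 (-x) / Q) + P / 2 * (qsum 3 0 x / Q + qsum 1 0 (-x) / Q)) / 2 =
       P / (4 * Q) * ((qsum 1 0 x + qsum 1 0 (-x)) + (qsum 3 0 x + qsum 3 0 (-x)))"
      by (simp add: algebra_simps add_divide_distrib)
    show ?thesis
      using has_sum_even_odd(1)[OF S T] unfolding e qsum_parities[OF x] t4 f_def even_odd_powers qx[symmetric]
      by (simp add: algebra_simps add_divide_distrib)
  qed
  have Od: "((\<lambda>i. q ^ (2 * i\<^sup>2 + 2 * i) * V (2 * i + 1) / qpoch t t (2 * i + 1)) has_sum
      P / (2 * Q) * (qsum 1 1 t + q * qsum 3 3 t)) UNIV"
  proof -
    have e: "(P / 2 * (qsum 1 0 x / Q + qsum 3 0 (-x) / Q) - P / 2 * (qsum 3 0 x / Q + qsum 1 0 (-x) / Q)) / 2 =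
       P / (4 * Q) * ((qsum 1 0 x - qsum 1 0 (-x)) - (qsum 3 0 x - qsum 3 0 (-x)))"
      by (simp add: algebra_simps diff_divide_distrib add_divide_distrib)
    have g: "1 / x * (P / (4 * Q) * (2 * x * qsum 1 1 t - 2 * x ^ 3 * qsum 3 3 t)) = P / (2 * Q) * (qsum 1 1 t + q * qsum 3 3 t)"
      using x(2) by (simp add: qx divide_simps) (simp add: algebra_simps power2_eq_square power3_eq_cube)
    have "((\<lambda>i. 1 / x * f (2 * i + 1)) has_sum 1 / x * (P / (4 * Q) * (2 * x * qsum 1 1 t - 2 * x ^ 3 * qsum 3 3 t))) UNIV"
      using has_sum_cmult_right[OF has_sum_even_odd(2)[OF S T], of "1 / x"] unfolding e qsum_parities[OF x] t4 .
    thus ?thesis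
      unfolding g f_def even_odd_powers qx[symmetric]
      by (rule has_sum_cong[THEN iffD1, rotated]) (use x in simp)
  qed
  have "((\<lambda>(M, n1, n2). q powi (nahm_exponent M n1 n2) * qpoch (-q) t M / (qpoch t t n1 * qpoch t t n2 * qpoch t t M)) has_sum
            (qsum 2 0 q * (P / (2 * Q) * (qsum 1 0 t + qsum 3 0 t)) + q * qsum 2 2 q * (P / (2 * Q) * (qsum 1 1 t + q * qsum 3 3 t))) / qpoch_inf t t) UNIV"
    by (rule rank_reduction_0[OF q tq, of 1 D]) (use D V Ev Od in auto)
  hence "chi_sq [1, 1, 1, 1] q = qpoch_inf (-(1 * q)) t * ((qsum 2 0 q * (P / (2 * Q) * (qsum 1 0 t + qsum 3 0 t)) + q * qsum 2 2 q * (P / (2 * Q) * (qsum 1 1 t + q * qsum 3 3 t))) / qpoch_inf t t)"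
    by (intro chi_reduction[OF q tq]) simp_all
  thus ?thesis unfolding qsum_2 tq[symmetric] by (simp add: P_def Q_def algebra_simps add_divide_distrib)
qed

lemma power_pair_eq:
  fixes q :: complex
  assumes "q \<noteq> 0"
  shows "(q\<^sup>2) ^ n1 * (q powi (-2)) ^ n2 = q powi (2 * (int n1 - int n2))"
proof -
  have "(q\<^sup>2) ^ n1 = q powi (2 * int n1)" by (metis powi_double[OF assms] power_int_of_nat)
  moreover have "(q powi (-2)) ^ n2 = q powi (-2 * int n2)" by (metis power_int_mult power_int_of_nat)
  moreover have "q powi (2 * int n1) * q powi (-2 * int n2) = q powi (2 * (int n1 - int n2))"
    by (rule powi_mult_eq[OF assms]) simp
  ultimately show ?thesis by simp
qed

text \<open>The weight is w(M) = t^M (-q)_M. The factor t^j adds 2j to the exponent j^2, so V(k) comes from the odd part of Euler's series.\<close>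

lemma chi_2_m2_2_0:
  fixes q t :: complex
  assumes q: "norm q < 1" "q \<noteq> 0" and tq: "t = q\<^sup>2"
  defines "P \<equiv> qpoch_inf (-q) t" and "Q \<equiv> qpoch_inf t t"
  shows "chi_sq [q\<^sup>2, q powi (-2), q\<^sup>2, 1] q = P / Q * (P / (2 * Q)) *
     (qsum 1 1 t * (qsum 1 1 t - q * qsum 3 3 t) + qsum 1 0 t / q * (qsum 1 0 t - qsum 3 0 t))"
proof -
  obtain x where x: "norm x < 1" "x \<noteq> 0" and qx: "q = -(x\<^sup>2)" using obtain_root[OF q] .
  have t: "norm t < 1" "norm t \<le> 1" using q by (simp_all add: tq norm_power_less_1 less_imp_le)
  have t4: "x ^ 4 = t" by (simp add: tq qx power_mult[symmetric])
  obtain D where D: "D \<ge> 1" "\<And>n. norm (qpoch (-q) t n) \<le> D" using qpoch_bounded[OF t(1)] by metis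
  define W where "W = (\<lambda>k. qpoch x (x\<^sup>2) k * qpoch_inf (-x) (x\<^sup>2) - qpoch (-x) (x\<^sup>2) k * qpoch_inf x (x\<^sup>2))"
  define V where "V = (\<lambda>k. P / (2 * x) * (x\<^sup>2) ^ k * W k)"
  define f where "f = (\<lambda>k. x ^ k\<^sup>2 * W k / qpoch t t k)"
  note hs = half_sums[OF x, unfolded t4, folded Q_def]
  have V: "((\<lambda>j. q ^ j\<^sup>2 * (t ^ (k + j) * qpoch (-q) t (k + j)) / qpoch t t j) has_sum V k) UNIV" for k
  proof -
    have c: "t ^ k / (x\<^sup>2) ^ k = (x\<^sup>2) ^ k"
    proof -
      have e: "t = x\<^sup>2 * x\<^sup>2" unfolding t4[symmetric] by (simp add: power4_eq_xxxx power2_eq_square)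
      have "(x\<^sup>2) ^ k \<noteq> 0" using x(2) by simp
      thus ?thesis unfolding e power_mult_distrib by (rule nonzero_mult_div_cancel_right)
    qed
    have d: "t ^ k * (qpoch_inf (x\<^sup>2) (x ^ 4) / (2 * x * (x\<^sup>2) ^ k) * W k) = V k"
    proof -
      have "V k = P / (2 * x) * (t ^ k / (x\<^sup>2) ^ k) * W k" by (simp only: V_def c)
      moreover have "qpoch_inf (x\<^sup>2) (x ^ 4) = P" by (simp add: P_def qx t4[unfolded qx])
      ultimately show ?thesis by simp
    qed
    have "((\<lambda>j. t ^ k * ((-1) ^ j * (x\<^sup>2) ^ (j\<^sup>2 + 2 * j) * qpoch (x\<^sup>2) (x ^ 4) (k + j) / qpoch (x ^ 4) (x ^ 4) j)) has_sum V k) UNIV"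
      unfolding d[symmetric] W_def by (intro has_sum_cmult_right has_sum_kernel_odd x)
    moreover have "t ^ k * ((-1) ^ j * (x\<^sup>2) ^ (j\<^sup>2 + 2 * j) * qpoch (x\<^sup>2) (x ^ 4) (k + j) / qpoch (x ^ 4) (x ^ 4) j) =
        q ^ j\<^sup>2 * (t ^ (k + j) * qpoch (-q) t (k + j)) / qpoch t t j" for j
    proof -
      have "(-1) ^ j * (x\<^sup>2) ^ (j\<^sup>2 + 2 * j) = q ^ j\<^sup>2 * t ^ j"
        unfolding power_add mult.assoc[symmetric] minus_one_power_times_square
        by (simp add: qx tq power_mult[symmetric])
      thus ?thesis unfolding t4 by (simp add: qx[symmetric] power_add) (simp add: qx)
    qed
    ultimately show ?thesis by simp
  qed
  have S: "(f has_sum (qsum 1 0 x / Q - qsum 3 0 (-x) / Q)) UNIV"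
    using has_sum_add[OF hs(1) has_sum_uminusI[OF hs(3)]] unfolding diff_conv_add_uminus
    by (rule has_sum_cong[THEN iffD1, rotated]) (simp add: f_def W_def algebra_simps diff_divide_distrib)
  have T: "((\<lambda>k. (-1) ^ k * f k) has_sum (qsum 3 0 x / Q - qsum 1 0 (-x) / Q)) UNIV"
    using has_sum_add[OF hs(2) has_sum_uminusI[OF hs(4)]] unfolding diff_conv_add_uminus
    by (rule has_sum_cong[THEN iffD1, rotated]) (simp add: f_def W_def algebra_simps diff_divide_distrib)
  have qp: "q ^ (2 * m) = x ^ (4 * m)" for m by (simp add: qx power_mult power_mult[of x 2 2, symmetric])
  have Ev: "((\<lambda>i. q ^ (4 * (i choose 2)) * V (2 * i) / qpoch t t (2 * i)) has_sum P / (2 * Q) * (qsum 1 1 t - q * qsum 3 3 t)) UNIV"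
  proof -
    have e: "P / (2 * x) * ((qsum 1 0 x / Q - qsum 3 0 (-x) / Q + (qsum 3 0 x / Q - qsum 1 0 (-x) / Q)) / 2) =
       P / (4 * x * Q) * ((qsum 1 0 x - qsum 1 0 (-x)) + (qsum 3 0 x - qsum 3 0 (-x)))"
      by (simp add: algebra_simps add_divide_distrib diff_divide_distrib)
    have g: "P / (4 * x * Q) * (2 * x * qsum 1 1 t + 2 * x ^ 3 * qsum 3 3 t) = P / (2 * Q) * (qsum 1 1 t - q * qsum 3 3 t)"
      using x(2) by (simp add: qx divide_simps) (simp add: algebra_simps power2_eq_square power3_eq_cube)
    have "((\<lambda>i. P / (2 * x) * f (2 * i)) has_sum P / (2 * Q) * (qsum 1 1 t - q * qsum 3 3 t)) UNIV"
      using has_sum_cmult_right[OF has_sum_even_odd(1)[OF S T], of "P / (2 * x)"] unfolding e qsum_parities[OF x] t4 g .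
    thus ?thesis
    proof (rule has_sum_cong[THEN iffD1, rotated])
      fix i
      have "x ^ (2 * i)\<^sup>2 = q ^ (4 * (i choose 2)) * (x\<^sup>2) ^ (2 * i)"
        using qp[of "2 * (i choose 2)"]
        by (simp add: power_mult_distrib square_nat_choose_two double_choose_two power_mult[symmetric] power_add[symmetric] add_ac)
      thus "P / (2 * x) * f (2 * i) = q ^ (4 * (i choose 2)) * V (2 * i) / qpoch t t (2 * i)"
        by (simp add: f_def V_def mult_ac)
    qed
  qed
  have Od: "((\<lambda>i. q ^ (2 * i\<^sup>2) * V (2 * i + 1) / qpoch t t (2 * i + 1)) has_sum P / (2 * Q) * (qsum 1 0 t - qsum 3 0 t)) UNIV"
  proof -
    have e: "P / 2 * ((qsum 1 0 x / Q - qsum 3 0 (-x) / Q - (qsum 3 0 x / Q - qsum 1 0 (-x) / Q)) / 2) =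
       P / (4 * Q) * ((qsum 1 0 x + qsum 1 0 (-x)) - (qsum 3 0 x + qsum 3 0 (-x)))"
      by (simp add: algebra_simps add_divide_distrib diff_divide_distrib)
    have g: "P / (4 * Q) * (2 * qsum 1 0 t - 2 * qsum 3 0 t) = P / (2 * Q) * (qsum 1 0 t - qsum 3 0 t)"
      by (simp add: algebra_simps diff_divide_distrib)
    have "((\<lambda>i. P / 2 * f (2 * i + 1)) has_sum P / (2 * Q) * (qsum 1 0 t - qsum 3 0 t)) UNIV"
      using has_sum_cmult_right[OF has_sum_even_odd(2)[OF S T], of "P / 2"] unfolding e qsum_parities[OF x] t4 g .
    thus ?thesis
    proof (rule has_sum_cong[THEN iffD1, rotated])
      fix i :: nat
      have "(2 * i + 1)\<^sup>2 = 4 * i\<^sup>2 + (2 * (2 * i) + 1)" by (simp add: power2_eq_square)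
      hence "x ^ (2 * i + 1)\<^sup>2 = x ^ (4 * i\<^sup>2) * ((x\<^sup>2) ^ (2 * i) * x)"
        by (simp only: power_add power_mult[symmetric] power_one_right)
      hence "x ^ (2 * i + 1)\<^sup>2 * x = q ^ (2 * i\<^sup>2) * (x\<^sup>2) ^ (2 * i + 1)"
        by (simp add: qp power2_eq_square[of x] mult_ac)
      hence "x ^ (2 * i + 1)\<^sup>2 = q ^ (2 * i\<^sup>2) * (x\<^sup>2) ^ (2 * i + 1) / x"
        using x(2) by (simp add: eq_divide_eq)
      thus "P / 2 * f (2 * i + 1) = q ^ (2 * i\<^sup>2) * V (2 * i + 1) / qpoch t t (2 * i + 1)"
        by (simp only: f_def V_def) (simp add: mult_ac)
    qed
  qed
  define T where "T = (qsum 2 2 q * (P / (2 * Q) * (qsum 1 1 t - q * qsum 3 3 t)) + qsum 2 0 q / q * (P / (2 * Q) * (qsum 1 0 t - qsum 3 0 t))) / qpoch_inf t t"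
  have nb: "norm (t ^ M * qpoch (-q) t M) \<le> D * 1 ^ M" for M
    using D(2)[of M] t(2) by (auto simp: norm_mult norm_power intro!: order_trans[OF mult_left_le_one_le] power_le_one)
  have "((\<lambda>(M, n1, n2). q powi (nahm_exponent_shifted M n1 n2) * (t ^ M * qpoch (-q) t M) / (qpoch t t n1 * qpoch t t n2 * qpoch t t M)) has_sum T) UNIV"
    unfolding T_def by (rule rank_reduction_1[OF q tq _ _ nb V Ev Od]) (use D in auto)
  hence "((\<lambda>(N, n1, n2). q powi (nahm_exponent N n1 n2) *
     ((q\<^sup>2) ^ n1 * (q powi (-2)) ^ n2 * (q\<^sup>2 * 1) ^ N) * qpoch (-(q / 1)) t N / (qpoch t t n1 * qpoch t t n2 * qpoch t t N)) has_sum T) UNIV"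
  proof (rule has_sum_cong[THEN iffD1, rotated])
    fix p :: "nat \<times> nat \<times> nat"
    obtain N n1 n2 where p: "p = (N, n1, n2)" by (cases p) auto
    have e: "q powi (nahm_exponent N n1 n2) * q powi (2 * (int n1 - int n2)) =
       q powi (nahm_exponent_shifted N n1 n2)"
      by (rule powi_mult_eq[OF q(2)]) simp
    show "(case p of (M, n1, n2) \<Rightarrow> q powi (nahm_exponent_shifted M n1 n2) * (t ^ M * qpoch (-q) t M) / (qpoch t t n1 * qpoch t t n2 * qpoch t t M)) =
       (case p of (N, n1, n2) \<Rightarrow> q powi (nahm_exponent N n1 n2) *
     ((q\<^sup>2) ^ n1 * (q powi (-2)) ^ n2 * (q\<^sup>2 * 1) ^ N) * qpoch (-(q / 1)) t N / (qpoch t t n1 * qpoch t t n2 * qpoch t t N))"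
      unfolding p prod.case power_pair_eq[OF q(2)] e[symmetric] tq by (simp add: mult_ac)
  qed
  hence "chi_sq [q\<^sup>2, q powi (-2), q\<^sup>2, 1] q = qpoch_inf (-(1 * q)) t * T"
    by (intro chi_reduction[OF q tq]) simp_all
  thus ?thesis unfolding T_def qsum_2 tq[symmetric]
    by (simp add: P_def Q_def algebra_simps add_divide_distrib diff_divide_distrib)
qed

text \<open>The arguments x2 = q^(-2) and x3 = q^2 contribute q^(2N - 2 n2). This is exactly the change of the exponent under N = M - 1,
up to a constant. In terms of M the weight is (1 - t^M) (-q)_{M-1} / q, which equals (-1/q)_M - (-q)_M and
vanishes at M = 0, so both parts of V(k) come from the even part of Euler's series, at c = 1/x and at c = x.\<close>

lemma chi_0_m2_2_0:
  fixes q t :: complex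
  assumes q: "norm q < 1" "q \<noteq> 0" and tq: "t = q\<^sup>2"
  defines "P \<equiv> qpoch_inf (-q) t" and "Q \<equiv> qpoch_inf t t"
  shows "chi_sq [1, q powi (-2), q\<^sup>2, 1] q = P / Q * (P / Q) *
     (qsum 1 0 t * qsum 3 2 t + qsum 1 1 t * qsum 3 1 t)"
proof -
  obtain x where x: "norm x < 1" "x \<noteq> 0" and qx: "q = -(x\<^sup>2)" using obtain_root[OF q] .
  have mx: "norm (-x) < 1" "-x \<noteq> 0" using x by auto
  have r: "norm (x\<^sup>2) < 1" using x by (simp add: norm_power_less_1)
  have t: "norm t < 1" using q by (simp add: tq norm_power_less_1)
  have t4: "x ^ 4 = t" by (simp add: tq qx power_mult[symmetric])
  define c where "c = 1 / x"
  have c2: "c\<^sup>2 = -(1 / q)" by (simp add: c_def qx power_divide)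
  obtain D1 where D1: "D1 \<ge> 1" "\<And>n. norm (qpoch (c\<^sup>2) t n) \<le> D1" using qpoch_bounded[OF t] by metis
  obtain D2 where D2: "D2 \<ge> 1" "\<And>n. norm (qpoch (-q) t n) \<le> D2" using qpoch_bounded[OF t] by metis
  define w where "w = (\<lambda>M. qpoch (c\<^sup>2) t M - qpoch (-q) t M)"
  define a where "a = qpoch_inf x (x\<^sup>2)"
  define b where "b = qpoch_inf (-x) (x\<^sup>2)"
  define al where "al = (\<lambda>k. x ^ k\<^sup>2 * (b * ((1 + 1 / x) * qpoch (1 / x) (x\<^sup>2) k - qpoch x (x\<^sup>2) k)) / qpoch t t k)"
  define be where "be = (\<lambda>k. x ^ k\<^sup>2 * (a * ((1 - 1 / x) * qpoch (-(1 / x)) (x\<^sup>2) k - qpoch (-x) (x\<^sup>2) k)) / qpoch t t k)"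
  have e: "(-1) ^ k * (x ^ k\<^sup>2 * u / d) = (-x) ^ k\<^sup>2 * u / d" for k u d
    using minus_one_power_times_square[of k x] by simp
  have al1: "(al has_sum 0) UNIV"
    using has_sum_cmult_right[OF has_sum_inverse_difference[OF x], of b]
    unfolding al_def t4 by (simp add: mult_ac)
  have al2: "((\<lambda>k. (-1) ^ k * al k) has_sum 2 / x * (qsum 3 2 x / Q)) UNIV"
    unfolding al_def e using has_sum_inverse_difference_neg[OF mx] by (simp add: b_def t4 Q_def)
  have be1: "(be has_sum - (2 / x) * (qsum 3 2 (-x) / Q)) UNIV"
    unfolding be_def using has_sum_inverse_difference_neg[OF x] by (simp add: a_def t4 Q_def)
  have be2: "((\<lambda>k. (-1) ^ k * be k) has_sum 0) UNIV"
    using has_sum_cmult_right[OF has_sum_inverse_difference[OF mx], of a]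
    unfolding be_def e by (simp add: t4 mult_ac)
  have ic: "qpoch_inf c (x\<^sup>2) = (1 - 1 / x) * a" "qpoch_inf (-c) (x\<^sup>2) = (1 + 1 / x) * b"
  proof -
    have "c * x\<^sup>2 = x" using x(2) by (simp add: c_def power2_eq_square)
    thus "qpoch_inf c (x\<^sup>2) = (1 - 1 / x) * a" "qpoch_inf (-c) (x\<^sup>2) = (1 + 1 / x) * b"
      using qpoch_inf_Suc[OF r, of c] qpoch_inf_Suc[OF r, of "-c"] by (simp_all add: a_def b_def c_def)
  qed
  define V where "V = (\<lambda>k. P / 2 * (b * ((1 + 1 / x) * qpoch (1 / x) (x\<^sup>2) k - qpoch x (x\<^sup>2) k) +
       a * ((1 - 1 / x) * qpoch (-(1 / x)) (x\<^sup>2) k - qpoch (-x) (x\<^sup>2) k)))"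
  define f where "f = (\<lambda>k. x ^ k\<^sup>2 * V k / qpoch t t k)"
  have V: "((\<lambda>j. q ^ j\<^sup>2 * w (k + j) / qpoch t t j) has_sum V k) UNIV" for k
  proof -
    have "((\<lambda>j. q ^ j\<^sup>2 * qpoch (c\<^sup>2) t (k + j) / qpoch t t j + - (q ^ j\<^sup>2 * qpoch (x\<^sup>2) t (k + j) / qpoch t t j)) has_sum
       (P / 2 * (qpoch c (x\<^sup>2) k * qpoch_inf (-c) (x\<^sup>2) + qpoch (-c) (x\<^sup>2) k * qpoch_inf c (x\<^sup>2)) +
       - (P / 2 * (qpoch x (x\<^sup>2) k * qpoch_inf (-x) (x\<^sup>2) + qpoch (-x) (x\<^sup>2) k * qpoch_inf x (x\<^sup>2))))) UNIV"
      unfolding P_def by (intro has_sum_add has_sum_uminusI has_sum_qpoch_kernel[OF x qx tq])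
    also have "P / 2 * (qpoch c (x\<^sup>2) k * qpoch_inf (-c) (x\<^sup>2) + qpoch (-c) (x\<^sup>2) k * qpoch_inf c (x\<^sup>2)) +
       - (P / 2 * (qpoch x (x\<^sup>2) k * qpoch_inf (-x) (x\<^sup>2) + qpoch (-x) (x\<^sup>2) k * qpoch_inf x (x\<^sup>2))) = V k"
      unfolding ic V_def a_def[symmetric] b_def[symmetric] by (simp add: c_def algebra_simps)
    finally show ?thesis
      by (rule has_sum_cong[THEN iffD1, rotated]) (simp add: w_def qx algebra_simps diff_divide_distrib)
  qed
  have S: "(f has_sum P / 2 * (0 + - (2 / x) * (qsum 3 2 (-x) / Q))) UNIV"
    using has_sum_cmult_right[OF has_sum_add[OF al1 be1], of "P / 2"]
    by (rule has_sum_cong[THEN iffD1, rotated])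
       (simp only: f_def V_def al_def be_def distrib_left add_divide_distrib times_divide_eq_right mult.left_commute)
  have T: "((\<lambda>k. (-1) ^ k * f k) has_sum P / 2 * (2 / x * (qsum 3 2 x / Q) + 0)) UNIV"
    using has_sum_cmult_right[OF has_sum_add[OF al2 be2], of "P / 2"]
    by (rule has_sum_cong[THEN iffD1, rotated])
       (simp only: f_def V_def al_def be_def distrib_left add_divide_distrib times_divide_eq_right mult.left_commute)
  have Ev: "((\<lambda>i. q ^ (2 * i\<^sup>2) * V (2 * i) / qpoch t t (2 * i)) has_sum P / Q * qsum 3 2 t) UNIV"
  proof -
    have e: "(P / 2 * (0 + - (2 / x) * (qsum 3 2 (-x) / Q)) + P / 2 * (2 / x * (qsum 3 2 x / Q) + 0)) / 2 =
       P / (2 * x * Q) * (qsum 3 2 x - qsum 3 2 (-x))"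
      by (simp add: algebra_simps diff_divide_distrib)
    have g: "P / (2 * x * Q) * (2 * x * qsum 3 2 t) = P / Q * qsum 3 2 t"
      using x(2) by simp
    show ?thesis
      using has_sum_even_odd(1)[OF S T] unfolding e qsum_parities[OF x] t4 g f_def even_odd_powers qx[symmetric] .
  qed
  have Od: "((\<lambda>i. q ^ (2 * i\<^sup>2 + 2 * i) * V (2 * i + 1) / qpoch t t (2 * i + 1)) has_sum P / (q * Q) * qsum 3 1 t) UNIV"
  proof -
    have e: "1 / x * ((P / 2 * (0 + - (2 / x) * (qsum 3 2 (-x) / Q)) - P / 2 * (2 / x * (qsum 3 2 x / Q) + 0)) / 2) =
       P / (2 * q * Q) * (qsum 3 2 x + qsum 3 2 (-x))"
      using x(2) unfolding qx power2_eq_square by (simp add: divide_simps) (simp add: algebra_simps)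
    have g: "P / (2 * q * Q) * (2 * qsum 3 1 t) = P / (q * Q) * qsum 3 1 t" by simp
    have "((\<lambda>i. 1 / x * f (2 * i + 1)) has_sum P / (q * Q) * qsum 3 1 t) UNIV"
      using has_sum_cmult_right[OF has_sum_even_odd(2)[OF S T], of "1 / x"] unfolding e qsum_parities[OF x] t4 g .
    thus ?thesis
      unfolding f_def even_odd_powers qx[symmetric]
      by (rule has_sum_cong[THEN iffD1, rotated]) (use x in simp)
  qed
  define T where "T = (qsum 2 0 q * (P / Q * qsum 3 2 t) + q * qsum 2 2 q * (P / (q * Q) * qsum 3 1 t)) / qpoch_inf t t"
  define H where "H = (\<lambda>M n1 n2. q powi (nahm_exponent M n1 n2) * w M / (qpoch t t n1 * qpoch t t n2 * qpoch t t M))"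
  have nb: "norm (w M) \<le> (D1 + D2) * 1 ^ M" for M
    using D1(2)[of M] D2(2)[of M] norm_triangle_ineq4[of "qpoch (c\<^sup>2) t M" "qpoch (-q) t M"]
    by (simp add: w_def)
  have "((\<lambda>(M, n1, n2). H M n1 n2) has_sum T) UNIV"
    unfolding T_def H_def by (rule rank_reduction_0[OF q tq _ _ nb V Ev Od]) (use D1 D2 in auto)
  also have "?this \<longleftrightarrow> ((\<lambda>(M, n1, n2). H M n1 n2) has_sum T) (range (\<lambda>(N, p). (Suc N, p)))"
  proof (rule has_sum_cong_neutral)
    fix p :: "nat \<times> nat \<times> nat" assume p: "p \<in> UNIV - range (\<lambda>(N, p). (Suc N, p))"
    obtain M n1 n2 where p': "p = (M, n1, n2)" by (cases p) auto
    have "M = 0"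
    proof (rule ccontr)
      assume "M \<noteq> 0"
      then obtain N where "M = Suc N" by (metis not0_implies_Suc)
      hence "p = (\<lambda>(N, p). (Suc N, p)) (N, n1, n2)" by (simp add: p')
      with p show False by blast
    qed
    thus "(case p of (M, n1, n2) \<Rightarrow> H M n1 n2) = 0" by (simp add: p' H_def w_def)
  qed auto
  also have "\<dots> \<longleftrightarrow> ((\<lambda>(N, n1, n2). H (Suc N) n1 n2) has_sum T) UNIV"
    by (subst has_sum_reindex) (auto simp: inj_on_def o_def case_prod_unfold)
  finally have "((\<lambda>(N, n1, n2). H (Suc N) n1 n2) has_sum T) UNIV" .
  hence "((\<lambda>(N, n1, n2). q powi (nahm_exponent N n1 n2) *
     (1 ^ n1 * (q powi (-2)) ^ n2 * (q\<^sup>2 * 1) ^ N) * qpoch (-(q / 1)) t N / (qpoch t t n1 * qpoch t t n2 * qpoch t t N)) has_sum T) UNIV"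
  proof (rule has_sum_cong[THEN iffD1, rotated])
    fix p :: "nat \<times> nat \<times> nat"
    obtain N n1 n2 where p: "p = (N, n1, n2)" by (cases p) auto
    define E where "E = nahm_exponent N n1 n2"
    have tn: "1 - t * t ^ N \<noteq> 0" by (rule one_minus_power_nonzero[OF t])
    have wS: "w (Suc N) = 1 / q * (1 - t * t ^ N) * qpoch (-q) t N"
    proof -
      have "c\<^sup>2 * t = -q" unfolding c2 tq using q(2) by (simp add: power2_eq_square)
      hence "w (Suc N) = (1 + 1 / q) * qpoch (-q) t N - qpoch (-q) t N * (1 + q * t ^ N)"
        unfolding w_def qpoch_Suc_left[of "c\<^sup>2"] qpoch_Suc[of "-q"] by (simp add: c2)
      also have "\<dots> = (1 / q - q * t ^ N) * qpoch (-q) t N" by (simp add: algebra_simps)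
      also have "1 / q - q * t ^ N = 1 / q * (1 - t * t ^ N)"
        using q(2) by (simp add: tq power2_eq_square right_diff_distrib)
      finally show ?thesis .
    qed
    have ee: "q powi (nahm_exponent (Suc N) n1 n2) * (1 / q) =
       q powi E * ((q powi (-2)) ^ n2 * (q\<^sup>2) ^ N)"
    proof -
      have "(q powi (-2)) ^ n2 * (q\<^sup>2) ^ N = q powi (2 * (int N - int n2))"
        using power_pair_eq[OF q(2), of N n2] by (simp add: mult.commute)
      moreover have "q powi E * q powi (2 * (int N - int n2)) = q powi (E + 2 * (int N - int n2))"
        by (rule powi_mult_eq[OF q(2) refl])
      moreover have "q powi (E + 2 * (int N - int n2)) * q powi 1 =
          q powi (nahm_exponent (Suc N) n1 n2)"
        by (rule powi_mult_eq[OF q(2)]) (simp add: E_def power2_eq_square algebra_simps)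
      ultimately show ?thesis using q(2) by (simp add: divide_eq_eq)
    qed
    have "H (Suc N) n1 n2 = (q powi (nahm_exponent (Suc N) n1 n2) * (1 / q)) *
       qpoch (-q) t N / (qpoch t t n1 * qpoch t t n2 * qpoch t t N) * ((1 - t * t ^ N) / (1 - t * t ^ N))"
      unfolding H_def wS qpoch_Suc[of t t N] by (simp add: mult_ac)
    also have "\<dots> = q powi E * ((q powi (-2)) ^ n2 * (q\<^sup>2) ^ N) * qpoch (-q) t N / (qpoch t t n1 * qpoch t t n2 * qpoch t t N)"
      unfolding ee using tn by simp
    finally show "(case p of (N, n1, n2) \<Rightarrow> H (Suc N) n1 n2) =
       (case p of (N, n1, n2) \<Rightarrow> q powi (nahm_exponent N n1 n2) *
     (1 ^ n1 * (q powi (-2)) ^ n2 * (q\<^sup>2 * 1) ^ N) * qpoch (-(q / 1)) t N / (qpoch t t n1 * qpoch t t n2 * qpoch t t N))"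
      by (simp add: p E_def)
  qed
  hence "chi_sq [1, q powi (-2), q\<^sup>2, 1] q = qpoch_inf (-(1 * q)) t * T"
    by (intro chi_reduction[OF q tq]) simp_all
  thus ?thesis unfolding T_def qsum_2 tq[symmetric] using q(2)
    by (simp add: P_def Q_def algebra_simps add_divide_distrib)
qed

text \<open>For the weights q^M (c)_M the inner sum V(k) is Lebesgue's identity.\<close>

lemma lebesgue_kernel:
  fixes q t c :: complex
  assumes q: "norm q < 1" and tq: "t = q\<^sup>2"
  shows "((\<lambda>j. q ^ j\<^sup>2 * (q ^ (k + j) * qpoch c t (k + j)) / qpoch t t j) has_sum
           q ^ k * qpoch c t k * (qpoch_inf (-t) t * qpoch_inf (c * t ^ k * t) (t\<^sup>2))) UNIV"
proof -
  have t: "norm t < 1" using q by (simp add: tq norm_power_less_1)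
  have "((\<lambda>j. q ^ k * qpoch c t k * (t ^ (j choose 2) * t ^ j * qpoch (c * t ^ k) t j / qpoch t t j)) has_sum
           q ^ k * qpoch c t k * (qpoch_inf (-t) t * qpoch_inf (c * t ^ k * t) (t\<^sup>2))) UNIV"
    by (intro has_sum_cmult_right has_sum_lebesgue t)
  thus ?thesis
  proof (rule has_sum_cong[THEN iffD1, rotated])
    fix j
    have "t ^ (j choose 2) * t ^ j = q ^ j\<^sup>2 * q ^ j"
      by (simp add: tq square_nat_choose_two power_mult[symmetric] power_add[symmetric] add_ac)
    thus "q ^ k * qpoch c t k * (t ^ (j choose 2) * t ^ j * qpoch (c * t ^ k) t j / qpoch t t j) =
       q ^ j\<^sup>2 * (q ^ (k + j) * qpoch c t (k + j)) / qpoch t t j"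
      by (simp add: qpoch_add power_add mult_ac)
  qed
qed

lemma qpoch_even_split: "qpoch a q (2 * n) = qpoch a (q\<^sup>2) n * qpoch (a * q) (q\<^sup>2) n"
  using qpoch_split[of a q 2 n] by (simp add: numeral_2_eq_2)

lemma mult_regroup:
  fixes X Y Z p s u R :: complex
  assumes "X * Y = Z" "p * s = u"
  shows "p * (s * X * (R * Y)) = u * (R * Z)"
  unfolding assms[symmetric] by (simp only: mult_ac)

text \<open>The weight is w(M) = q^M (-1)_M. Even and odd k lead to the numbers 48 and 50 of Slater's list.\<close>

lemma chi_0_0_0_1:
  fixes q t :: complex
  assumes q: "norm q < 1" "q \<noteq> 0" and tq: "t = q\<^sup>2"
  defines "R \<equiv> qpoch_inf (-t) t"
  shows "chi_sq [1, 1, 1, q] q = R / qpoch_inf t t * (R\<^sup>2 / qpoch_inf (t\<^sup>2) (t\<^sup>2)) *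
     (qsum 1 0 t * qsum 3 0 t + q\<^sup>2 * (qsum 1 1 t * qsum 3 3 t))"
proof -
  have t: "norm t < 1" "t \<noteq> 0" using q by (simp_all add: tq norm_power_less_1)
  have t2: "norm (t\<^sup>2) < 1" using t by (simp add: norm_power_less_1)
  obtain D where D: "D \<ge> 1" "\<And>n. norm (qpoch (-1) t n) \<le> D" using qpoch_bounded[OF t(1)] by metis
  define R1 where "R1 = qpoch_inf (-t) (t\<^sup>2)"
  define R2 where "R2 = qpoch_inf (-(t\<^sup>2)) (t\<^sup>2)"
  define U where "U = qpoch_inf (t\<^sup>2) (t\<^sup>2)"
  have R12: "R = R1 * R2"
    using qpoch_inf_split[OF t(1), of 2 "-t"] by (simp add: R_def R1_def R2_def eval_nat_numeral)
  define V where "V = (\<lambda>k. q ^ k * qpoch (-1) t k * (R * qpoch_inf (-1 * t ^ k * t) (t\<^sup>2)))"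
  have V: "((\<lambda>j. q ^ j\<^sup>2 * (q ^ (k + j) * qpoch (-1) t (k + j)) / qpoch t t j) has_sum V k) UNIV" for k
    unfolding V_def R_def by (rule lebesgue_kernel[OF q(1) tq])
  have qt: "q ^ (2 * m) = t ^ m" for m by (simp add: tq power_mult)
  have Ev: "((\<lambda>i. q ^ (2 * i\<^sup>2) * V (2 * i) / qpoch t t (2 * i)) has_sum R * R1 * (R2 / U * qsum 3 0 t)) UNIV"
    using has_sum_cmult_right[OF has_sum_slater48[OF t], of "R * R1"] unfolding R2_def U_def
  proof (rule has_sum_cong[THEN iffD1, rotated])
    fix i
    have "R1 = qpoch (-t) (t\<^sup>2) i * qpoch_inf (-1 * t ^ (2 * i) * t) (t\<^sup>2)"
      using qpoch_inf_shift[OF t2, of "-t" i] by (simp add: R1_def power_mult[symmetric] mult_ac)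
    hence "qpoch (-1) t (2 * i) * qpoch_inf (-1 * t ^ (2 * i) * t) (t\<^sup>2) = qpoch (-1) (t\<^sup>2) i * R1"
      by (simp add: qpoch_even_split[of "-1"])
    moreover have "q ^ (2 * i\<^sup>2) * q ^ (2 * i) = t ^ (i\<^sup>2 + i)" by (simp only: qt power_add)
    ultimately have "q ^ (2 * i\<^sup>2) * V (2 * i) = t ^ (i\<^sup>2 + i) * (R * (qpoch (-1) (t\<^sup>2) i * R1))"
      unfolding V_def by (rule mult_regroup)
    thus "R * R1 * (t ^ (i\<^sup>2 + i) * qpoch (-1) (t\<^sup>2) i / qpoch t t (2 * i)) = q ^ (2 * i\<^sup>2) * V (2 * i) / qpoch t t (2 * i)"
      by (simp add: mult_ac)
  qed
  have Od: "((\<lambda>i. q ^ (2 * i\<^sup>2 + 2 * i) * V (2 * i + 1) / qpoch t t (2 * i + 1)) has_sum 2 * q * R * R2 * (R1 / U * (qsum 3 3 t / 2))) UNIV"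
    using has_sum_cmult_right[OF has_sum_slater50[OF t], of "2 * q * R * R2"] unfolding R1_def U_def
  proof (rule has_sum_cong[THEN iffD1, rotated])
    fix i
    have a: "-(t\<^sup>2) * (t\<^sup>2) ^ i = -1 * t ^ (2 * i + 1) * t"
      unfolding power_add power_double by (simp add: power2_eq_square)
    have R2: "R2 = qpoch (-(t\<^sup>2)) (t\<^sup>2) i * qpoch_inf (-1 * t ^ (2 * i + 1) * t) (t\<^sup>2)"
      unfolding R2_def by (rule qpoch_inf_shift[OF t2, of "-(t\<^sup>2)" i, unfolded a])
    have "qpoch (-1) t (2 * i + 1) = 2 * (qpoch (-t) (t\<^sup>2) i * qpoch (-(t\<^sup>2)) (t\<^sup>2) i)"
      using qpoch_Suc_left[of "-1" t "2 * i"] qpoch_even_split[of "-t" t i] by (simp add: power2_eq_square)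
    hence "qpoch (-1) t (2 * i + 1) * qpoch_inf (-1 * t ^ (2 * i + 1) * t) (t\<^sup>2) = 2 * qpoch (-t) (t\<^sup>2) i * R2"
      by (simp add: R2)
    moreover have "q ^ (2 * i\<^sup>2 + 2 * i) * q ^ (2 * i + 1) = q * t ^ (i\<^sup>2 + 2 * i)"
    proof -
      have "(2 * i\<^sup>2 + 2 * i) + (2 * i + 1) = 2 * (i\<^sup>2 + 2 * i) + 1" by simp
      hence "q ^ (2 * i\<^sup>2 + 2 * i) * q ^ (2 * i + 1) = q ^ (2 * (i\<^sup>2 + 2 * i) + 1)" by (simp only: power_add[symmetric])
      also have "\<dots> = q ^ (2 * (i\<^sup>2 + 2 * i)) * q" by (simp only: power_add power_one_right)
      finally show ?thesis unfolding qt by (simp only: mult.commute)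
    qed
    ultimately have "q ^ (2 * i\<^sup>2 + 2 * i) * V (2 * i + 1) = q * t ^ (i\<^sup>2 + 2 * i) * (R * (2 * qpoch (-t) (t\<^sup>2) i * R2))"
      unfolding V_def by (rule mult_regroup)
    thus "2 * q * R * R2 * (t ^ (i\<^sup>2 + 2 * i) * qpoch (-t) (t\<^sup>2) i / qpoch t t (2 * i + 1)) =
        q ^ (2 * i\<^sup>2 + 2 * i) * V (2 * i + 1) / qpoch t t (2 * i + 1)"
      by (simp add: mult_ac)
  qed
  define T where "T = (qsum 2 0 q * (R * R1 * (R2 / U * qsum 3 0 t)) + q * qsum 2 2 q * (2 * q * R * R2 * (R1 / U * (qsum 3 3 t / 2)))) / qpoch_inf t t"
  have nb: "norm (q ^ M * qpoch (-1) t M) \<le> D * 1 ^ M" for M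
    using D(2)[of M] q(1) by (auto simp: norm_mult norm_power intro!: order_trans[OF mult_left_le_one_le] power_le_one)
  have "((\<lambda>(M, n1, n2). q powi (nahm_exponent M n1 n2) * (q ^ M * qpoch (-1) t M) / (qpoch t t n1 * qpoch t t n2 * qpoch t t M)) has_sum T) UNIV"
    unfolding T_def by (rule rank_reduction_0[OF q tq _ _ nb V Ev Od]) (use D in auto)
  hence "((\<lambda>(N, n1, n2). q powi (nahm_exponent N n1 n2) *
     (1 ^ n1 * 1 ^ n2 * (1 * q) ^ N) * qpoch (-(q / q)) t N / (qpoch t t n1 * qpoch t t n2 * qpoch t t N)) has_sum T) UNIV"
    using q(2) by (simp add: case_prod_unfold mult.assoc)
  hence "chi_sq [1, 1, 1, q] q = qpoch_inf (-(q * q)) t * T"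
    by (intro chi_reduction[OF q tq]) (use q in simp_all)
  also have qq: "q * q = t" by (simp add: tq power2_eq_square)
  finally show ?thesis unfolding T_def qsum_2 tq[symmetric] R_def[symmetric] U_def[symmetric]
    by (simp add: R12 algebra_simps add_divide_distrib power2_eq_square qq)
qed

text \<open>The weight is w(M) = q^M (-t)_M. Even and odd k lead to the numbers 29 and 28 of Slater's list.\<close>

lemma chi_2_m2_2_m1:
  fixes q t :: complex
  assumes q: "norm q < 1" "q \<noteq> 0" and tq: "t = q\<^sup>2"
  defines "R \<equiv> qpoch_inf (-t) t"
  shows "chi_sq [q\<^sup>2, q powi (-2), q\<^sup>2, q powi (-1)] q = qpoch_inf (-1) t / qpoch_inf t t * (R\<^sup>2 / qpoch_inf (t\<^sup>2) (t\<^sup>2)) *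
     (qsum 1 1 t * qsum 3 1 t + qsum 1 0 t * qsum 3 2 t)"
proof -
  have t: "norm t < 1" "t \<noteq> 0" using q by (simp_all add: tq norm_power_less_1)
  have t2: "norm (t\<^sup>2) < 1" using t by (simp add: norm_power_less_1)
  obtain D where D: "D \<ge> 1" "\<And>n. norm (qpoch (-t) t n) \<le> D" using qpoch_bounded[OF t(1)] by metis
  define R1 where "R1 = qpoch_inf (-t) (t\<^sup>2)"
  define R2 where "R2 = qpoch_inf (-(t\<^sup>2)) (t\<^sup>2)"
  define U where "U = qpoch_inf (t\<^sup>2) (t\<^sup>2)"
  have R12: "R = R1 * R2"
    using qpoch_inf_split[OF t(1), of 2 "-t"] by (simp add: R_def R1_def R2_def eval_nat_numeral)
  define V where "V = (\<lambda>k. q ^ k * qpoch (-t) t k * (R * qpoch_inf (-t * t ^ k * t) (t\<^sup>2)))"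
  have V: "((\<lambda>j. q ^ j\<^sup>2 * (q ^ (k + j) * qpoch (-t) t (k + j)) / qpoch t t j) has_sum V k) UNIV" for k
    unfolding V_def R_def by (rule lebesgue_kernel[OF q(1) tq])
  have qt: "q ^ (2 * m) = t ^ m" for m by (simp add: tq power_mult)
  have Ev: "((\<lambda>i. q ^ (4 * (i choose 2)) * V (2 * i) / qpoch t t (2 * i)) has_sum R * R2 * (R1 / U * qsum 3 1 t)) UNIV"
    using has_sum_cmult_right[OF has_sum_slater29[OF t], of "R * R2"] unfolding R1_def U_def
  proof (rule has_sum_cong[THEN iffD1, rotated])
    fix i
    have a: "-(t\<^sup>2) * (t\<^sup>2) ^ i = -t * t ^ (2 * i) * t"
      unfolding power_add power_double by (simp add: power2_eq_square)
    have R2: "R2 = qpoch (-(t\<^sup>2)) (t\<^sup>2) i * qpoch_inf (-t * t ^ (2 * i) * t) (t\<^sup>2)"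
      unfolding R2_def by (rule qpoch_inf_shift[OF t2, of "-(t\<^sup>2)" i, unfolded a])
    have "qpoch (-t) t (2 * i) * qpoch_inf (-t * t ^ (2 * i) * t) (t\<^sup>2) = qpoch (-t) (t\<^sup>2) i * R2"
      unfolding qpoch_even_split[of "-t"] R2 by (simp add: power2_eq_square[of t])
    moreover have "q ^ (4 * (i choose 2)) * q ^ (2 * i) = t ^ i\<^sup>2"
      using qt[of "2 * (i choose 2)"] qt[of i] by (simp add: square_nat_choose_two power_add)
    ultimately have "q ^ (4 * (i choose 2)) * V (2 * i) = t ^ i\<^sup>2 * (R * (qpoch (-t) (t\<^sup>2) i * R2))"
      unfolding V_def by (rule mult_regroup)
    thus "R * R2 * (t ^ i\<^sup>2 * qpoch (-t) (t\<^sup>2) i / qpoch t t (2 * i)) = q ^ (4 * (i choose 2)) * V (2 * i) / qpoch t t (2 * i)"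
      by (simp add: mult_ac)
  qed
  have Od: "((\<lambda>i. q ^ (2 * i\<^sup>2) * V (2 * i + 1) / qpoch t t (2 * i + 1)) has_sum q * R * R1 * (R2 / U * qsum 3 2 t)) UNIV"
    using has_sum_cmult_right[OF has_sum_slater28[OF t], of "q * R * R1"] unfolding R2_def U_def
  proof (rule has_sum_cong[THEN iffD1, rotated])
    fix i
    have a: "-t * (t\<^sup>2) ^ Suc i = -t * t ^ (2 * i + 1) * t"
      unfolding power_add power_double by (simp add: power2_eq_square)
    have R1: "R1 = qpoch (-t) (t\<^sup>2) (Suc i) * qpoch_inf (-t * t ^ (2 * i + 1) * t) (t\<^sup>2)"
      unfolding R1_def by (rule qpoch_inf_shift[OF t2, of "-t" "Suc i", unfolded a])
    have "qpoch (-t) t (2 * i + 1) = qpoch (-t) (t\<^sup>2) (Suc i) * qpoch (-(t\<^sup>2)) (t\<^sup>2) i"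
    proof -
      have p: "t ^ (2 * i) = (t\<^sup>2) ^ i" by (rule power_mult)
      have tt: "-t * t = -(t\<^sup>2)" by (simp add: power2_eq_square)
      show ?thesis unfolding Suc_eq_plus1[symmetric] qpoch_Suc p qpoch_even_split tt by (simp only: mult_ac)
    qed
    hence "qpoch (-t) t (2 * i + 1) * qpoch_inf (-t * t ^ (2 * i + 1) * t) (t\<^sup>2) = qpoch (-(t\<^sup>2)) (t\<^sup>2) i * R1"
      by (simp add: R1)
    moreover have "q ^ (2 * i\<^sup>2) * q ^ (2 * i + 1) = q * t ^ (i\<^sup>2 + i)"
      unfolding power_add qt by (simp add: mult_ac)
    ultimately have "q ^ (2 * i\<^sup>2) * V (2 * i + 1) = q * t ^ (i\<^sup>2 + i) * (R * (qpoch (-(t\<^sup>2)) (t\<^sup>2) i * R1))"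
      unfolding V_def by (rule mult_regroup)
    thus "q * R * R1 * (t ^ (i\<^sup>2 + i) * qpoch (-(t\<^sup>2)) (t\<^sup>2) i / qpoch t t (2 * i + 1)) =
        q ^ (2 * i\<^sup>2) * V (2 * i + 1) / qpoch t t (2 * i + 1)"
      by (simp add: mult_ac)
  qed
  define T where "T = (qsum 2 2 q * (R * R2 * (R1 / U * qsum 3 1 t)) + qsum 2 0 q / q * (q * R * R1 * (R2 / U * qsum 3 2 t))) / qpoch_inf t t"
  have nb: "norm (q ^ M * qpoch (-t) t M) \<le> D * 1 ^ M" for M
    using D(2)[of M] q(1) by (auto simp: norm_mult norm_power intro!: order_trans[OF mult_left_le_one_le] power_le_one)
  have "((\<lambda>(M, n1, n2). q powi (nahm_exponent_shifted M n1 n2) * (q ^ M * qpoch (-t) t M) / (qpoch t t n1 * qpoch t t n2 * qpoch t t M)) has_sum T) UNIV"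
    unfolding T_def by (rule rank_reduction_1[OF q tq _ _ nb V Ev Od]) (use D in auto)
  hence "((\<lambda>(N, n1, n2). q powi (nahm_exponent N n1 n2) *
     ((q\<^sup>2) ^ n1 * (q powi (-2)) ^ n2 * (q\<^sup>2 * q powi (-1)) ^ N) * qpoch (-(q / q powi (-1))) t N / (qpoch t t n1 * qpoch t t n2 * qpoch t t N)) has_sum T) UNIV"
  proof (rule has_sum_cong[THEN iffD1, rotated])
    fix p :: "nat \<times> nat \<times> nat"
    obtain N n1 n2 where p: "p = (N, n1, n2)" by (cases p) auto
    have e: "q powi (nahm_exponent N n1 n2) * q powi (2 * (int n1 - int n2)) =
       q powi (nahm_exponent_shifted N n1 n2)"
      by (rule powi_mult_eq[OF q(2)]) simp
    have e': "q\<^sup>2 * q powi (-1) = q" "q / q powi (-1) = t"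
      using q(2) by (simp_all add: tq power_int_minus power2_eq_square field_simps)
    show "(case p of (M, n1, n2) \<Rightarrow> q powi (nahm_exponent_shifted M n1 n2) * (q ^ M * qpoch (-t) t M) / (qpoch t t n1 * qpoch t t n2 * qpoch t t M)) =
       (case p of (N, n1, n2) \<Rightarrow> q powi (nahm_exponent N n1 n2) *
     ((q\<^sup>2) ^ n1 * (q powi (-2)) ^ n2 * (q\<^sup>2 * q powi (-1)) ^ N) * qpoch (-(q / q powi (-1))) t N / (qpoch t t n1 * qpoch t t n2 * qpoch t t N))"
      unfolding p prod.case power_pair_eq[OF q(2)] e[symmetric] e' by (simp add: mult_ac)
  qed
  hence "chi_sq [q\<^sup>2, q powi (-2), q\<^sup>2, q powi (-1)] q = qpoch_inf (-(q powi (-1) * q)) t * T"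
    by (intro chi_reduction[OF q tq]) (use q in simp_all)
  also have "q powi (-1) * q = 1" using q(2) by (simp add: power_int_minus)
  finally show ?thesis unfolding T_def qsum_2 tq[symmetric] U_def[symmetric] using q(2)
    by (simp add: R12 algebra_simps add_divide_distrib power2_eq_square)
qed

section \<open>The three-term theta relation\<close>

lemma theta_inverse:
  assumes q: "norm q < 1" "q \<noteq> 0" and z: "z \<noteq> 0"
  shows "theta (1 / z) q = - (theta z q / z)"
proof -
  have "theta (1 / z) q = (1 - 1 / z) * qpoch_inf (1 / z * q) q * qpoch_inf (q * z) q * qpoch_inf q q"
    using theta_product[OF q, of "1 / z"] z qpoch_inf_Suc[OF q(1), of "1 / z"] by simp
  moreover have "theta z q = (1 - z) * qpoch_inf (z * q) q * qpoch_inf (q / z) q * qpoch_inf q q"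
    using theta_product[OF q z] qpoch_inf_Suc[OF q(1), of z] by simp
  moreover have "1 - 1 / z = - ((1 - z) / z)" using z by (simp add: field_simps)
  ultimately show ?thesis by (simp add: mult_ac)
qed

text \<open>Together with the next series, this gives coordinates of a two-dimensional space in which products of two theta functions become determinants.\<close>

definition theta_even :: "complex \<Rightarrow> complex \<Rightarrow> complex" where
  "theta_even x q = (\<Sum>\<^sub>\<infinity>k::int. q powi (k\<^sup>2) * x powi (2 * k))"

definition theta_odd :: "complex \<Rightarrow> complex \<Rightarrow> complex" where
  "theta_odd x q = (\<Sum>\<^sub>\<infinity>k::int. q powi (k\<^sup>2 + k) * x powi (2 * k + 1))"

lemma minus_powi: "(- z) powi n = (-1) powi n * z powi n" for z :: complex
  by (subst mult_minus1[symmetric], rule power_int_mult_distrib)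

lemma minus_one_powi_twice: "(-1) powi n * (-1) powi n = (1 :: complex)"
  by (subst power_int_mult_distrib[symmetric]) simp

lemma has_sum_theta_even_odd:
  assumes q: "norm q < 1" "q \<noteq> 0" and x: "x \<noteq> 0"
  shows "((\<lambda>k::int. q powi (k\<^sup>2) * x powi (2 * k)) has_sum theta_even x q) UNIV"
    and "((\<lambda>k::int. q powi (k\<^sup>2 + k) * x powi (2 * k + 1)) has_sum theta_odd x q) UNIV"
proof -
  have q2: "norm (q\<^sup>2) < 1" "q\<^sup>2 \<noteq> 0" using q by (auto simp: norm_power_less_1)
  have e: "(q\<^sup>2) powi (n * (n - 1) div 2) = q powi (n\<^sup>2 - n)" for n :: int
    unfolding powi_double[OF q(2)] by (rule arg_cong[of _ _ "power_int q"]) (simp add: power2_eq_square algebra_simps)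
  have x2: "(x\<^sup>2) powi n = x powi (2 * n)" for n by (rule powi_double[OF x])
  have "(\<lambda>n::int. (-1) powi n * (q\<^sup>2) powi (n * (n - 1) div 2) * (-(q * x\<^sup>2)) powi n) summable_on UNIV"
    by (rule has_sum_imp_summable[OF jacobi_triple_product[OF q2]]) (use q x in auto)
  also have "(\<lambda>n::int. (-1) powi n * (q\<^sup>2) powi (n * (n - 1) div 2) * (-(q * x\<^sup>2)) powi n) =
      (\<lambda>k. q powi (k\<^sup>2) * x powi (2 * k))"
  proof
    fix n :: int
    have "(-1) powi n * (q\<^sup>2) powi (n * (n - 1) div 2) * (-(q * x\<^sup>2)) powi n =
       ((-1) powi n * (-1) powi n) * (q powi (n\<^sup>2 - n) * q powi n) * x powi (2 * n)"
      unfolding minus_powi[of "q * _"] e power_int_mult_distrib x2 by (simp only: mult_ac)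
    also have "q powi (n\<^sup>2 - n) * q powi n = q powi (n\<^sup>2)" by (rule powi_mult_eq[OF q(2)]) simp
    finally show "(-1) powi n * (q\<^sup>2) powi (n * (n - 1) div 2) * (-(q * x\<^sup>2)) powi n = q powi (n\<^sup>2) * x powi (2 * n)"
      by (simp add: minus_one_powi_twice)
  qed
  finally show "((\<lambda>k::int. q powi (k\<^sup>2) * x powi (2 * k)) has_sum theta_even x q) UNIV"
    unfolding theta_even_def by (rule has_sum_infsum)
  have "(\<lambda>n::int. (-1) powi n * (q\<^sup>2) powi (n * (n - 1) div 2) * (-(q\<^sup>2 * x\<^sup>2)) powi n) summable_on UNIV"
    by (rule has_sum_imp_summable[OF jacobi_triple_product[OF q2]]) (use q x in auto)
  hence "(\<lambda>n::int. x * ((-1) powi n * (q\<^sup>2) powi (n * (n - 1) div 2) * (-(q\<^sup>2 * x\<^sup>2)) powi n)) summable_on UNIV"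
    by (rule summable_on_cmult_right)
  also have "(\<lambda>n::int. x * ((-1) powi n * (q\<^sup>2) powi (n * (n - 1) div 2) * (-(q\<^sup>2 * x\<^sup>2)) powi n)) =
      (\<lambda>k. q powi (k\<^sup>2 + k) * x powi (2 * k + 1))"
  proof
    fix n :: int
    have "x * ((-1) powi n * (q\<^sup>2) powi (n * (n - 1) div 2) * (-(q\<^sup>2 * x\<^sup>2)) powi n) =
       ((-1) powi n * (-1) powi n) * (q powi (n\<^sup>2 - n) * q powi (2 * n)) * (x powi (2 * n) * x powi 1)"
      unfolding minus_powi[of "q\<^sup>2 * _"] e power_int_mult_distrib x2 powi_double[OF q(2), of n] by simp
    also have "q powi (n\<^sup>2 - n) * q powi (2 * n) = q powi (n\<^sup>2 + n)" by (rule powi_mult_eq[OF q(2)]) simp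
    also have "x powi (2 * n) * x powi 1 = x powi (2 * n + 1)" by (rule powi_mult_eq[OF x refl])
    finally show "x * ((-1) powi n * (q\<^sup>2) powi (n * (n - 1) div 2) * (-(q\<^sup>2 * x\<^sup>2)) powi n) = q powi (n\<^sup>2 + n) * x powi (2 * n + 1)"
      by (simp add: minus_one_powi_twice)
  qed
  finally show "((\<lambda>k::int. q powi (k\<^sup>2 + k) * x powi (2 * k + 1)) has_sum theta_odd x q) UNIV"
    unfolding theta_odd_def by (rule has_sum_infsum)
qed

lemma has_sum_product:
  fixes f :: "'a \<Rightarrow> complex" and g :: "'b \<Rightarrow> complex"
  assumes "(f has_sum S) UNIV" "(g has_sum T) UNIV"
  shows "((\<lambda>(i, j). f i * g j) has_sum S * T) UNIV"
proof (rule has_sum_iterated_rev)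
  have "(\<lambda>i. norm (f i)) summable_on UNIV" "(\<lambda>j. norm (g j)) summable_on UNIV"
    using assms by (metis has_sum_imp_summable summable_on_iff_abs_summable_on_complex)+
  hence "(\<lambda>(i, j). norm (f i) * norm (g j)) summable_on UNIV \<times> UNIV"
    by (intro summable_on_times_real) auto
  thus "(\<lambda>(i, j). f i * g j) summable_on UNIV"
    unfolding UNIV_Times_UNIV by (rule summable_on_complex_majorant) (auto simp: norm_mult)
  show "((\<lambda>j. f i * g j) has_sum f i * T) UNIV" for i by (intro has_sum_cmult_right assms)
  show "((\<lambda>i. f i * T) has_sum S * T) UNIV" by (intro has_sum_cmult_left assms)
qed

text \<open>In the double series over (m, n) the pairs with m + n even and those with m + n odd are parametrised by
(k + l, k - l) and (k + 1 + l, k - l). In both cases the exponent separates into a part in k and a part in l.\<close>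

lemma theta_times_theta:
  assumes q: "norm q < 1" "q \<noteq> 0" and x: "x \<noteq> 0" and y: "y \<noteq> 0"
  shows "theta (x * y) q * theta (x / y) q = x * (theta_odd x q * theta_even y q - theta_even x q * theta_odd y q)"
proof -
  define f where "f = (\<lambda>z (n::int). (-1) powi n * q powi (n * (n - 1) div 2) * z powi n)"
  have f: "(f z has_sum theta z q) UNIV" if "z \<noteq> 0" for z
    using jacobi_triple_product[OF q that] theta_product[OF q that] by (simp add: f_def)
  define F where "F = (\<lambda>(m, n). f (x * y) m * f (x / y) n)"
  have F: "(F has_sum theta (x * y) q * theta (x / y) q) UNIV"
    unfolding F_def by (rule has_sum_product) (use f x y in auto)
  define g1 where "g1 = (\<lambda>(k, l). (k + l, k - l :: int))"
  define g2 where "g2 = (\<lambda>(k, l). (k + 1 + l, k - l :: int))"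
  have inj: "inj g1" "inj g2" by (auto simp: inj_on_def g1_def g2_def)
  have disj: "range g1 \<inter> range g2 = {}"
    by (auto simp: g1_def g2_def) presburger
  have un: "range g1 \<union> range g2 = UNIV"
  proof -
    have "(m, n) \<in> range g1 \<union> range g2" for m n :: int
    proof (cases "even (m + n)")
      case True
      then obtain k where "m + n = 2 * k" by (elim evenE)
      hence "(m, n) = g1 (k, m - k)" by (simp add: g1_def)
      thus ?thesis by blast
    next
      case False
      then obtain k where "m + n = 2 * k + 1" by (elim oddE)
      hence "(m, n) = g2 (k, m - k - 1)" by (simp add: g2_def)
      thus ?thesis by blast
    qed
    thus ?thesis by auto
  qed
  have half: "q powi (m * (m - 1) div 2) * q powi (n * (n - 1) div 2) = q powi e"
    if "m * (m - 1) + n * (n - 1) = 2 * e" for m n e :: int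
  proof (rule powi_mult_eq[OF q(2)])
    have "2 * (m * (m - 1) div 2) = m * (m - 1)" "2 * (n * (n - 1) div 2) = n * (n - 1)" by simp_all
    thus "m * (m - 1) div 2 + n * (n - 1) div 2 = e" using that by linarith
  qed
  have xy: "(x * y) powi m * (x / y) powi n = x powi (m + n) * y powi (m - n)" for m n
    using x y by (simp add: power_int_mult_distrib power_int_divide_distrib power_int_add power_int_diff)
  have s: "(-1) powi m * (-1) powi n = ((-1) powi (m + n) :: complex)" for m n
    by (simp add: power_int_add)
  have F_eq: "F (m, n) = (-1) powi (m + n) * q powi e * (x powi (m + n) * y powi (m - n))"
    if "m * (m - 1) + n * (n - 1) = 2 * e" for m n e
    unfolding F_def f_def prod.case xy[symmetric] half[OF that, symmetric] s[symmetric] by (simp only: mult_ac)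
  have m1: "(-1) powi (2 * k) = (1 :: complex)" for k :: int
    by (simp add: power_int_mult)
  have m2: "(-1) powi (2 * k + 1) = (-1 :: complex)" for k :: int
    using m1[of k] by (simp add: power_int_add)
  have "((\<lambda>k. q powi (k\<^sup>2 - k) * x powi (2 * k)) has_sum x * theta_odd x q) UNIV"
  proof -
    have "((\<lambda>k. x * (q powi (k\<^sup>2 + k) * x powi (2 * k + 1))) has_sum x * theta_odd x q) UNIV"
      by (intro has_sum_cmult_right has_sum_theta_even_odd q x)
    also have "(\<lambda>k. x * (q powi (k\<^sup>2 + k) * x powi (2 * k + 1))) =
        (\<lambda>k. (\<lambda>k. q powi (k\<^sup>2 - k) * x powi (2 * k)) (k + 1))"
    proof
      fix k :: int
      have 1: "x powi (2 * k + 1) * x powi 1 = x powi (2 * (k + 1))" by (rule powi_mult_eq[OF x]) simp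
      have 2: "k\<^sup>2 + k = (k + 1)\<^sup>2 - (k + 1)" by (simp add: power2_eq_square algebra_simps)
      show "x * (q powi (k\<^sup>2 + k) * x powi (2 * k + 1)) = (\<lambda>k. q powi (k\<^sup>2 - k) * x powi (2 * k)) (k + 1)"
        unfolding 2[symmetric] 1[symmetric] power_int_1_right by (simp only: mult_ac)
    qed
    finally show ?thesis
      by (subst (asm) has_sum_reindex_bij_betw[of "\<lambda>k::int. k + 1" UNIV UNIV])
         (auto intro!: bij_betwI[of _ _ _ "\<lambda>k. k - 1"])
  qed
  from has_sum_product[OF this has_sum_theta_even_odd(1)[OF q y]]
  have "((\<lambda>p. F (g1 p)) has_sum x * theta_odd x q * theta_even y q) UNIV"
  proof (rule has_sum_cong[THEN iffD1, rotated])
    fix p :: "int \<times> int"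
    obtain k l where p: "p = (k, l)" by (cases p)
    have "F (k + l, k - l) = (-1) powi ((k + l) + (k - l)) * q powi (k\<^sup>2 - k + l\<^sup>2) * (x powi ((k + l) + (k - l)) * y powi ((k + l) - (k - l)))"
      by (rule F_eq) (simp add: power2_eq_square algebra_simps)
    also have "(k + l) + (k - l) = 2 * k" by simp
    also have "(k + l) - (k - l) = 2 * l" by simp
    also have "q powi (k\<^sup>2 - k + l\<^sup>2) = q powi (k\<^sup>2 - k) * q powi (l\<^sup>2)" by (rule powi_mult_eq[OF q(2) refl, symmetric])
    finally show "(case p of (i, j) \<Rightarrow> q powi (i\<^sup>2 - i) * x powi (2 * i) * (q powi (j\<^sup>2) * y powi (2 * j))) = F (g1 p)"
      by (simp add: p g1_def m1 mult_ac)
  qed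
  hence S1: "(F has_sum x * theta_odd x q * theta_even y q) (range g1)"
    by (subst has_sum_reindex[OF inj(1)]) (simp add: o_def)
  from has_sum_cmult_right[OF has_sum_product[OF has_sum_theta_even_odd(1)[OF q x] has_sum_theta_even_odd(2)[OF q y]], of "- x"]
  have "((\<lambda>p. F (g2 p)) has_sum - x * (theta_even x q * theta_odd y q)) UNIV"
  proof (rule has_sum_cong[THEN iffD1, rotated])
    fix p :: "int \<times> int"
    obtain k l where p: "p = (k, l)" by (cases p)
    have "F (k + 1 + l, k - l) = (-1) powi ((k + 1 + l) + (k - l)) * q powi (k\<^sup>2 + (l\<^sup>2 + l)) *
       (x powi ((k + 1 + l) + (k - l)) * y powi ((k + 1 + l) - (k - l)))"
      by (rule F_eq) (simp add: power2_eq_square algebra_simps)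
    also have "(k + 1 + l) + (k - l) = 2 * k + 1" by simp
    also have "(k + 1 + l) - (k - l) = 2 * l + 1" by simp
    also have "q powi (k\<^sup>2 + (l\<^sup>2 + l)) = q powi (k\<^sup>2) * q powi (l\<^sup>2 + l)" by (rule powi_mult_eq[OF q(2) refl, symmetric])
    also have "x powi (2 * k + 1) = x powi (2 * k) * x powi 1" by (rule powi_mult_eq[OF x refl, symmetric])
    finally show "- x * (case p of (i, j) \<Rightarrow> q powi (i\<^sup>2) * x powi (2 * i) * (q powi (j\<^sup>2 + j) * y powi (2 * j + 1))) = F (g2 p)"
      by (simp add: p g2_def m2 mult_ac)
  qed
  hence S2: "(F has_sum - x * (theta_even x q * theta_odd y q)) (range g2)"
    by (subst has_sum_reindex[OF inj(2)]) (simp add: o_def)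
  have "(F has_sum (x * theta_odd x q * theta_even y q + - x * (theta_even x q * theta_odd y q))) UNIV"
    using has_sum_Un_disjoint[OF S1 S2 disj] unfolding un .
  from has_sum_unique[OF F this] show ?thesis by (simp add: algebra_simps)
qed

text \<open>Weierstrass' three-term relation. By the preceding theorem each product of two theta functions is a 2 x 2 determinant formed from the vectors
(theta_even, theta_odd) at two of the four points, and the relation is the Pluecker relation between these determinants.\<close>

theorem theta_addition:
  assumes q: "norm q < 1" "q \<noteq> 0" and nz: "x \<noteq> 0" "y \<noteq> 0" "u \<noteq> 0" "v \<noteq> 0"
  shows "theta (x * y) q * theta (x / y) q * (theta (u * v) q * theta (u / v) q) -
         theta (x * v) q * theta (x / v) q * (theta (u * y) q * theta (u / y) q) =
         u / y * (theta (y * v) q * theta (y / v) q * (theta (x * u) q * theta (x / u) q))"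
  unfolding theta_times_theta[OF q nz(1,2)] theta_times_theta[OF q nz(3,4)] theta_times_theta[OF q nz(1,4)]
    theta_times_theta[OF q nz(3,2)] theta_times_theta[OF q nz(2,4)] theta_times_theta[OF q nz(1,3)]
  using nz by (simp add: algebra_simps)

section \<open>Theta series as products over residue classes modulo 24\<close>

text \<open>All moduli in the theorem divide 24, so every product in it is a monomial in these factors; products with a minus sign are quotients of such monomials.\<close>

definition residue_factor :: "complex \<Rightarrow> nat \<Rightarrow> complex" where
  "residue_factor q j = qpoch_inf (q ^ j) (q ^ 24)"

lemma qpoch_inf_power_split:
  assumes "norm q < 1" "d > 0" "k > 0"
  shows "qpoch_inf (q ^ a) (q ^ d) = (\<Prod>i<k. qpoch_inf (q ^ (a + d * i)) (q ^ (d * k)))"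
  using qpoch_inf_split[of "q ^ d" k "q ^ a"] assms
  by (simp add: norm_power_less_1 power_mult[symmetric] power_add[symmetric])

lemma qpoch_inf_neg_power:
  assumes "norm q < 1" "d > 0" "a > 0"
  shows "qpoch_inf (-(q ^ a)) (q ^ d) = qpoch_inf (q ^ (2 * a)) (q ^ (2 * d)) / qpoch_inf (q ^ a) (q ^ d)"
proof -
  have "qpoch_inf (q ^ a) (q ^ d) \<noteq> 0" using assms by (intro qpoch_inf_nonzero_less norm_power_less_1) auto
  moreover have "qpoch_inf (q ^ a) (q ^ d) * qpoch_inf (-(q ^ a)) (q ^ d) = qpoch_inf (q ^ (2 * a)) (q ^ (2 * d))"
    using qpoch_inf_neg_mult[of "q ^ d" "q ^ a"] assms
    by (simp add: norm_power_less_1 power_mult[symmetric] mult.commute)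
  ultimately show ?thesis by (simp add: field_simps)
qed

lemma residue_factor_nonzero:
  assumes "norm q < 1" "j > 0"
  shows "residue_factor q j \<noteq> 0"
  unfolding residue_factor_def using assms by (intro qpoch_inf_nonzero_less norm_power_less_1) auto

lemma residue_factors:
  assumes q: "norm q < 1"
  shows "qpoch_inf (q ^ a) (q ^ 24) = residue_factor q a"
    and "qpoch_inf (q ^ a) (q ^ 12) = residue_factor q a * residue_factor q (a + 12)"
    and "qpoch_inf (q ^ a) (q ^ 8) = residue_factor q a * residue_factor q (a + 8) * residue_factor q (a + 16)"
    and "qpoch_inf (q ^ a) (q ^ 6) = residue_factor q a * residue_factor q (a + 6) * residue_factor q (a + 12) * residue_factor q (a + 18)"
    and "qpoch_inf (q ^ a) (q ^ 4) = residue_factor q a * residue_factor q (a + 4) * residue_factor q (a + 8) *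
           residue_factor q (a + 12) * residue_factor q (a + 16) * residue_factor q (a + 20)"
    and "qpoch_inf (q ^ a) (q ^ 3) = residue_factor q a * residue_factor q (a + 3) * residue_factor q (a + 6) * residue_factor q (a + 9) *
           residue_factor q (a + 12) * residue_factor q (a + 15) * residue_factor q (a + 18) * residue_factor q (a + 21)"
    and "qpoch_inf (q ^ a) (q ^ 2) = residue_factor q a * residue_factor q (a + 2) * residue_factor q (a + 4) * residue_factor q (a + 6) *
           residue_factor q (a + 8) * residue_factor q (a + 10) * residue_factor q (a + 12) * residue_factor q (a + 14) *
           residue_factor q (a + 16) * residue_factor q (a + 18) * residue_factor q (a + 20) * residue_factor q (a + 22)"
proof -
  have *: "qpoch_inf (q ^ a) (q ^ d) = (\<Prod>i<k. residue_factor q (a + d * i))" if "d * k = 24" for d k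
    unfolding residue_factor_def using qpoch_inf_power_split[OF q, of d k a] that by (cases "d = 0 \<or> k = 0") auto
  note [simp] = lessThan_nat_numeral
  show "qpoch_inf (q ^ a) (q ^ 24) = residue_factor q a"
    using *[of 24 1] by simp
  show "qpoch_inf (q ^ a) (q ^ 12) = residue_factor q a * residue_factor q (a + 12)"
    using *[of 12 2] by (simp add: mult_ac)
  show "qpoch_inf (q ^ a) (q ^ 8) = residue_factor q a * residue_factor q (a + 8) * residue_factor q (a + 16)"
    using *[of 8 3] by (simp add: mult_ac)
  show "qpoch_inf (q ^ a) (q ^ 6) = residue_factor q a * residue_factor q (a + 6) * residue_factor q (a + 12) * residue_factor q (a + 18)"
    using *[of 6 4] by (simp add: mult_ac)
  show "qpoch_inf (q ^ a) (q ^ 4) = residue_factor q a * residue_factor q (a + 4) * residue_factor q (a + 8) *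
           residue_factor q (a + 12) * residue_factor q (a + 16) * residue_factor q (a + 20)"
    using *[of 4 6] by (simp add: mult_ac)
  show "qpoch_inf (q ^ a) (q ^ 3) = residue_factor q a * residue_factor q (a + 3) * residue_factor q (a + 6) * residue_factor q (a + 9) *
           residue_factor q (a + 12) * residue_factor q (a + 15) * residue_factor q (a + 18) * residue_factor q (a + 21)"
    using *[of 3 8] by (simp add: mult_ac)
  show "qpoch_inf (q ^ a) (q ^ 2) = residue_factor q a * residue_factor q (a + 2) * residue_factor q (a + 4) * residue_factor q (a + 6) *
           residue_factor q (a + 8) * residue_factor q (a + 10) * residue_factor q (a + 12) * residue_factor q (a + 14) *
           residue_factor q (a + 16) * residue_factor q (a + 18) * residue_factor q (a + 20) * residue_factor q (a + 22)"
    using *[of 2 12] by (simp add: mult_ac)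
qed

lemma J_1_split:
  assumes q: "norm q < 1"
  shows "J q 1 = qpoch_inf (q ^ 1) (q ^ 2) * J q 2"
proof -
  have "{..<2 :: nat} = {0, 1}" by auto
  thus ?thesis
    using qpoch_inf_power_split[OF q, of 1 2 1] by (simp add: J_def power2_eq_square)
qed

lemma J_residue_factors:
  assumes q: "norm q < 1"
  shows "J q 24 = residue_factor q 24"
    and "J q 12 = residue_factor q 12 * residue_factor q 24"
    and "J q 8 = residue_factor q 8 * residue_factor q 16 * residue_factor q 24"
    and "J q 6 = residue_factor q 6 * residue_factor q 12 * residue_factor q 18 * residue_factor q 24"
    and "J q 4 = residue_factor q 4 * residue_factor q 8 * residue_factor q 12 *
           residue_factor q 16 * residue_factor q 20 * residue_factor q 24"
    and "J q 3 = residue_factor q 3 * residue_factor q 6 * residue_factor q 9 * residue_factor q 12 *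
           residue_factor q 15 * residue_factor q 18 * residue_factor q 21 * residue_factor q 24"
    and "J q 2 = residue_factor q 2 * residue_factor q 4 * residue_factor q 6 * residue_factor q 8 *
           residue_factor q 10 * residue_factor q 12 * residue_factor q 14 * residue_factor q 16 *
           residue_factor q 18 * residue_factor q 20 * residue_factor q 22 * residue_factor q 24"
    and "J q 1 = residue_factor q 1 * residue_factor q 3 * residue_factor q 5 * residue_factor q 7 *
           residue_factor q 9 * residue_factor q 11 * residue_factor q 13 * residue_factor q 15 *
           residue_factor q 17 * residue_factor q 19 * residue_factor q 21 * residue_factor q 23 * J q 2"
  unfolding J_1_split[OF q] unfolding J_def residue_factors[OF q] by (simp_all del: add_2_eq_Suc add_2_eq_Suc')

lemma J_nonzero:
  assumes "norm q < 1" "m > 0"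
  shows "J q m \<noteq> 0"
  unfolding J_def using assms by (intro qpoch_inf_nonzero_less norm_power_less_1) auto

lemma JJ_nonzero:
  assumes q: "norm q < 1" and a: "0 < a" "a < m"
  shows "JJ q a m \<noteq> 0"
proof -
  have "qpoch_inf (q ^ b) (q ^ m) \<noteq> 0" if "b > 0" for b
    using q a that by (intro qpoch_inf_nonzero_less norm_power_less_1) auto
  thus ?thesis using a by (simp add: JJ_def qpochs_inf_def)
qed

lemma JJ_expand: "JJ q a m = qpoch_inf (q ^ a) (q ^ m) * qpoch_inf (q ^ (m - a)) (q ^ m) * J q m"
  by (simp add: JJ_def qpochs_inf_def J_def mult.assoc)

lemma power5_eq: "x ^ 5 = x * x * x * x * (x::complex)" by (simp add: eval_nat_numeral)

lemma JJ_relations: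
  assumes q: "norm q < 1"
  shows "JJ q 2 24 * JJ q 10 24 = J q 24 ^ 2 * J q 2 * J q 12 / (J q 4 * J q 6)"
    and "JJ q 4 24 = J q 4 * J q 24 ^ 2 / (J q 8 * J q 12)"
    and "JJ q 6 24 = J q 6 * J q 24 / J q 12"
    and "JJ q 8 24 = J q 8"
    and "JJ q 1 12 * JJ q 5 12 = J q 12 ^ 2 * J q 1 * J q 6 / (J q 2 * J q 3)"
    and "JJ q 5 24 * JJ q 7 24 = J q 24 ^ 2 * JJ q 5 12 / J q 12"
    and "JJ q 2 12 = J q 2 * J q 12 ^ 2 / (J q 4 * J q 6)"
  unfolding JJ_expand residue_factors[OF q] J_residue_factors[OF q]
  using residue_factor_nonzero[OF q]
  by (simp_all add: field_simps power2_eq_square)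

lemma theta_power:
  assumes "norm q < 1" "q \<noteq> 0" "0 < a" "a < m"
  shows "theta (q ^ a) (q ^ m) = JJ q a m"
proof -
  have "q ^ m / q ^ a = q ^ (m - a)" using assms by (simp add: power_diff)
  thus ?thesis using theta_product[of "q ^ m" "q ^ a"] assms
    by (simp add: norm_power_less_1 JJ_expand J_def)
qed

lemma theta_neg_power:
  assumes "norm q < 1" "q \<noteq> 0" "0 < a" "a < m"
  shows "theta (-(q ^ a)) (q ^ m) =
    qpoch_inf (-(q ^ a)) (q ^ m) * qpoch_inf (-(q ^ (m - a))) (q ^ m) * J q m"
proof -
  have "q ^ m / (-(q ^ a)) = -(q ^ (m - a))" using assms by (simp add: power_diff)
  thus ?thesis using theta_product[of "q ^ m" "-(q ^ a)"] assms
    by (simp add: norm_power_less_1 J_def)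
qed

lemma theta_minus_1:
  assumes "norm q < 1" "q \<noteq> 0" "0 < m"
  shows "theta (-1) (q ^ m) = 2 * qpoch_inf (-(q ^ m)) (q ^ m) ^ 2 * J q m"
  using theta_product[of "q ^ m" "-1"] qpoch_inf_Suc[of "q ^ m" "-1"] assms
  by (simp add: norm_power_less_1 J_def power2_eq_square)

lemma qpoch_inf_neg_split_12:
  assumes "norm q < 1"
  shows "qpoch_inf (-(q ^ a)) (q ^ 12) = qpoch_inf (-(q ^ a)) (q ^ 24) * qpoch_inf (-(q ^ (a + 12))) (q ^ 24)"
proof -
  have "{..<2 :: nat} = {0, 1}" by auto
  thus ?thesis using qpoch_inf_split[of "q ^ 12" 2 "-(q ^ a)"] assms
    by (simp add: norm_power_less_1 power_mult[symmetric] power_add)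
qed

lemma theta_products_24:
  assumes q: "norm q < 1" "q \<noteq> 0"
  shows "theta (-(q ^ 12)) (q ^ 24) * theta (-1) (q ^ 24) = 2 * J q 24 ^ 4 / J q 12 ^ 2"
    and "theta (-(q ^ 8)) (q ^ 24) * theta (-(q ^ 4)) (q ^ 24) = J q 8 * J q 12 * J q 24 / J q 4"
    and "theta (-(q ^ 10)) (q ^ 24) * theta (-(q ^ 2)) (q ^ 24) = J q 4 ^ 2 * J q 6 * J q 24 ^ 3 / (J q 2 * J q 8 * J q 12 ^ 2)"
proof -
  note n = qpoch_inf_neg_split_12[OF q(1)]
  note m = qpoch_inf_neg_power[OF q(1)]
  note u = residue_factor_nonzero[OF q(1)]
  have "theta (-(q ^ 12)) (q ^ 24) * theta (-1) (q ^ 24) = 2 * qpoch_inf (-(q ^ 12)) (q ^ 12) ^ 2 * J q 24 ^ 2"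
    unfolding n[of 12] by (simp add: theta_neg_power[OF q] theta_minus_1[OF q] power2_eq_square)
  also have "\<dots> = 2 * J q 24 ^ 4 / J q 12 ^ 2"
    unfolding J_residue_factors[OF q(1)] using u by (simp add: m residue_factors[OF q(1)] field_simps)
  finally show "theta (-(q ^ 12)) (q ^ 24) * theta (-1) (q ^ 24) = 2 * J q 24 ^ 4 / J q 12 ^ 2" .
  have "theta (-(q ^ 8)) (q ^ 24) * theta (-(q ^ 4)) (q ^ 24) =
      qpoch_inf (-(q ^ 8)) (q ^ 12) * qpoch_inf (-(q ^ 4)) (q ^ 12) * J q 24 ^ 2"
    unfolding n[of 8] n[of 4] by (simp add: theta_neg_power[OF q] power2_eq_square)
  also have "\<dots> = J q 8 * J q 12 * J q 24 / J q 4"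
    unfolding J_residue_factors[OF q(1)] using u by (simp add: m residue_factors[OF q(1)] field_simps power2_eq_square)
  finally show "theta (-(q ^ 8)) (q ^ 24) * theta (-(q ^ 4)) (q ^ 24) = J q 8 * J q 12 * J q 24 / J q 4" .
  have "theta (-(q ^ 10)) (q ^ 24) * theta (-(q ^ 2)) (q ^ 24) =
      qpoch_inf (-(q ^ 10)) (q ^ 12) * qpoch_inf (-(q ^ 2)) (q ^ 12) * J q 24 ^ 2"
    unfolding n[of 10] n[of 2] power2_eq_square[of "J q 24"] by (simp add: theta_neg_power[OF q])
  also have "\<dots> = J q 4 ^ 2 * J q 6 * J q 24 ^ 3 / (J q 2 * J q 8 * J q 12 ^ 2)"
    unfolding J_residue_factors[OF q(1)] using u
    by (simp add: m residue_factors[OF q(1)]) (simp add: field_simps power2_eq_square power3_eq_cube)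
  finally show "theta (-(q ^ 10)) (q ^ 24) * theta (-(q ^ 2)) (q ^ 24) =
      J q 4 ^ 2 * J q 6 * J q 24 ^ 3 / (J q 2 * J q 8 * J q 12 ^ 2)" .
qed

lemma theta_products_12:
  assumes q: "norm q < 1" "q \<noteq> 0"
  shows "theta (-(q ^ 4)) (q ^ 12) * theta (q ^ 4) (q ^ 12) = J q 8 * J q 12 ^ 2 / J q 24"
    and "theta (-(q ^ 2)) (q ^ 12) * theta (q ^ 2) (q ^ 12) = J q 4 * J q 24 * J q 12 / J q 8"
    and "theta (q ^ 3) (q ^ 12) * theta (-(q ^ 3)) (q ^ 12) = J q 6 * J q 12"
    and "theta (-(q ^ 6)) (q ^ 12) = J q 12 ^ 5 / (J q 6 ^ 2 * J q 24 ^ 2)"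
    and "theta (-(q ^ 5)) (q ^ 12) = J q 12 ^ 2 * JJ q 10 24 / (J q 24 * JJ q 5 12)"
    and "theta (-(q ^ 1)) (q ^ 12) = J q 12 ^ 2 * JJ q 2 24 / (J q 24 * JJ q 1 12)"
proof -
  note u = residue_factor_nonzero[OF q(1)]
  note n = qpoch_inf_neg_power[OF q(1)]
  note r = residue_factors[OF q(1)] J_residue_factors[OF q(1)]
  have *: "theta (-(q ^ a)) (q ^ 12) * theta (q ^ a) (q ^ 12) =
      qpoch_inf (q ^ (2 * a)) (q ^ 24) * qpoch_inf (q ^ (2 * (12 - a))) (q ^ 24) * J q 12 ^ 2"
    if "0 < a" "a < 12" for a
    using that theta_power[OF q, of a 12] theta_neg_power[OF q, of a 12] n[of 12 a] n[of 12 "12 - a"]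
      J_nonzero[OF q(1), of 12] qpoch_inf_nonzero_less[of "q ^ 12" "q ^ a"] qpoch_inf_nonzero_less[of "q ^ 12" "q ^ (12 - a)"] q
    by (simp add: JJ_expand norm_power_less_1 power2_eq_square)
  show "theta (-(q ^ 4)) (q ^ 12) * theta (q ^ 4) (q ^ 12) = J q 8 * J q 12 ^ 2 / J q 24"
    using *[of 4] u by (simp add: r)
  show "theta (-(q ^ 2)) (q ^ 12) * theta (q ^ 2) (q ^ 12) = J q 4 * J q 24 * J q 12 / J q 8"
    using *[of 2] u by (simp add: r) (simp add: power2_eq_square)
  show "theta (q ^ 3) (q ^ 12) * theta (-(q ^ 3)) (q ^ 12) = J q 6 * J q 12"
    using *[of 3] u by (simp add: r mult.commute[of "theta (q ^ 3) _"]) (simp add: power2_eq_square)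
  have "theta (-(q ^ 6)) (q ^ 12) = qpoch_inf (-(q ^ 6)) (q ^ 12) ^ 2 * J q 12"
    by (simp add: theta_neg_power[OF q] power2_eq_square)
  also have "\<dots> = J q 12 ^ 5 / (J q 6 ^ 2 * J q 24 ^ 2)"
    unfolding r using u by (simp add: n r field_simps power2_eq_square power5_eq)
  finally show "theta (-(q ^ 6)) (q ^ 12) = J q 12 ^ 5 / (J q 6 ^ 2 * J q 24 ^ 2)" .
  have "JJ q 5 12 * theta (-(q ^ 5)) (q ^ 12) = J q 12 ^ 2 * JJ q 10 24 / J q 24"
    using *[of 5] theta_power[OF q, of 5 12] J_nonzero[OF q(1), of 24] by (simp add: JJ_expand mult_ac)
  thus "theta (-(q ^ 5)) (q ^ 12) = J q 12 ^ 2 * JJ q 10 24 / (J q 24 * JJ q 5 12)"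
    using JJ_nonzero[OF q(1), of 5 12] J_nonzero[OF q(1), of 24] by (simp add: field_simps)
  have "JJ q 1 12 * theta (-(q ^ 1)) (q ^ 12) = J q 12 ^ 2 * JJ q 2 24 / J q 24"
    using *[of 1] theta_power[OF q, of 1 12] J_nonzero[OF q(1), of 24] by (simp add: JJ_expand mult_ac)
  thus "theta (-(q ^ 1)) (q ^ 12) = J q 12 ^ 2 * JJ q 2 24 / (J q 24 * JJ q 1 12)"
    using JJ_nonzero[OF q(1), of 1 12] J_nonzero[OF q(1), of 24] by (simp add: field_simps)
qed

lemma qpoch_products:
  assumes q: "norm q < 1" "q \<noteq> 0"
  shows "qpoch_inf (-q) (q ^ 2) = J q 2 ^ 2 / (J q 1 * J q 4)"
    and "qpoch_inf (q ^ 2) (q ^ 2) = J q 2"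
    and "qpoch_inf (-(q ^ 2)) (q ^ 2) = J q 4 / J q 2"
    and "qpoch_inf ((q ^ 2) ^ 2) ((q ^ 2) ^ 2) = J q 4"
proof -
  note nz = J_nonzero[OF q(1)]
  have "qpoch_inf (q ^ 2) (q ^ 4) * J q 4 = J q 2"
    unfolding J_residue_factors[OF q(1)] residue_factors[OF q(1)] by simp
  hence a: "qpoch_inf (q ^ 2) (q ^ 4) = J q 2 / J q 4" using nz[of 4] by (simp add: field_simps)
  have "qpoch_inf (q ^ 1) (q ^ 2) * J q 2 = J q 1" by (simp only: J_1_split[OF q(1)])
  hence b: "qpoch_inf (q ^ 1) (q ^ 2) = J q 1 / J q 2" using nz[of 2] by (simp add: field_simps)
  have "qpoch_inf (-(q ^ 1)) (q ^ 2) = qpoch_inf (q ^ 2) (q ^ 4) / qpoch_inf (q ^ 1) (q ^ 2)"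
    using qpoch_inf_neg_power[OF q(1), of 2 1] by simp
  thus "qpoch_inf (-q) (q ^ 2) = J q 2 ^ 2 / (J q 1 * J q 4)"
    unfolding a b by (simp add: power2_eq_square mult.commute)
  show "qpoch_inf (q ^ 2) (q ^ 2) = J q 2" by (simp add: J_def)
  show "qpoch_inf (-(q ^ 2)) (q ^ 2) = J q 4 / J q 2"
    by (simp add: qpoch_inf_neg_power[OF q(1)] J_def)
  show "qpoch_inf ((q ^ 2) ^ 2) ((q ^ 2) ^ 2) = J q 4" by (simp add: J_def power_mult[symmetric])
qed

lemma qsum_products:
  assumes q: "norm q < 1" "q \<noteq> 0"
  shows "qsum 1 0 (q ^ 2) = J q 4 ^ 5 / (J q 2 ^ 2 * J q 8 ^ 2)"
    and "qsum 1 1 (q ^ 2) = 2 * J q 8 ^ 2 / J q 4"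
    and "qsum 3 0 (q ^ 2) = J q 12 ^ 5 / (J q 6 ^ 2 * J q 24 ^ 2)"
    and "qsum 3 3 (q ^ 2) = 2 * J q 24 ^ 2 / J q 12"
    and "qsum 3 1 (q ^ 2) = J q 8 * J q 12 ^ 2 / (J q 4 * J q 24)"
    and "qsum 3 2 (q ^ 2) = J q 4 ^ 2 * J q 6 * J q 24 / (J q 2 * J q 8 * J q 12)"
proof -
  have t: "norm (q ^ 2) < 1" "q ^ 2 \<noteq> 0" using q by (simp_all add: norm_power_less_1)
  note u = residue_factor_nonzero[OF q(1)]
  note n = qpoch_inf_neg_power[OF q(1)]
  have two: "qpoch_inf (-1) (q ^ m) = 2 * qpoch_inf (-(q ^ m)) (q ^ m)" if "m > 0" for m
    using qpoch_inf_Suc[of "q ^ m" "-1"] q that by (simp add: norm_power_less_1)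
  have "qsum 1 0 (q ^ 2) = (qpoch_inf (-(q ^ 2)) (q ^ 4) * qpoch_inf (-(q ^ 2)) (q ^ 4)) * J q 4"
    unfolding J_def by (simp add: qsum_product[OF t] flip: power_mult)
  also have "\<dots> = J q 4 ^ 5 / (J q 2 ^ 2 * J q 8 ^ 2)"
    unfolding J_residue_factors[OF q(1)] using u by (simp add: n residue_factors[OF q(1)]) (simp add: field_simps power2_eq_square power5_eq)
  finally show "qsum 1 0 (q ^ 2) = J q 4 ^ 5 / (J q 2 ^ 2 * J q 8 ^ 2)" .
  have "qsum 1 1 (q ^ 2) = 2 * (qpoch_inf (-(q ^ 4)) (q ^ 4) * qpoch_inf (-(q ^ 4)) (q ^ 4)) * J q 4"
    unfolding J_def using two[of 4] by (simp add: qsum_product[OF t] flip: power_mult)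
  also have "\<dots> = 2 * J q 8 ^ 2 / J q 4"
    unfolding J_residue_factors[OF q(1)] using u by (simp add: n residue_factors[OF q(1)]) (simp add: field_simps power2_eq_square)
  finally show "qsum 1 1 (q ^ 2) = 2 * J q 8 ^ 2 / J q 4" .
  have "qsum 3 0 (q ^ 2) = (qpoch_inf (-(q ^ 6)) (q ^ 12) * qpoch_inf (-(q ^ 6)) (q ^ 12)) * J q 12"
    unfolding J_def by (simp add: qsum_product[OF t] flip: power_mult)
  also have "\<dots> = J q 12 ^ 5 / (J q 6 ^ 2 * J q 24 ^ 2)"
    unfolding J_residue_factors[OF q(1)] using u by (simp add: n residue_factors[OF q(1)]) (simp add: field_simps power2_eq_square power5_eq)
  finally show "qsum 3 0 (q ^ 2) = J q 12 ^ 5 / (J q 6 ^ 2 * J q 24 ^ 2)" .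
  have "qsum 3 3 (q ^ 2) = 2 * (qpoch_inf (-(q ^ 12)) (q ^ 12) * qpoch_inf (-(q ^ 12)) (q ^ 12)) * J q 12"
    unfolding J_def using two[of 12] by (simp add: qsum_product[OF t] flip: power_mult)
  also have "\<dots> = 2 * J q 24 ^ 2 / J q 12"
    unfolding J_residue_factors[OF q(1)] using u by (simp add: n residue_factors[OF q(1)]) (simp add: field_simps power2_eq_square)
  finally show "qsum 3 3 (q ^ 2) = 2 * J q 24 ^ 2 / J q 12" .
  have "qsum 3 1 (q ^ 2) = qpoch_inf (-(q ^ 8)) (q ^ 12) * qpoch_inf (-(q ^ 4)) (q ^ 12) * J q 12"
    unfolding J_def by (simp add: qsum_product[OF t] flip: power_mult)
  also have "\<dots> = J q 8 * J q 12 ^ 2 / (J q 4 * J q 24)"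
    unfolding J_residue_factors[OF q(1)] using u by (simp add: n residue_factors[OF q(1)]) (simp add: field_simps power2_eq_square)
  finally show "qsum 3 1 (q ^ 2) = J q 8 * J q 12 ^ 2 / (J q 4 * J q 24)" .
  have "qsum 3 2 (q ^ 2) = qpoch_inf (-(q ^ 10)) (q ^ 12) * qpoch_inf (-(q ^ 2)) (q ^ 12) * J q 12"
    unfolding J_def by (simp add: qsum_product[OF t] flip: power_mult)
  also have "\<dots> = J q 4 ^ 2 * J q 6 * J q 24 / (J q 2 * J q 8 * J q 12)"
    unfolding J_residue_factors[OF q(1)] using u by (simp add: n residue_factors[OF q(1)]) (simp add: field_simps power2_eq_square)
  finally show "qsum 3 2 (q ^ 2) = J q 4 ^ 2 * J q 6 * J q 24 / (J q 2 * J q 8 * J q 12)" .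
qed

section \<open>The product formulas\<close>

text \<open>Four instances of the three-term relation, two with base q^24 and two with base q^12. The points are chosen such that, apart from common factors,
the three terms are the two theta series to be combined and their sum or difference. For base q^12 all points carry a factor \<i>, because then the product and
the quotient of two points have opposite signs.\<close>

lemma theta_relations:
  assumes q: "norm q < 1" "q \<noteq> 0"
  shows "JJ q 10 24 * JJ q 6 24 * (theta (-(q ^ 12)) (q ^ 24) * theta (-1) (q ^ 24)) =
           theta (-(q ^ 10)) (q ^ 24) * theta (-(q ^ 2)) (q ^ 24) * (JJ q 8 24 * JJ q 4 24) +
           theta (-(q ^ 8)) (q ^ 24) * theta (-(q ^ 4)) (q ^ 24) * (JJ q 10 24 * JJ q 2 24)"
    and "JJ q 8 24 * JJ q 4 24 * (theta (-(q ^ 10)) (q ^ 24) * theta (-(q ^ 2)) (q ^ 24)) -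
           JJ q 10 24 * JJ q 2 24 * (theta (-(q ^ 8)) (q ^ 24) * theta (-(q ^ 4)) (q ^ 24)) =
           q ^ 2 * (JJ q 6 24 * JJ q 2 24 * (theta (-(q ^ 12)) (q ^ 24) * theta (-1) (q ^ 24)))"
    and "theta (-(q ^ 4)) (q ^ 12) * theta (q ^ 4) (q ^ 12) * (theta (-(q ^ 5)) (q ^ 12) * JJ q 1 12) +
           q * (theta (-(q ^ 2)) (q ^ 12) * theta (q ^ 2) (q ^ 12) * (theta (-(q ^ 5)) (q ^ 12) * JJ q 1 12)) =
           theta (-(q ^ 6)) (q ^ 12) * JJ q 2 12 * (theta (q ^ 3) (q ^ 12) * theta (-(q ^ 3)) (q ^ 12))"
    and "theta (-(q ^ 4)) (q ^ 12) * theta (q ^ 4) (q ^ 12) * (JJ q 5 12 * theta (-(q ^ 1)) (q ^ 12)) -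
           q * (theta (-(q ^ 2)) (q ^ 12) * theta (q ^ 2) (q ^ 12) * (JJ q 5 12 * theta (-(q ^ 1)) (q ^ 12))) =
           theta (-(q ^ 6)) (q ^ 12) * JJ q 2 12 * (theta (q ^ 3) (q ^ 12) * theta (-(q ^ 3)) (q ^ 12))"
proof -
  have b: "norm (q ^ m) < 1" "q ^ m \<noteq> 0" if "m > 0" for m
    using q that by (auto simp: norm_power_less_1)
  have b24: "norm (q ^ 24) < 1" "q ^ 24 \<noteq> 0" and b12: "norm (q ^ 12) < 1" "q ^ 12 \<noteq> 0" by (rule b; simp)+
  have ii: "\<i> * x * (\<i> * y) = - (x * y)" "\<i> * x * \<i> = - x" for x y
  proof -
    have "\<i> * x * (\<i> * y) = (\<i> * \<i>) * (x * y)" "\<i> * x * \<i> = (\<i> * \<i>) * x" by (simp_all only: mult_ac)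
    thus "\<i> * x * (\<i> * y) = - (x * y)" "\<i> * x * \<i> = - x" by simp_all
  qed
  have P: "theta (q ^ a) (q ^ m) = JJ q a m" if "0 < a" "a < m" for a m using theta_power[OF q that] .
  have sym: "theta (-(q ^ 14)) (q ^ 24) = theta (-(q ^ 10)) (q ^ 24)"
            "theta (q ^ 14) (q ^ 24) = theta (q ^ 10) (q ^ 24)"
            "theta (-(q ^ 7)) (q ^ 12) = theta (-(q ^ 5)) (q ^ 12)"
            "theta (q ^ 7) (q ^ 12) = theta (q ^ 5) (q ^ 12)"
    by (simp_all add: theta_neg_power[OF q] theta_power[OF q] JJ_expand)
  have inv: "theta (-1 / q ^ 4) (q ^ 24) = theta (-(q ^ 4)) (q ^ 24) / q ^ 4"
            "theta (1 / q ^ 2) (q ^ 24) = - theta (q ^ 2) (q ^ 24) / q ^ 2"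
            "theta (1 / q ^ 2) (q ^ 12) = - theta (q ^ 2) (q ^ 12) / q ^ 2"
    using theta_inverse[OF b24, of "-(q ^ 4)"] theta_inverse[OF b24, of "q ^ 2"]
      theta_inverse[OF b12, of "q ^ 2"] q by simp_all
  show "JJ q 10 24 * JJ q 6 24 * (theta (-(q ^ 12)) (q ^ 24) * theta (-1) (q ^ 24)) =
           theta (-(q ^ 10)) (q ^ 24) * theta (-(q ^ 2)) (q ^ 24) * (JJ q 8 24 * JJ q 4 24) +
           theta (-(q ^ 8)) (q ^ 24) * theta (-(q ^ 4)) (q ^ 24) * (JJ q 10 24 * JJ q 2 24)"
  proof -
    let ?x = "q ^ 8" and ?y = "q ^ 2" and ?u = "q ^ 6" and ?v = "-(q ^ 6)"
    have e: "?x * ?y = q ^ 10" "?x / ?y = q ^ 6" "?u * ?v = -(q ^ 12)" "?u / ?v = -1" "?x * ?v = -(q ^ 14)"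
      "?x / ?v = -(q ^ 2)" "?u * ?y = q ^ 8" "?u / ?y = q ^ 4" "?y * ?v = -(q ^ 8)" "?y / ?v = -1 / q ^ 4"
      "?x * ?u = q ^ 14" "?x / ?u = q ^ 2"
      using q by (simp_all add: field_simps flip: power_add)
    have nz: "?x \<noteq> 0" "?y \<noteq> 0" "?u \<noteq> 0" "?v \<noteq> 0" using q by auto
    from theta_addition[OF b24 nz, unfolded e sym inv] show ?thesis
      using q by (simp add: P field_simps)
  qed
  show "JJ q 8 24 * JJ q 4 24 * (theta (-(q ^ 10)) (q ^ 24) * theta (-(q ^ 2)) (q ^ 24)) -
           JJ q 10 24 * JJ q 2 24 * (theta (-(q ^ 8)) (q ^ 24) * theta (-(q ^ 4)) (q ^ 24)) =
           q ^ 2 * (JJ q 6 24 * JJ q 2 24 * (theta (-(q ^ 12)) (q ^ 24) * theta (-1) (q ^ 24)))"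
  proof -
    let ?x = "q ^ 6" and ?y = "q ^ 2" and ?u = "-(q ^ 6)" and ?v = "q ^ 4"
    have e: "?x * ?y = q ^ 8" "?x / ?y = q ^ 4" "?u * ?v = -(q ^ 10)" "?u / ?v = -(q ^ 2)" "?x * ?v = q ^ 10"
      "?x / ?v = q ^ 2" "?u * ?y = -(q ^ 8)" "?u / ?y = -(q ^ 4)" "?y * ?v = q ^ 6" "?y / ?v = 1 / q ^ 2"
      "?x * ?u = -(q ^ 12)" "?x / ?u = -1"
      using q by (simp_all add: field_simps flip: power_add)
    have nz: "?x \<noteq> 0" "?y \<noteq> 0" "?u \<noteq> 0" "?v \<noteq> 0" using q by auto
    from theta_addition[OF b24 nz, unfolded e sym inv] show ?thesis
      using q by (simp add: P) (simp add: eval_nat_numeral)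
  qed
  show "theta (-(q ^ 4)) (q ^ 12) * theta (q ^ 4) (q ^ 12) * (theta (-(q ^ 5)) (q ^ 12) * JJ q 1 12) +
           q * (theta (-(q ^ 2)) (q ^ 12) * theta (q ^ 2) (q ^ 12) * (theta (-(q ^ 5)) (q ^ 12) * JJ q 1 12)) =
           theta (-(q ^ 6)) (q ^ 12) * JJ q 2 12 * (theta (q ^ 3) (q ^ 12) * theta (-(q ^ 3)) (q ^ 12))"
  proof -
    let ?x = "\<i> * q ^ 4" and ?y = "\<i>" and ?u = "\<i> * q ^ 3" and ?v = "\<i> * q ^ 2"
    have e: "?x * ?y = -(q ^ 4)" "?x / ?y = q ^ 4" "?u * ?v = -(q ^ 5)" "?u / ?v = q ^ 1" "?x * ?v = -(q ^ 6)"
      "?x / ?v = q ^ 2" "?u * ?y = -(q ^ 3)" "?u / ?y = q ^ 3" "?y * ?v = -(q ^ 2)" "?y / ?v = 1 / q ^ 2"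
      "?x * ?u = -(q ^ 7)" "?x / ?u = q ^ 1"
      using q by (simp_all add: ii eval_nat_numeral)
    have nz: "?x \<noteq> 0" "?y \<noteq> 0" "?u \<noteq> 0" "?v \<noteq> 0" using q by auto
    have s: "q ^ 3 * (A * - (B / q ^ 2) * C) = - (q * (A * B * C))" for A B C
      using q by (simp add: eval_nat_numeral)
    note T = theta_addition[OF b12 nz, unfolded e sym inv P[of 1 12, simplified]]
    show ?thesis using T P[of 1 12] P[of 2 12]
      unfolding minus_divide_left[symmetric] s by (simp add: algebra_simps)
  qed
  show "theta (-(q ^ 4)) (q ^ 12) * theta (q ^ 4) (q ^ 12) * (JJ q 5 12 * theta (-(q ^ 1)) (q ^ 12)) -
           q * (theta (-(q ^ 2)) (q ^ 12) * theta (q ^ 2) (q ^ 12) * (JJ q 5 12 * theta (-(q ^ 1)) (q ^ 12))) =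
           theta (-(q ^ 6)) (q ^ 12) * JJ q 2 12 * (theta (q ^ 3) (q ^ 12) * theta (-(q ^ 3)) (q ^ 12))"
  proof -
    let ?x = "\<i> * q ^ 4" and ?y = "\<i>" and ?u = "-(\<i> * q ^ 3)" and ?v = "\<i> * q ^ 2"
    have e: "?x * ?y = -(q ^ 4)" "?x / ?y = q ^ 4" "?u * ?v = q ^ 5" "?u / ?v = -(q ^ 1)" "?x * ?v = -(q ^ 6)"
      "?x / ?v = q ^ 2" "?u * ?y = q ^ 3" "?u / ?y = -(q ^ 3)" "?y * ?v = -(q ^ 2)" "?y / ?v = 1 / q ^ 2"
      "?x * ?u = q ^ 7" "?x / ?u = -(q ^ 1)"
      using q by (simp_all add: ii eval_nat_numeral)
    have nz: "?x \<noteq> 0" "?y \<noteq> 0" "?u \<noteq> 0" "?v \<noteq> 0" using q by auto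
    have s: "-(q ^ 3) * (A * - (B / q ^ 2) * C) = q * (A * B * C)" for A B C
      using q by (simp add: eval_nat_numeral)
    note T = theta_addition[OF b12 nz, unfolded e sym inv]
    show ?thesis using T P[of 5 12] P[of 2 12]
      unfolding minus_divide_left[symmetric] s by (simp add: algebra_simps)
  qed
qed

text \<open>In each theta relation the terms are a common monomial (K, M or N in the proof) times two of the theta series; after division by it the third term is the asserted product.\<close>

lemma qsum_combinations:
  assumes q: "norm q < 1" "q \<noteq> 0"
  shows "qsum 1 0 (q ^ 2) + qsum 3 0 (q ^ 2) = 2 * J q 4 ^ 2 * JJ q 10 24 / (J q 2 * J q 8)"
    and "qsum 1 0 (q ^ 2) - qsum 3 0 (q ^ 2) =
           2 * q ^ 2 * J q 4 * J q 12 * J q 24 ^ 2 / (J q 6 * J q 8 * JJ q 10 24)"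
    and "qsum 1 1 (q ^ 2) + q * qsum 3 3 (q ^ 2) =
           2 * J q 2 ^ 2 * J q 3 * J q 8 * J q 12 ^ 2 * JJ q 5 12 ^ 2 / (J q 1 * J q 4 ^ 2 * J q 6 ^ 3 * JJ q 10 24)"
    and "qsum 1 1 (q ^ 2) - q * qsum 3 3 (q ^ 2) =
           2 * J q 1 * J q 8 * J q 12 ^ 5 * JJ q 10 24 / (J q 2 * J q 3 * J q 4 * J q 24 ^ 2 * JJ q 5 12 ^ 2)"
proof -
  note nz = J_nonzero[OF q(1)] JJ_nonzero[OF q(1)]
  define j1 j2 j3 j4 j6 j8 j12 j24 X Y where
    "j1 = J q 1" "j2 = J q 2" "j3 = J q 3" "j4 = J q 4" "j6 = J q 6" "j8 = J q 8" "j12 = J q 12"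
    "j24 = J q 24" "X = JJ q 10 24" "Y = JJ q 5 12"
  note df = this
  have n: "j1 \<noteq> 0" "j2 \<noteq> 0" "j3 \<noteq> 0" "j4 \<noteq> 0" "j6 \<noteq> 0" "j8 \<noteq> 0" "j12 \<noteq> 0" "j24 \<noteq> 0" "X \<noteq> 0" "Y \<noteq> 0"
    unfolding df using nz by auto
  have Z: "JJ q 2 24 = j24 ^ 2 * j2 * j12 / (j4 * j6 * X)"
    using JJ_relations(1)[OF q(1)] n unfolding df by (simp add: field_simps)
  have W: "JJ q 1 12 = j12 ^ 2 * j1 * j6 / (j2 * j3 * Y)"
    using JJ_relations(5)[OF q(1)] n unfolding df by (simp add: field_simps)
  note R = theta_relations[OF q, unfolded theta_products_24[OF q] theta_products_12[OF q] JJ_relations(2-4,7)[OF q(1)] Z W, folded df]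
  note S = qsum_products[OF q, folded df]
  \<comment> \<open>K, M and N are the quotients of the first terms of the relations by the corresponding theta series.\<close>
  define K M N where "K = j2 * j6 * j8 * j24 ^ 5 / (j4 ^ 2 * j12 ^ 3)"
    and "M = j12 ^ 6 * j1 * j4 * j6 * X / (2 * j2 * j3 * j8 * j24 ^ 2 * Y ^ 2)"
    and "N = j2 ^ 2 * j3 * j12 ^ 3 * Y ^ 2 / (2 * j1 * j6 ^ 2 * j8 * X)"
  have KMN: "K \<noteq> 0" "M \<noteq> 0" "N \<noteq> 0" using n by (simp_all add: K_def M_def N_def)
  have cancel: "a + b = c" if "C = A + B" "A = k * a" "B = k * b" "C = k * c" "k \<noteq> 0" for a b c A B C k :: complex
    using that by (metis distrib_left mult_cancel_left)
  have cancel': "a - b = c" if "A - B = C" "A = k * a" "B = k * b" "C = k * c" "k \<noteq> 0" for a b c A B C k :: complex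
    using that by (metis right_diff_distrib mult_cancel_left)
  note fs = K_def M_def N_def field_simps power_numeral_reduce
  show "qsum 1 0 (q ^ 2) + qsum 3 0 (q ^ 2) = 2 * J q 4 ^ 2 * JJ q 10 24 / (J q 2 * J q 8)"
    unfolding S df[symmetric] by (rule cancel[OF R(1) _ _ _ KMN(1)]) (use n in \<open>simp_all add: fs\<close>)
  show "qsum 1 0 (q ^ 2) - qsum 3 0 (q ^ 2) =
           2 * q ^ 2 * J q 4 * J q 12 * J q 24 ^ 2 / (J q 6 * J q 8 * JJ q 10 24)"
    unfolding S df[symmetric] by (rule cancel'[OF R(2) _ _ _ KMN(1)]) (use n in \<open>simp_all add: fs\<close>)
  show "qsum 1 1 (q ^ 2) + q * qsum 3 3 (q ^ 2) =
           2 * J q 2 ^ 2 * J q 3 * J q 8 * J q 12 ^ 2 * JJ q 5 12 ^ 2 / (J q 1 * J q 4 ^ 2 * J q 6 ^ 3 * JJ q 10 24)"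
    unfolding S df[symmetric] by (rule cancel[OF R(3)[symmetric] _ _ _ KMN(2)]) (use n in \<open>simp_all add: fs\<close>)
  show "qsum 1 1 (q ^ 2) - q * qsum 3 3 (q ^ 2) =
           2 * J q 1 * J q 8 * J q 12 ^ 5 * JJ q 10 24 / (J q 2 * J q 3 * J q 4 * J q 24 ^ 2 * JJ q 5 12 ^ 2)"
    unfolding S df[symmetric] by (rule cancel'[OF R(4) _ _ _ KMN(3)]) (use n in \<open>simp_all add: fs\<close>)
qed

theorem theorem1p5:
  fixes q :: complex
  assumes "0 < norm q" and "norm q < 1"
  shows
    "chi_sq [1, 1, 1, 1] q =
       qpoch_inf (-q) (q^2) / qpoch_inf (q^2) (q^2) *
       (J q 4 ^ 5 * J q 12 * JJ q 4 24 * JJ q 10 24 /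
          (J q 1 * J q 2 ^ 2 * J q 8 ^ 2 * J q 24 ^ 2)
        + 2 * q * (J q 8 ^ 2 * J q 12 * JJ q 5 12 * JJ q 2 24 ^ 2 * JJ q 10 24 /
          (J q 1 * J q 4 * JJ q 1 12 * JJ q 4 24 * J q 24 ^ 2)))
   \<and> chi_sq [1, q powi (-2), q^2, 1] q =
       qpoch_inf (-q) (q^2) / qpoch_inf (q^2) (q^2) *
       (J q 4 ^ 5 * J q 24 ^ 3 /
          (J q 1 * J q 2 * J q 8 ^ 3 * JJ q 2 24 * JJ q 10 24)
        + 2 * (J q 2 * J q 8 * J q 24 ^ 3 /
          (J q 1 * J q 4 * JJ q 4 24 ^ 2)))
   \<and> chi_sq [1, 1, 1, q] q =
       qpoch_inf (-(q^2)) (q^2) / qpoch_inf (q^2) (q^2) *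
       (J q 4 ^ 5 * J q 12 ^ 6 /
          (J q 2 ^ 3 * J q 6 ^ 3 * J q 8 ^ 2 * JJ q 2 24 * JJ q 10 24)
        + 4 * q^2 * (J q 8 ^ 2 * J q 24 ^ 4 /
          (J q 2 * J q 4 * J q 6 * JJ q 2 24 * JJ q 10 24)))
   \<and> chi_sq [q^2, q powi (-2), q^2, 1] q =
       qpoch_inf (-q) (q^2) / qpoch_inf (q^2) (q^2) *
       (q * (J q 4 ^ 5 * J q 24 ^ 3 /
          (J q 1 * J q 2 * J q 8 ^ 3 * JJ q 6 24 * JJ q 10 24))
        + 2 * (J q 8 ^ 3 * J q 12 ^ 3 * J q 24 ^ 2 * JJ q 10 24 /
          (J q 3 * J q 4 ^ 3 * JJ q 5 24 ^ 2 * JJ q 7 24 ^ 2)))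
   \<and> ((\<forall>p :: complex. norm p < 1 \<longrightarrow>
         (\<Sum>\<^sub>\<infinity>(n1, n2, n3) \<in> (UNIV :: (nat \<times> nat \<times> nat) set).
            p powi (4 * int n1 ^ 2 + 4 * int n1 * int n2 + 3 * int n2 ^ 2
                    - 2 * int n2 * int n3 + int n3 ^ 2 + 4 * int n1 + 2 * int n2) /
            (qpoch (p^4) (p^4) n1 * qpoch (p^4) (p^4) n2 * qpoch (p^4) (p^4) n3))
         = qpoch_inf (p^6) (p^6) * qpoch_inf (p^8) (p^8) * qpochs_inf [p^2, p^10] (p^12) /
           (qpoch_inf (p^4) (p^4) ^ 2 * qpochs_inf [p, p^11] (p^12)
              * qpochs_inf [p^5, p^7] (p^12)))
      \<longrightarrow> chi_sq [q^2, q powi (-2), q^2, q powi (-1)] q =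
         qpoch_inf (-1) (q^2) / qpoch_inf (q^2) (q^2) *
         (J q 4 ^ 5 * J q 12 ^ 2 * J q 24 ^ 7 /
            (J q 2 ^ 2 * J q 6 ^ 2 * J q 8 ^ 3 * JJ q 2 24 ^ 3 * JJ q 10 24 ^ 3)
          + 2 * (J q 8 ^ 3 * J q 12 ^ 2 / (J q 2 ^ 2 * J q 4 * J q 24))))"
proof -
  have q: "norm q < 1" "q \<noteq> 0" using assms by auto
  note nz = J_nonzero[OF q(1)] JJ_nonzero[OF q(1)]
  define j1 j2 j3 j4 j6 j8 j12 j24 X Y where
    "j1 = J q 1" "j2 = J q 2" "j3 = J q 3" "j4 = J q 4" "j6 = J q 6" "j8 = J q 8" "j12 = J q 12"
    "j24 = J q 24" "X = JJ q 10 24" "Y = JJ q 5 12"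
  note df = this
  have n: "j1 \<noteq> 0" "j2 \<noteq> 0" "j3 \<noteq> 0" "j4 \<noteq> 0" "j6 \<noteq> 0" "j8 \<noteq> 0" "j12 \<noteq> 0" "j24 \<noteq> 0" "X \<noteq> 0" "Y \<noteq> 0"
    unfolding df using nz by auto
  have Z: "JJ q 2 24 = j24 ^ 2 * j2 * j12 / (j4 * j6 * X)"
    using JJ_relations(1)[OF q(1)] n unfolding df by (simp add: field_simps)
  have W: "JJ q 1 12 = j12 ^ 2 * j1 * j6 / (j2 * j3 * Y)"
    using JJ_relations(5)[OF q(1)] n unfolding df by (simp add: field_simps)
  have V: "a * JJ q 5 24 ^ 2 * JJ q 7 24 ^ 2 = a * (j24 ^ 2 * Y / j12) ^ 2" for a
    using JJ_relations(6)[OF q(1)] unfolding df by (simp add: mult.assoc flip: power_mult_distrib)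
  note F = JJ_relations(2,3)[OF q(1), folded df] Z W V df[symmetric]
  note S = qsum_products[OF q, folded df] 
  note T = qsum_combinations[OF q, folded df]
  note Q = qpoch_products[OF q, folded df]
  \<comment> \<open>The two summands of each formula match separately, in the last two formulas in the opposite order.\<close>
  have split: "a * p * (s + r) = a * (A + B)" if "p * s = A" "p * r = B" for a p s r A B :: complex
    using that by (simp add: distrib_left mult.assoc)
  have split': "a * p * (s + r) = a * (B + A)" if "p * s = A" "p * r = B" for a p s r A B :: complex
    using that by (simp add: distrib_left mult.assoc add.commute)
  note fs = field_simps power_numeral_reduce
  show ?thesis
  proof (intro conjI impI)
    show "chi_sq [1, 1, 1, 1] q =
       qpoch_inf (-q) (q^2) / qpoch_inf (q^2) (q^2) *
       (J q 4 ^ 5 * J q 12 * JJ q 4 24 * JJ q 10 24 /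
          (J q 1 * J q 2 ^ 2 * J q 8 ^ 2 * J q 24 ^ 2)
        + 2 * q * (J q 8 ^ 2 * J q 12 * JJ q 5 12 * JJ q 2 24 ^ 2 * JJ q 10 24 /
          (J q 1 * J q 4 * JJ q 1 12 * JJ q 4 24 * J q 24 ^ 2)))"
      unfolding chi_0_0_0_0[OF q refl]
      by (rule split; (unfold T, unfold S Q F, insert n q(2), simp add: fs))
    show "chi_sq [1, q powi (-2), q^2, 1] q =
       qpoch_inf (-q) (q^2) / qpoch_inf (q^2) (q^2) *
       (J q 4 ^ 5 * J q 24 ^ 3 /
          (J q 1 * J q 2 * J q 8 ^ 3 * JJ q 2 24 * JJ q 10 24)
        + 2 * (J q 2 * J q 8 * J q 24 ^ 3 /
          (J q 1 * J q 4 * JJ q 4 24 ^ 2)))"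
      unfolding chi_0_m2_2_0[OF q refl]
      by (rule split; (unfold S Q F, insert n q(2), simp add: fs))
    show "chi_sq [1, 1, 1, q] q =
       qpoch_inf (-(q^2)) (q^2) / qpoch_inf (q^2) (q^2) *
       (J q 4 ^ 5 * J q 12 ^ 6 /
          (J q 2 ^ 3 * J q 6 ^ 3 * J q 8 ^ 2 * JJ q 2 24 * JJ q 10 24)
        + 4 * q^2 * (J q 8 ^ 2 * J q 24 ^ 4 /
          (J q 2 * J q 4 * J q 6 * JJ q 2 24 * JJ q 10 24)))"
      unfolding chi_0_0_0_1[OF q refl]
      by (rule split; (unfold S Q F, insert n q(2), simp add: fs))
    show "chi_sq [q^2, q powi (-2), q^2, 1] q =
       qpoch_inf (-q) (q^2) / qpoch_inf (q^2) (q^2) *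
       (q * (J q 4 ^ 5 * J q 24 ^ 3 /
          (J q 1 * J q 2 * J q 8 ^ 3 * JJ q 6 24 * JJ q 10 24))
        + 2 * (J q 8 ^ 3 * J q 12 ^ 3 * J q 24 ^ 2 * JJ q 10 24 /
          (J q 3 * J q 4 ^ 3 * JJ q 5 24 ^ 2 * JJ q 7 24 ^ 2)))"
      unfolding chi_2_m2_2_0[OF q refl]
      by (rule split'; (unfold T, unfold S Q F, insert n q(2), simp add: fs))
    show "chi_sq [q^2, q powi (-2), q^2, q powi (-1)] q =
         qpoch_inf (-1) (q^2) / qpoch_inf (q^2) (q^2) *
         (J q 4 ^ 5 * J q 12 ^ 2 * J q 24 ^ 7 /
            (J q 2 ^ 2 * J q 6 ^ 2 * J q 8 ^ 3 * JJ q 2 24 ^ 3 * JJ q 10 24 ^ 3)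
          + 2 * (J q 8 ^ 3 * J q 12 ^ 2 / (J q 2 ^ 2 * J q 4 * J q 24)))"
      unfolding chi_2_m2_2_m1[OF q refl]
      by (rule split'; (unfold S Q F, insert n q(2), simp add: fs))
  qed
qed

end
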